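(* The comparison 2-functor $$\Gamma\colon\mathbf{SCoFib}\longrightarrow\mathbf{Alg}_{\mathrm s}(\mathbb C),\qquad P\longmapsto(P,L^P),$$ is an isomorphism of 2-categories over $\mathbf{CAT}^{\mathbf 2}$. Consequently the forgetful 2-functor $U\colon\mathbf{SCoFib}\to\mathbf{CAT}^{\mathbf 2}$ is strictly 2-monadic.
   Context: $\mathbf{CAT}$ is the strict 2-category of locally small categories, functors and natural transformations. $\mathbf{CAT}^{\mathbf 2}$ is the strict arrow 2-category: objects are functors $P\colon E\to B$; a 1-cell $(T,S)\colon P\to Q$, with $Q\colon F\to C$, is a pair of functors $T\colon E\to F$, $S\colon B\to C$ with $QT=SP$; a 2-cell $(\beta,\alpha)\colon(T,S)\Rightarrow(T',S')$ is a pair of natural transformations $\beta\colon T\Rightarrow T'$, $\alpha\colon S\Rightarrow S'$ with $Q\beta=\alpha P$; compositions are componentwise. **Split cofibrations.** For $P\colon E\to B$, an arrow $e\colon x\to y$ of $E$ is $P$-cocartesian if for all $g\colon x\to z$ and $v\colon Py\to Pz$ with $Pg=v\,Pe$ there is a unique $h\colon y\to z$ with $he=g$, $Ph=v$. A cleavage chooses, for each $x\in E$ and $u\colon Px\to b$, a $P$-cocartesian arrow $\delta^x_u\colon x\to u_!x$ with $P\delta^x_u=u$. For $u\colon a\to b$ it induces a functor $u_!\colon E_a\to E_b$ between fibres: for vertical $f\colon x\to y$ ($Pf$ an identity), $u_!f$ is the unique vertical arrow with $(u_!f)\delta^x_u=\delta^y_uf$. It is normal if $\delta^x_{1_{Px}}=1_x$;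 split if normal and $(vu)_!=v_!u_!$, $\delta^x_{vu}=\delta^{u_!x}_v\delta^x_u$ whenever defined. A split cofibration is a functor with a split cleavage. $\mathbf{SCoFib}$ has split cofibrations as objects, squares $(T,S)\colon P\to Q$ with $T\delta^x_u=\delta^{Tx}_{Su}$ for all $x$, $u$ as 1-cells, and all 2-cells of $\mathbf{CAT}^{\mathbf 2}$ between them. **Comma 2-monad.** $P\downarrow B$ has objects $(x,u)$ with $x\in E$, $u\colon Px\to b$; an arrow $(f,v)\colon(x,u)\to(y,w)$ consists of $f\colon x\to y$, $v\colon b\to c$ with $vu=w\,Pf$. The 2-monad $\mathbb C$ on $\mathbf{CAT}^{\mathbf 2}$: $\mathbb CP=\mathrm{Cod}_P\colon P\downarrow B\to B$, $(x,u)\mapsto b$, $(f,v)\mapsto v$; $\mathbb C(T,S)=(\overline T,S)$ with $\overline T(x,u)=(Tx,Su)$, $\overline T(f,v)=(Tf,Sv)$; $\mathbb C(\beta,\alpha)=(\overline\beta,\alpha)$ with $\overline\beta_{(x,u)}=(\beta_x,\alpha_b)$; unit $(H^P,1_B)$, $H^Px=(x,1_{Px})$, $H^Pf=(f,Pf)$; multiplication $(M^P,1_B)$, $M^P((x,u),v)=(x,vu)$, $M^P((f,r),s)=(f,s)$. **Strict algebras.** For a strict 2-monad $\mathbb T=(\mathbb T,\eta,\mu)$ on $\mathcal K$, $\mathbf{Alg}_{\mathrm s}(\mathbb T)$ has objects $a\colon\mathbb TX\to X$ with $a\eta_X=1_X$, $a\mu_X=a\,\mathbb Ta$; 1-cells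 $f\colon(X,a)\to(Y,b)$ the 1-cells of $\mathcal K$ with $fa=b\,\mathbb Tf$; 2-cells $\alpha\colon f\Rightarrow g$ the 2-cells of $\mathcal K$ with $\alpha a=b\,\mathbb T\alpha$. For $\mathbb C$ the base component of an action is forced to be $1_B$, so a strict $\mathbb C$-algebra is written $(P,A)$ with action $(A,1_B)\colon\mathbb CP\to P$. **The functor $L^P$.** For a cloven cofibration $P$, $L^P\colon P\downarrow B\to E$ is the unique functor with $L^P(x,u)=u_!x$, $PL^P=\mathrm{Cod}_P$ and $L^P(f,v)\,\delta^x_u=\delta^y_wf$ for every $(f,v)\colon(x,u)\to(y,w)$. $\Gamma$ leaves underlying squares and 2-cells unchanged. "Over $\mathbf{CAT}^{\mathbf 2}$" means commuting strictly with the forgetful 2-functors. A 2-functor $U\colon\mathcal A\to\mathcal K$ with left 2-adjoint $F$, counit $\varepsilon$ and induced 2-monad $\mathbb T$ is strictly 2-monadic if the comparison 2-functor $\mathcal A\to\mathbf{Alg}_{\mathrm s}(\mathbb T)$, sending $A$ to the action $U\varepsilon_A\colon\mathbb TUA\to UA$, is an isomorphism of 2-categories over $\mathcal K$. (Here the left 2-adjoint sends $P$ to $\mathbb CP$ with the split cleavage $(1_x,v)\colon(x,u)\to(x,vu)$, the counit at $P$ is $(L^P,1_B)$, and the induced 2-monad is $\mathbb C$.) *)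

theory Defs
  imports Main "HOL-Library.FuncSet" "HOL-Library.Infinite_Typeclass" "HOL-Library.Equipollence"
begin

section \<open>Strict 2-categories, 2-functors, 2-monads\<close>

text \<open>The projections and operations of the records below are only meaningful on cells; laws and
  equalities are always relativised to cells. Composition is written in the classical order, so
  \<open>comp1 K g f\<close> is \<open>g f\<close>, and likewise for \<open>vcomp\<close> and \<open>hcomp\<close>.\<close>

record ('o, 'm, 'c) twocat =
  C0 :: "'o set"
  C1 :: "'m set"
  C2 :: "'c set"
  s1 :: "'m \<Rightarrow> 'o"
  t1 :: "'m \<Rightarrow> 'o"
  s2 :: "'c \<Rightarrow> 'm"
  t2 :: "'c \<Rightarrow> 'm"
  id1 :: "'o \<Rightarrow> 'm"
  id2 :: "'m \<Rightarrow> 'c"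
  comp1 :: "'m \<Rightarrow> 'm \<Rightarrow> 'm"
  vcomp :: "'c \<Rightarrow> 'c \<Rightarrow> 'c"
  hcomp :: "'c \<Rightarrow> 'c \<Rightarrow> 'c"

locale two_category =
  fixes K :: "('o, 'm, 'c) twocat"
  assumes s1_in: "f \<in> C1 K \<Longrightarrow> s1 K f \<in> C0 K"
    and t1_in: "f \<in> C1 K \<Longrightarrow> t1 K f \<in> C0 K"
    and s2_in: "a \<in> C2 K \<Longrightarrow> s2 K a \<in> C1 K"
    and t2_in: "a \<in> C2 K \<Longrightarrow> t2 K a \<in> C1 K"
    and s1_t2: "a \<in> C2 K \<Longrightarrow> s1 K (t2 K a) = s1 K (s2 K a)"
    and t1_t2: "a \<in> C2 K \<Longrightarrow> t1 K (t2 K a) = t1 K (s2 K a)"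
    and id1_in: "X \<in> C0 K \<Longrightarrow> id1 K X \<in> C1 K"
    and s1_id1: "X \<in> C0 K \<Longrightarrow> s1 K (id1 K X) = X"
    and t1_id1: "X \<in> C0 K \<Longrightarrow> t1 K (id1 K X) = X"
    and id2_in: "f \<in> C1 K \<Longrightarrow> id2 K f \<in> C2 K"
    and s2_id2: "f \<in> C1 K \<Longrightarrow> s2 K (id2 K f) = f"
    and t2_id2: "f \<in> C1 K \<Longrightarrow> t2 K (id2 K f) = f"
    and comp1_in: "\<lbrakk>f \<in> C1 K; g \<in> C1 K; t1 K f = s1 K g\<rbrakk> \<Longrightarrow> comp1 K g f \<in> C1 K"
    and s1_comp1: "\<lbrakk>f \<in> C1 K; g \<in> C1 K; t1 K f = s1 K g\<rbrakk> \<Longrightarrow> s1 K (comp1 K g f) = s1 K f"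
    and t1_comp1: "\<lbrakk>f \<in> C1 K; g \<in> C1 K; t1 K f = s1 K g\<rbrakk> \<Longrightarrow> t1 K (comp1 K g f) = t1 K g"
    and comp1_id_right: "f \<in> C1 K \<Longrightarrow> comp1 K f (id1 K (s1 K f)) = f"
    and comp1_id_left: "f \<in> C1 K \<Longrightarrow> comp1 K (id1 K (t1 K f)) f = f"
    and comp1_assoc:
      "\<lbrakk>f \<in> C1 K; g \<in> C1 K; h \<in> C1 K; t1 K f = s1 K g; t1 K g = s1 K h\<rbrakk>
        \<Longrightarrow> comp1 K h (comp1 K g f) = comp1 K (comp1 K h g) f"
    and vcomp_in: "\<lbrakk>a \<in> C2 K; b \<in> C2 K; t2 K a = s2 K b\<rbrakk> \<Longrightarrow> vcomp K b a \<in> C2 K"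
    and s2_vcomp: "\<lbrakk>a \<in> C2 K; b \<in> C2 K; t2 K a = s2 K b\<rbrakk> \<Longrightarrow> s2 K (vcomp K b a) = s2 K a"
    and t2_vcomp: "\<lbrakk>a \<in> C2 K; b \<in> C2 K; t2 K a = s2 K b\<rbrakk> \<Longrightarrow> t2 K (vcomp K b a) = t2 K b"
    and vcomp_id_right: "a \<in> C2 K \<Longrightarrow> vcomp K a (id2 K (s2 K a)) = a"
    and vcomp_id_left: "a \<in> C2 K \<Longrightarrow> vcomp K (id2 K (t2 K a)) a = a"
    and vcomp_assoc:
      "\<lbrakk>a \<in> C2 K; b \<in> C2 K; c \<in> C2 K; t2 K a = s2 K b; t2 K b = s2 K c\<rbrakk>
        \<Longrightarrow> vcomp K c (vcomp K b a) = vcomp K (vcomp K c b) a"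
    and hcomp_in:
      "\<lbrakk>a \<in> C2 K; b \<in> C2 K; t1 K (s2 K a) = s1 K (s2 K b)\<rbrakk> \<Longrightarrow> hcomp K b a \<in> C2 K"
    and s2_hcomp:
      "\<lbrakk>a \<in> C2 K; b \<in> C2 K; t1 K (s2 K a) = s1 K (s2 K b)\<rbrakk>
        \<Longrightarrow> s2 K (hcomp K b a) = comp1 K (s2 K b) (s2 K a)"
    and t2_hcomp:
      "\<lbrakk>a \<in> C2 K; b \<in> C2 K; t1 K (s2 K a) = s1 K (s2 K b)\<rbrakk>
        \<Longrightarrow> t2 K (hcomp K b a) = comp1 K (t2 K b) (t2 K a)"
    and hcomp_id_right: "a \<in> C2 K \<Longrightarrow> hcomp K a (id2 K (id1 K (s1 K (s2 K a)))) = a"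
    and hcomp_id_left: "a \<in> C2 K \<Longrightarrow> hcomp K (id2 K (id1 K (t1 K (s2 K a)))) a = a"
    and hcomp_assoc:
      "\<lbrakk>a \<in> C2 K; b \<in> C2 K; c \<in> C2 K;
        t1 K (s2 K a) = s1 K (s2 K b); t1 K (s2 K b) = s1 K (s2 K c)\<rbrakk>
        \<Longrightarrow> hcomp K c (hcomp K b a) = hcomp K (hcomp K c b) a"
    and hcomp_id2:
      "\<lbrakk>f \<in> C1 K; g \<in> C1 K; t1 K f = s1 K g\<rbrakk>
        \<Longrightarrow> hcomp K (id2 K g) (id2 K f) = id2 K (comp1 K g f)"
    and interchange:
      "\<lbrakk>a \<in> C2 K; a' \<in> C2 K; b \<in> C2 K; b' \<in> C2 K;
        t2 K a = s2 K a'; t2 K b = s2 K b'; t1 K (s2 K a) = s1 K (s2 K b)\<rbrakk>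
        \<Longrightarrow> hcomp K (vcomp K b' b) (vcomp K a' a) = vcomp K (hcomp K b' a') (hcomp K b a)"

record ('o, 'm, 'c, 'p, 'n, 'd) twofun =
  F0 :: "'o \<Rightarrow> 'p"
  F1 :: "'m \<Rightarrow> 'n"
  F2 :: "'c \<Rightarrow> 'd"

locale two_functor = A: two_category A + B: two_category B
  for A :: "('o, 'm, 'c) twocat" and B :: "('p, 'n, 'd) twocat" +
  fixes F :: "('o, 'm, 'c, 'p, 'n, 'd) twofun"
  assumes F0_in: "X \<in> C0 A \<Longrightarrow> F0 F X \<in> C0 B"
    and F1_in: "f \<in> C1 A \<Longrightarrow> F1 F f \<in> C1 B"
    and F2_in: "a \<in> C2 A \<Longrightarrow> F2 F a \<in> C2 B"
    and F_s1: "f \<in> C1 A \<Longrightarrow> s1 B (F1 F f) = F0 F (s1 A f)"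
    and F_t1: "f \<in> C1 A \<Longrightarrow> t1 B (F1 F f) = F0 F (t1 A f)"
    and F_s2: "a \<in> C2 A \<Longrightarrow> s2 B (F2 F a) = F1 F (s2 A a)"
    and F_t2: "a \<in> C2 A \<Longrightarrow> t2 B (F2 F a) = F1 F (t2 A a)"
    and F_id1: "X \<in> C0 A \<Longrightarrow> F1 F (id1 A X) = id1 B (F0 F X)"
    and F_id2: "f \<in> C1 A \<Longrightarrow> F2 F (id2 A f) = id2 B (F1 F f)"
    and F_comp1:
      "\<lbrakk>f \<in> C1 A; g \<in> C1 A; t1 A f = s1 A g\<rbrakk>
        \<Longrightarrow> F1 F (comp1 A g f) = comp1 B (F1 F g) (F1 F f)"
    and F_vcomp:
      "\<lbrakk>a \<in> C2 A; b \<in> C2 A; t2 A a = s2 A b\<rbrakk>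
        \<Longrightarrow> F2 F (vcomp A b a) = vcomp B (F2 F b) (F2 F a)"
    and F_hcomp:
      "\<lbrakk>a \<in> C2 A; b \<in> C2 A; t1 A (s2 A a) = s1 A (s2 A b)\<rbrakk>
        \<Longrightarrow> F2 F (hcomp A b a) = hcomp B (F2 F b) (F2 F a)"

definition tf_id :: "('o, 'm, 'c, 'o, 'm, 'c) twofun" where
  "tf_id = \<lparr>F0 = \<lambda>X. X, F1 = \<lambda>f. f, F2 = \<lambda>a. a\<rparr>"

definition tf_comp ::
  "('p, 'n, 'd, 'q, 'l, 'e) twofun \<Rightarrow> ('o, 'm, 'c, 'p, 'n, 'd) twofun \<Rightarrow> ('o, 'm, 'c, 'q, 'l, 'e) twofun"
where
  "tf_comp G F = \<lparr>F0 = F0 G \<circ> F0 F, F1 = F1 G \<circ> F1 F, F2 = F2 G \<circ> F2 F\<rparr>"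

definition tf_eq ::
  "('o, 'm, 'c) twocat \<Rightarrow> ('o, 'm, 'c, 'p, 'n, 'd) twofun \<Rightarrow> ('o, 'm, 'c, 'p, 'n, 'd) twofun \<Rightarrow> bool"
where
  "tf_eq A F G \<longleftrightarrow> (\<forall>X\<in>C0 A. F0 F X = F0 G X) \<and> (\<forall>f\<in>C1 A. F1 F f = F1 G f)
     \<and> (\<forall>a\<in>C2 A. F2 F a = F2 G a)"

definition two_iso ::
  "('o, 'm, 'c) twocat \<Rightarrow> ('p, 'n, 'd) twocat \<Rightarrow> ('o, 'm, 'c, 'p, 'n, 'd) twofun \<Rightarrow> bool"
where
  "two_iso A B F \<longleftrightarrow> two_functor A B F \<and>
     (\<exists>G. two_functor B A G \<and> tf_eq A (tf_comp G F) tf_id \<and> tf_eq B (tf_comp F G) tf_id)"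

text \<open>Isomorphism \<open>F : A \<rightarrow> B\<close> over \<open>K\<close>, where \<open>U : A \<rightarrow> K\<close> and \<open>V : B \<rightarrow> K\<close>.\<close>

definition two_iso_over ::
  "('q, 'l, 'e) twocat \<Rightarrow> ('o, 'm, 'c) twocat \<Rightarrow> ('o, 'm, 'c, 'q, 'l, 'e) twofun
    \<Rightarrow> ('p, 'n, 'd) twocat \<Rightarrow> ('p, 'n, 'd, 'q, 'l, 'e) twofun
    \<Rightarrow> ('o, 'm, 'c, 'p, 'n, 'd) twofun \<Rightarrow> bool"
where
  "two_iso_over K A U B V F \<longleftrightarrow>
     two_functor A K U \<and> two_functor B K V \<and> two_iso A B F \<and> tf_eq A (tf_comp V F) U"

locale two_natural = F: two_functor A B F + G: two_functor A B G
  for A :: "('o, 'm, 'c) twocat" and B :: "('p, 'n, 'd) twocat"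
    and F :: "('o, 'm, 'c, 'p, 'n, 'd) twofun" and G :: "('o, 'm, 'c, 'p, 'n, 'd) twofun" +
  fixes \<sigma> :: "'o \<Rightarrow> 'n"
  assumes component_in: "X \<in> C0 A \<Longrightarrow> \<sigma> X \<in> C1 B"
    and s1_component: "X \<in> C0 A \<Longrightarrow> s1 B (\<sigma> X) = F0 F X"
    and t1_component: "X \<in> C0 A \<Longrightarrow> t1 B (\<sigma> X) = F0 G X"
    and natural1:
      "f \<in> C1 A \<Longrightarrow> comp1 B (F1 G f) (\<sigma> (s1 A f)) = comp1 B (\<sigma> (t1 A f)) (F1 F f)"
    and natural2:
      "a \<in> C2 A \<Longrightarrow> hcomp B (F2 G a) (id2 B (\<sigma> (s1 A (s2 A a))))
                  = hcomp B (id2 B (\<sigma> (t1 A (s2 A a)))) (F2 F a)"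

record ('o, 'm, 'c) twomonad =
  mfun :: "('o, 'm, 'c, 'o, 'm, 'c) twofun"
  munit :: "'o \<Rightarrow> 'm"
  mmult :: "'o \<Rightarrow> 'm"

locale two_monad =
  T: two_functor K K "mfun T" +
  \<eta>: two_natural K K tf_id "mfun T" "munit T" +
  \<mu>: two_natural K K "tf_comp (mfun T) (mfun T)" "mfun T" "mmult T"
  for K :: "('o, 'm, 'c) twocat" and T :: "('o, 'm, 'c) twomonad" +
  assumes unit_left:
      "X \<in> C0 K \<Longrightarrow> comp1 K (mmult T X) (munit T (F0 (mfun T) X)) = id1 K (F0 (mfun T) X)"
    and unit_right:
      "X \<in> C0 K \<Longrightarrow> comp1 K (mmult T X) (F1 (mfun T) (munit T X)) = id1 K (F0 (mfun T) X)"
    and mult_assoc: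
      "X \<in> C0 K \<Longrightarrow> comp1 K (mmult T X) (mmult T (F0 (mfun T) X))
                  = comp1 K (mmult T X) (F1 (mfun T) (mmult T X))"

definition tm_eq :: "('o, 'm, 'c) twocat \<Rightarrow> ('o, 'm, 'c) twomonad \<Rightarrow> ('o, 'm, 'c) twomonad \<Rightarrow> bool"
where
  "tm_eq K S T \<longleftrightarrow> tf_eq K (mfun S) (mfun T) \<and>
     (\<forall>X\<in>C0 K. munit S X = munit T X \<and> mmult S X = mmult T X)"

text \<open>The 2-adjunction \<open>F \<stileturn> U : A \<rightarrow> K\<close>.\<close>

locale two_adjunction =
  F: two_functor K A F +
  U: two_functor A K U +
  \<eta>: two_natural K K tf_id "tf_comp U F" \<eta> +
  \<epsilon>: two_natural A A "tf_comp F U" tf_id \<epsilon>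
  for A :: "('p, 'n, 'd) twocat" and K :: "('o, 'm, 'c) twocat"
    and F :: "('o, 'm, 'c, 'p, 'n, 'd) twofun" and U :: "('p, 'n, 'd, 'o, 'm, 'c) twofun"
    and \<eta> :: "'o \<Rightarrow> 'm" and \<epsilon> :: "'p \<Rightarrow> 'n" +
  assumes triangle_F: "X \<in> C0 K \<Longrightarrow> comp1 A (\<epsilon> (F0 F X)) (F1 F (\<eta> X)) = id1 A (F0 F X)"
    and triangle_U: "Z \<in> C0 A \<Longrightarrow> comp1 K (F1 U (\<epsilon> Z)) (\<eta> (F0 U Z)) = id1 K (F0 U Z)"

definition induced_monad ::
  "('o, 'm, 'c, 'p, 'n, 'd) twofun \<Rightarrow> ('p, 'n, 'd, 'o, 'm, 'c) twofun
    \<Rightarrow> ('o \<Rightarrow> 'm) \<Rightarrow> ('p \<Rightarrow> 'n) \<Rightarrow> ('o, 'm, 'c) twomonad"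
where
  "induced_monad F U \<eta> \<epsilon> =
     \<lparr>mfun = tf_comp U F, munit = \<eta>, mmult = (\<lambda>X. F1 U (\<epsilon> (F0 F X)))\<rparr>"

text \<open>The 2-category of structured objects of \<open>K\<close>: \<open>und\<close> gives the underlying object of an element
  of \<open>S\<close>, and the cells are those cells of \<open>K\<close> between underlying objects that satisfy \<open>R1\<close>,
  resp. \<open>R2\<close>. A cell is tagged with its source and target in \<open>S\<close>.\<close>

definition structured ::
  "('o, 'm, 'c) twocat \<Rightarrow> 'z set \<Rightarrow> ('z \<Rightarrow> 'o) \<Rightarrow> ('z \<Rightarrow> 'm \<Rightarrow> 'z \<Rightarrow> bool) \<Rightarrow> ('z \<Rightarrow> 'c \<Rightarrow> 'z \<Rightarrow> bool)
    \<Rightarrow> ('z, 'z \<times> 'm \<times> 'z, 'z \<times> 'c \<times> 'z) twocat"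
where
  "structured K S und R1 R2 =
    (let M = {(X, f, Y). X \<in> S \<and> Y \<in> S \<and> f \<in> C1 K \<and> s1 K f = und X \<and> t1 K f = und Y \<and> R1 X f Y}
     in \<lparr>C0 = S,
         C1 = M,
         C2 = {(X, a, Y). a \<in> C2 K \<and> (X, s2 K a, Y) \<in> M \<and> (X, t2 K a, Y) \<in> M \<and> R2 X a Y},
         s1 = (\<lambda>(X, f, Y). X),
         t1 = (\<lambda>(X, f, Y). Y),
         s2 = (\<lambda>(X, a, Y). (X, s2 K a, Y)),
         t2 = (\<lambda>(X, a, Y). (X, t2 K a, Y)),
         id1 = (\<lambda>X. (X, id1 K (und X), X)),
         id2 = (\<lambda>(X, f, Y). (X, id2 K f, Y)),
         comp1 = (\<lambda>(Y', g, Z) (X, f, Y). (X, comp1 K g f, Z)),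
         vcomp = (\<lambda>(X', b, Y') (X, a, Y). (X, vcomp K b a, Y)),
         hcomp = (\<lambda>(Y', b, Z) (X, a, Y). (X, hcomp K b a, Z))\<rparr>)"

definition forget :: "('z \<Rightarrow> 'o) \<Rightarrow> ('z, 'z \<times> 'm \<times> 'z, 'z \<times> 'c \<times> 'z, 'o, 'm, 'c) twofun" where
  "forget und = \<lparr>F0 = und, F1 = (\<lambda>(X, f, Y). f), F2 = (\<lambda>(X, a, Y). a)\<rparr>"

type_synonym ('o, 'm, 'c) alg_twocat =
  "('o \<times> 'm, ('o \<times> 'm) \<times> 'm \<times> ('o \<times> 'm), ('o \<times> 'm) \<times> 'c \<times> ('o \<times> 'm)) twocat"

definition algebras :: "('o, 'm, 'c) twocat \<Rightarrow> ('o, 'm, 'c) twomonad \<Rightarrow> ('o \<times> 'm) set" where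
  "algebras K T = {(X, a). X \<in> C0 K \<and> a \<in> C1 K \<and> s1 K a = F0 (mfun T) X \<and> t1 K a = X
     \<and> comp1 K a (munit T X) = id1 K X
     \<and> comp1 K a (mmult T X) = comp1 K a (F1 (mfun T) a)}"

definition Alg_s :: "('o, 'm, 'c) twocat \<Rightarrow> ('o, 'm, 'c) twomonad \<Rightarrow> ('o, 'm, 'c) alg_twocat" where
  "Alg_s K T = structured K (algebras K T) fst
     (\<lambda>(X, a) f (Y, b). comp1 K f a = comp1 K b (F1 (mfun T) f))
     (\<lambda>(X, a) \<alpha> (Y, b). hcomp K \<alpha> (id2 K a) = hcomp K (id2 K b) (F2 (mfun T) \<alpha>))"

definition comparison ::
  "('p, 'n, 'd) twocat \<Rightarrow> ('p, 'n, 'd, 'o, 'm, 'c) twofun \<Rightarrow> ('p \<Rightarrow> 'n)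
    \<Rightarrow> ('p, 'n, 'd, 'o \<times> 'm, ('o \<times> 'm) \<times> 'm \<times> ('o \<times> 'm), ('o \<times> 'm) \<times> 'c \<times> ('o \<times> 'm)) twofun"
where
  "comparison A U \<epsilon> =
    (let act = (\<lambda>Z. (F0 U Z, F1 U (\<epsilon> Z)))
     in \<lparr>F0 = act,
         F1 = (\<lambda>f. (act (s1 A f), F1 U f, act (t1 A f))),
         F2 = (\<lambda>\<alpha>. (act (s1 A (s2 A \<alpha>)), F2 U \<alpha>, act (t1 A (s2 A \<alpha>))))\<rparr>)"

text \<open>\<open>T\<close> has to agree with the induced 2-monad on cells only; the values of \<open>twofun\<close>s elsewhere are
  junk.\<close>

definition strictly_two_monadic ::
  "('p, 'n, 'd) twocat \<Rightarrow> ('o, 'm, 'c) twocat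
    \<Rightarrow> ('p, 'n, 'd, 'o, 'm, 'c) twofun \<Rightarrow> ('o, 'm, 'c, 'p, 'n, 'd) twofun
    \<Rightarrow> ('o \<Rightarrow> 'm) \<Rightarrow> ('p \<Rightarrow> 'n) \<Rightarrow> ('o, 'm, 'c) twomonad \<Rightarrow> bool"
where
  "strictly_two_monadic A K U F \<eta> \<epsilon> T \<longleftrightarrow>
     two_adjunction A K F U \<eta> \<epsilon> \<and> tm_eq K (induced_monad F U \<eta> \<epsilon>) T \<and>
     two_iso_over K A U (Alg_s K T) (forget fst) (comparison A U \<epsilon>)"

text \<open>The arrow 2-category of \<open>K\<close>. A 1-cell \<open>(T, S) : P \<rightarrow> Q\<close> is encoded as \<open>(P, T, S, Q)\<close>, and a
  2-cell \<open>(\<beta>, \<alpha>)\<close> between such 1-cells as \<open>(P, \<beta>, \<alpha>, Q)\<close>.\<close>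

definition arrow2 ::
  "('o, 'm, 'c) twocat \<Rightarrow> ('m, 'm \<times> 'm \<times> 'm \<times> 'm, 'm \<times> 'c \<times> 'c \<times> 'm) twocat"
where
  "arrow2 K =
    (let M = {(P, T, S, Q). P \<in> C1 K \<and> Q \<in> C1 K \<and> T \<in> C1 K \<and> S \<in> C1 K
               \<and> s1 K T = s1 K P \<and> t1 K T = s1 K Q \<and> s1 K S = t1 K P \<and> t1 K S = t1 K Q
               \<and> comp1 K Q T = comp1 K S P}
     in \<lparr>C0 = C1 K,
         C1 = M,
         C2 = {(P, \<beta>, \<alpha>, Q). \<beta> \<in> C2 K \<and> \<alpha> \<in> C2 K
               \<and> (P, s2 K \<beta>, s2 K \<alpha>, Q) \<in> M \<and> (P, t2 K \<beta>, t2 K \<alpha>, Q) \<in> M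
               \<and> hcomp K (id2 K Q) \<beta> = hcomp K \<alpha> (id2 K P)},
         s1 = (\<lambda>(P, T, S, Q). P),
         t1 = (\<lambda>(P, T, S, Q). Q),
         s2 = (\<lambda>(P, \<beta>, \<alpha>, Q). (P, s2 K \<beta>, s2 K \<alpha>, Q)),
         t2 = (\<lambda>(P, \<beta>, \<alpha>, Q). (P, t2 K \<beta>, t2 K \<alpha>, Q)),
         id1 = (\<lambda>P. (P, id1 K (s1 K P), id1 K (t1 K P), P)),
         id2 = (\<lambda>(P, T, S, Q). (P, id2 K T, id2 K S, Q)),
         comp1 = (\<lambda>(Q', T', S', R) (P, T, S, Q). (P, comp1 K T' T, comp1 K S' S, R)),
         vcomp = (\<lambda>(P', \<beta>', \<alpha>', Q') (P, \<beta>, \<alpha>, Q). (P, vcomp K \<beta>' \<beta>, vcomp K \<alpha>' \<alpha>, Q)),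
         hcomp = (\<lambda>(Q', \<beta>', \<alpha>', R) (P, \<beta>, \<alpha>, Q). (P, hcomp K \<beta>' \<beta>, hcomp K \<alpha>' \<alpha>, R))\<rparr>)"


section \<open>The 2-category of categories\<close>

text \<open>A category has its objects and its arrows in a type \<open>'u\<close>, hom-sets being disjoint. All
  operations take the value \<open>undefined\<close> outside their domain, so that equality of categories,
  functors and natural transformations is equality in HOL.\<close>

record 'u cat =
  Ob :: "'u set"
  Ar :: "'u set"
  src :: "'u \<Rightarrow> 'u"
  tgt :: "'u \<Rightarrow> 'u"
  ide :: "'u \<Rightarrow> 'u"
  cmp :: "'u \<Rightarrow> 'u \<Rightarrow> 'u"

definition hom :: "'u cat \<Rightarrow> 'u \<Rightarrow> 'u \<Rightarrow> 'u set" where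
  "hom C x y = {f \<in> Ar C. src C f = x \<and> tgt C f = y}"

locale category =
  fixes C :: "'u cat"
  assumes src_in: "src C \<in> Ar C \<rightarrow>\<^sub>E Ob C"
    and tgt_in: "tgt C \<in> Ar C \<rightarrow>\<^sub>E Ob C"
    and ide_ext: "ide C \<in> extensional (Ob C)"
    and ide_in: "x \<in> Ob C \<Longrightarrow> ide C x \<in> hom C x x"
    and cmp_in: "\<lbrakk>f \<in> hom C x y; g \<in> hom C y z\<rbrakk> \<Longrightarrow> cmp C g f \<in> hom C x z"
    and cmp_ext: "\<not> (f \<in> Ar C \<and> g \<in> Ar C \<and> tgt C f = src C g) \<Longrightarrow> cmp C g f = undefined"
    and cmp_ide_right: "f \<in> Ar C \<Longrightarrow> cmp C f (ide C (src C f)) = f"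
    and cmp_ide_left: "f \<in> Ar C \<Longrightarrow> cmp C (ide C (tgt C f)) f = f"
    and cmp_assoc:
      "\<lbrakk>f \<in> hom C w x; g \<in> hom C x y; h \<in> hom C y z\<rbrakk>
        \<Longrightarrow> cmp C h (cmp C g f) = cmp C (cmp C h g) f"

text \<open>Size, following the class-set distinction: subsets of \<open>'u\<close> are the classes, and the small
  ones are those of cardinality less than that of \<open>'u\<close> (limitation of size).\<close>

definition locally_small :: "'u cat \<Rightarrow> bool" where
  "locally_small C \<longleftrightarrow> (\<forall>x\<in>Ob C. \<forall>y\<in>Ob C. hom C x y \<prec> (UNIV :: 'u set))"

record 'u func =
  fdom :: "'u cat"
  fcod :: "'u cat"
  fob :: "'u \<Rightarrow> 'u"
  far :: "'u \<Rightarrow> 'u"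

locale is_functor = dom: category "fdom F" + cod: category "fcod F" for F :: "'u func" +
  assumes fob_in: "fob F \<in> Ob (fdom F) \<rightarrow>\<^sub>E Ob (fcod F)"
    and far_ext: "far F \<in> extensional (Ar (fdom F))"
    and far_in: "f \<in> hom (fdom F) x y \<Longrightarrow> far F f \<in> hom (fcod F) (fob F x) (fob F y)"
    and far_ide: "x \<in> Ob (fdom F) \<Longrightarrow> far F (ide (fdom F) x) = ide (fcod F) (fob F x)"
    and far_cmp:
      "\<lbrakk>f \<in> hom (fdom F) x y; g \<in> hom (fdom F) y z\<rbrakk>
        \<Longrightarrow> far F (cmp (fdom F) g f) = cmp (fcod F) (far F g) (far F f)"

definition idf :: "'u cat \<Rightarrow> 'u func" where
  "idf C = \<lparr>fdom = C, fcod = C, fob = (\<lambda>x\<in>Ob C. x), far = (\<lambda>f\<in>Ar C. f)\<rparr>"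

definition fcomp :: "'u func \<Rightarrow> 'u func \<Rightarrow> 'u func" where
  "fcomp G F = \<lparr>fdom = fdom F, fcod = fcod G,
     fob = (\<lambda>x\<in>Ob (fdom F). fob G (fob F x)),
     far = (\<lambda>f\<in>Ar (fdom F). far G (far F f))\<rparr>"

record 'u ntrans =
  nsrc :: "'u func"
  ntgt :: "'u func"
  ncmp :: "'u \<Rightarrow> 'u"

locale is_ntrans = src: is_functor "nsrc \<alpha>" + tgt: is_functor "ntgt \<alpha>" for \<alpha> :: "'u ntrans" +
  assumes same_fdom: "fdom (ntgt \<alpha>) = fdom (nsrc \<alpha>)"
    and same_fcod: "fcod (ntgt \<alpha>) = fcod (nsrc \<alpha>)"
    and ncmp_ext: "ncmp \<alpha> \<in> extensional (Ob (fdom (nsrc \<alpha>)))"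
    and ncmp_in:
      "x \<in> Ob (fdom (nsrc \<alpha>))
        \<Longrightarrow> ncmp \<alpha> x \<in> hom (fcod (nsrc \<alpha>)) (fob (nsrc \<alpha>) x) (fob (ntgt \<alpha>) x)"
    and naturality:
      "f \<in> hom (fdom (nsrc \<alpha>)) x y
        \<Longrightarrow> cmp (fcod (nsrc \<alpha>)) (far (ntgt \<alpha>) f) (ncmp \<alpha> x)
          = cmp (fcod (nsrc \<alpha>)) (ncmp \<alpha> y) (far (nsrc \<alpha>) f)"

definition CAT :: "('u cat, 'u func, 'u ntrans) twocat" where
  "CAT =
    (let M = {F. is_functor F \<and> locally_small (fdom F) \<and> locally_small (fcod F)}
     in \<lparr>C0 = {C. category C \<and> locally_small C},
         C1 = M,
         C2 = {\<alpha>. is_ntrans \<alpha> \<and> nsrc \<alpha> \<in> M \<and> ntgt \<alpha> \<in> M},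
         s1 = fdom,
         t1 = fcod,
         s2 = nsrc,
         t2 = ntgt,
         id1 = idf,
         id2 = (\<lambda>F. \<lparr>nsrc = F, ntgt = F, ncmp = (\<lambda>x\<in>Ob (fdom F). ide (fcod F) (fob F x))\<rparr>),
         comp1 = fcomp,
         vcomp = (\<lambda>\<beta> \<alpha>. \<lparr>nsrc = nsrc \<alpha>, ntgt = ntgt \<beta>,
           ncmp = (\<lambda>x\<in>Ob (fdom (nsrc \<alpha>)). cmp (fcod (nsrc \<alpha>)) (ncmp \<beta> x) (ncmp \<alpha> x))\<rparr>),
         hcomp = (\<lambda>\<beta> \<alpha>. \<lparr>nsrc = fcomp (nsrc \<beta>) (nsrc \<alpha>), ntgt = fcomp (ntgt \<beta>) (ntgt \<alpha>),
           ncmp = (\<lambda>x\<in>Ob (fdom (nsrc \<alpha>)).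
             cmp (fcod (nsrc \<beta>)) (ncmp \<beta> (fob (ntgt \<alpha>) x)) (far (nsrc \<beta>) (ncmp \<alpha> x)))\<rparr>)\<rparr>)"

type_synonym 'u sq = "'u func \<times> 'u func \<times> 'u func \<times> 'u func"
type_synonym 'u sq2 = "'u func \<times> 'u ntrans \<times> 'u ntrans \<times> 'u func"

definition CAT2 :: "('u func, 'u sq, 'u sq2) twocat" where
  "CAT2 = arrow2 CAT"


section \<open>Split cofibrations\<close>

definition cocartesian :: "'u func \<Rightarrow> 'u \<Rightarrow> bool" where
  "cocartesian P e \<longleftrightarrow> e \<in> Ar (fdom P) \<and>
     (\<forall>z g v. g \<in> hom (fdom P) (src (fdom P) e) z
        \<and> v \<in> hom (fcod P) (fob P (tgt (fdom P) e)) (fob P z)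
        \<and> far P g = cmp (fcod P) v (far P e)
        \<longrightarrow> (\<exists>!h. h \<in> hom (fdom P) (tgt (fdom P) e) z \<and> cmp (fdom P) h e = g \<and> far P h = v))"

definition fibre :: "'u func \<Rightarrow> 'u \<Rightarrow> 'u cat" where
  "fibre P b =
    (let E = fdom P;
         X = {x \<in> Ob E. fob P x = b};
         V = {f \<in> Ar E. far P f = ide (fcod P) b}
     in \<lparr>Ob = X, Ar = V, src = restrict (src E) V, tgt = restrict (tgt E) V,
         ide = restrict (ide E) X,
         cmp = (\<lambda>g f. if f \<in> V \<and> g \<in> V \<and> tgt E f = src E g then cmp E g f else undefined)\<rparr>)"

text \<open>\<open>\<delta> x u\<close> is the chosen lift of \<open>u : P x \<rightarrow> b\<close> at \<open>x\<close>.\<close>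

type_synonym 'u lifts = "'u \<Rightarrow> 'u \<Rightarrow> 'u"

locale cleavage = P: is_functor P for P :: "'u func" +
  fixes \<delta> :: "'u lifts"
  assumes lift_ext:
      "\<not> (x \<in> Ob (fdom P) \<and> u \<in> Ar (fcod P) \<and> src (fcod P) u = fob P x) \<Longrightarrow> \<delta> x u = undefined"
    and lift_src:
      "\<lbrakk>x \<in> Ob (fdom P); u \<in> Ar (fcod P); src (fcod P) u = fob P x\<rbrakk> \<Longrightarrow> src (fdom P) (\<delta> x u) = x"
    and lift_cocartesian:
      "\<lbrakk>x \<in> Ob (fdom P); u \<in> Ar (fcod P); src (fcod P) u = fob P x\<rbrakk> \<Longrightarrow> cocartesian P (\<delta> x u)"
    and lift_over:
      "\<lbrakk>x \<in> Ob (fdom P); u \<in> Ar (fcod P); src (fcod P) u = fob P x\<rbrakk> \<Longrightarrow> far P (\<delta> x u) = u"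

definition push :: "'u func \<Rightarrow> 'u lifts \<Rightarrow> 'u \<Rightarrow> 'u func" where
  "push P \<delta> u =
    (let E = fdom P; A = fibre P (src (fcod P) u); B = fibre P (tgt (fcod P) u)
     in \<lparr>fdom = A, fcod = B,
         fob = (\<lambda>x\<in>Ob A. tgt E (\<delta> x u)),
         far = (\<lambda>f\<in>Ar A. THE h. h \<in> hom B (tgt E (\<delta> (src E f) u)) (tgt E (\<delta> (tgt E f) u))
                 \<and> cmp E h (\<delta> (src E f) u) = cmp E (\<delta> (tgt E f) u) f)\<rparr>)"

locale split_cleavage = cleavage +
  assumes normal: "x \<in> Ob (fdom P) \<Longrightarrow> \<delta> x (ide (fcod P) (fob P x)) = ide (fdom P) x"
    and split_push:
      "\<lbrakk>u \<in> Ar (fcod P); v \<in> Ar (fcod P); tgt (fcod P) u = src (fcod P) v\<rbrakk>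
        \<Longrightarrow> push P \<delta> (cmp (fcod P) v u) = fcomp (push P \<delta> v) (push P \<delta> u)"
    and split_lift:
      "\<lbrakk>x \<in> Ob (fdom P); u \<in> Ar (fcod P); v \<in> Ar (fcod P);
        src (fcod P) u = fob P x; tgt (fcod P) u = src (fcod P) v\<rbrakk>
        \<Longrightarrow> \<delta> x (cmp (fcod P) v u) = cmp (fdom P) (\<delta> (fob (push P \<delta> u) x) v) (\<delta> x u)"

type_synonym 'u scofib = "'u func \<times> 'u lifts"

type_synonym 'u scofib_twocat =
  "('u scofib, 'u scofib \<times> 'u sq \<times> 'u scofib, 'u scofib \<times> 'u sq2 \<times> 'u scofib) twocat"

definition SCoFib :: "'u scofib_twocat" where
  "SCoFib = structured CAT2 {(P, \<delta>). P \<in> C0 CAT2 \<and> split_cleavage P \<delta>} fst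
     (\<lambda>(P, \<delta>) (_, T, S, _) (Q, \<delta>').
        \<forall>x\<in>Ob (fdom P). \<forall>u\<in>Ar (fcod P). src (fcod P) u = fob P x
          \<longrightarrow> far T (\<delta> x u) = \<delta>' (fob T x) (far S u))
     (\<lambda>_ _ _. True)"


section \<open>The comma 2-monad\<close>

text \<open>A fixed injective pairing on the infinite type \<open>'u\<close>, so that comma categories again have their
  objects and arrows in \<open>'u\<close>.\<close>

definition upair :: "'u::infinite \<Rightarrow> 'u \<Rightarrow> 'u" where
  "upair = curry (SOME p. inj p)"

definition ufst :: "'u::infinite \<Rightarrow> 'u" where
  "ufst z = fst (inv (case_prod upair) z)"

definition usnd :: "'u::infinite \<Rightarrow> 'u" where
  "usnd z = snd (inv (case_prod upair) z)"

lemma inj_upair: "inj (case_prod (upair :: 'u::infinite \<Rightarrow> _))"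
proof -
  have "\<exists>p. bij_betw p (UNIV \<times> UNIV :: ('u \<times> 'u) set) (UNIV :: 'u set)"
    using card_of_Times_same_infinite[OF infinite_UNIV[where 'a = 'u]]
    by (simp only: card_of_ordIso)
  then have "\<exists>p :: 'u \<times> 'u \<Rightarrow> 'u. inj p"
    by (auto simp: bij_betw_def)
  then show ?thesis
    unfolding upair_def case_prod_curry by (rule someI_ex)
qed

lemma upair_proj [simp]: "ufst (upair a b) = a" "usnd (upair a b) = b"
  using inv_f_f[OF inj_upair, of "(a, b)"] by (simp_all add: ufst_def usnd_def)

lemma upair_eq_iff [simp]: "upair a b = upair c d \<longleftrightarrow> a = c \<and> b = d"
  by (metis upair_proj)

text \<open>The object \<open>(x, u)\<close> is \<open>upair x u\<close>; an arrow \<open>(f, v)\<close> is encoded together with its source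
  \<open>z\<close> and target \<open>z'\<close>, since these are not determined by \<open>f\<close> and \<open>v\<close>.\<close>

definition carr :: "'u::infinite \<Rightarrow> 'u \<Rightarrow> 'u \<Rightarrow> 'u \<Rightarrow> 'u" where
  "carr z f v z' = upair z (upair (upair f v) z')"

definition csrc :: "'u::infinite \<Rightarrow> 'u" where "csrc a = ufst a"
definition ctop :: "'u::infinite \<Rightarrow> 'u" where "ctop a = ufst (ufst (usnd a))"
definition cbot :: "'u::infinite \<Rightarrow> 'u" where "cbot a = usnd (ufst (usnd a))"
definition ctgt :: "'u::infinite \<Rightarrow> 'u" where "ctgt a = usnd (usnd a)"

definition comma_ob :: "'u::infinite func \<Rightarrow> 'u set" where
  "comma_ob P = {upair x u | x u. x \<in> Ob (fdom P) \<and> u \<in> Ar (fcod P) \<and> src (fcod P) u = fob P x}"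

definition comma_ar :: "'u::infinite func \<Rightarrow> 'u set" where
  "comma_ar P = {carr (upair x u) f v (upair y w) | x u f v y w.
     upair x u \<in> comma_ob P \<and> upair y w \<in> comma_ob P \<and> f \<in> hom (fdom P) x y
     \<and> v \<in> hom (fcod P) (tgt (fcod P) u) (tgt (fcod P) w)
     \<and> cmp (fcod P) v u = cmp (fcod P) w (far P f)}"

definition comma :: "'u::infinite func \<Rightarrow> 'u cat" where
  "comma P =
    (let E = fdom P; B = fcod P
     in \<lparr>Ob = comma_ob P, Ar = comma_ar P,
         src = restrict csrc (comma_ar P), tgt = restrict ctgt (comma_ar P),
         ide = (\<lambda>z\<in>comma_ob P. carr z (ide E (ufst z)) (ide B (tgt B (usnd z))) z),
         cmp = (\<lambda>b a. if a \<in> comma_ar P \<and> b \<in> comma_ar P \<and> ctgt a = csrc b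
                  then carr (csrc a) (cmp E (ctop b) (ctop a)) (cmp B (cbot b) (cbot a)) (ctgt b)
                  else undefined)\<rparr>)"

definition CodF :: "'u::infinite func \<Rightarrow> 'u func" where
  "CodF P = \<lparr>fdom = comma P, fcod = fcod P,
     fob = (\<lambda>z\<in>comma_ob P. tgt (fcod P) (usnd z)),
     far = (\<lambda>a\<in>comma_ar P. cbot a)\<rparr>"

text \<open>\<open>bar (P, T, S, Q) : P \<down> B \<rightarrow> Q \<down> C\<close> is the functor \<open>(x, u) \<mapsto> (T x, S u)\<close>,
  \<open>(f, v) \<mapsto> (T f, S v)\<close>.\<close>

definition bar :: "'u::infinite sq \<Rightarrow> 'u func" where
  "bar = (\<lambda>(P, T, S, Q).
    (let ob = (\<lambda>z. upair (fob T (ufst z)) (far S (usnd z)))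
     in \<lparr>fdom = comma P, fcod = comma Q,
         fob = (\<lambda>z\<in>comma_ob P. ob z),
         far = (\<lambda>a\<in>comma_ar P. carr (ob (csrc a)) (far T (ctop a)) (far S (cbot a)) (ob (ctgt a)))\<rparr>))"

definition bar2 :: "'u::infinite sq2 \<Rightarrow> 'u ntrans" where
  "bar2 = (\<lambda>(P, \<beta>, \<alpha>, Q).
    (let G = bar (P, nsrc \<beta>, nsrc \<alpha>, Q); G' = bar (P, ntgt \<beta>, ntgt \<alpha>, Q)
     in \<lparr>nsrc = G, ntgt = G',
         ncmp = (\<lambda>z\<in>comma_ob P.
           carr (fob G z) (ncmp \<beta> (ufst z)) (ncmp \<alpha> (tgt (fcod P) (usnd z))) (fob G' z))\<rparr>))"

definition HF :: "'u::infinite func \<Rightarrow> 'u func" where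
  "HF P =
    (let ob = (\<lambda>x. upair x (ide (fcod P) (fob P x)))
     in \<lparr>fdom = fdom P, fcod = comma P,
         fob = (\<lambda>x\<in>Ob (fdom P). ob x),
         far = (\<lambda>f\<in>Ar (fdom P). carr (ob (src (fdom P) f)) f (far P f) (ob (tgt (fdom P) f)))\<rparr>)"

definition MF :: "'u::infinite func \<Rightarrow> 'u func" where
  "MF P =
    (let ob = (\<lambda>z. upair (ufst (ufst z)) (cmp (fcod P) (usnd z) (usnd (ufst z))))
     in \<lparr>fdom = comma (CodF P), fcod = comma P,
         fob = (\<lambda>z\<in>comma_ob (CodF P). ob z),
         far = (\<lambda>a\<in>comma_ar (CodF P). carr (ob (csrc a)) (ctop (ctop a)) (cbot a) (ob (ctgt a)))\<rparr>)"

definition comma_twofun :: "('u::infinite func, 'u sq, 'u sq2, 'u func, 'u sq, 'u sq2) twofun" where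
  "comma_twofun =
    \<lparr>F0 = CodF,
     F1 = (\<lambda>(P, T, S, Q). (CodF P, bar (P, T, S, Q), S, CodF Q)),
     F2 = (\<lambda>(P, \<beta>, \<alpha>, Q). (CodF P, bar2 (P, \<beta>, \<alpha>, Q), \<alpha>, CodF Q))\<rparr>"

definition comma_unit :: "'u::infinite func \<Rightarrow> 'u sq" where
  "comma_unit P = (P, HF P, idf (fcod P), CodF P)"

definition comma_mult :: "'u::infinite func \<Rightarrow> 'u sq" where
  "comma_mult P = (CodF (CodF P), MF P, idf (fcod P), CodF P)"

definition comma_monad :: "('u::infinite func, 'u sq, 'u sq2) twomonad" where
  "comma_monad = \<lparr>mfun = comma_twofun, munit = comma_unit, mmult = comma_mult\<rparr>"


section \<open>The comparison 2-functor and the left 2-adjoint\<close>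

definition LF :: "'u::infinite func \<Rightarrow> 'u lifts \<Rightarrow> 'u func" where
  "LF P \<delta> = (THE L. is_functor L \<and> fdom L = comma P \<and> fcod L = fdom P
     \<and> (\<forall>x u. upair x u \<in> Ob (comma P) \<longrightarrow> fob L (upair x u) = fob (push P \<delta> u) x)
     \<and> fcomp P L = CodF P
     \<and> (\<forall>x u f v y w. carr (upair x u) f v (upair y w) \<in> Ar (comma P) \<longrightarrow>
          cmp (fdom P) (far L (carr (upair x u) f v (upair y w))) (\<delta> x u)
            = cmp (fdom P) (\<delta> y w) f))"

definition L_action :: "'u::infinite scofib \<Rightarrow> 'u sq" where
  "L_action = (\<lambda>(P, \<delta>). (CodF P, LF P \<delta>, idf (fcod P), P))"

type_synonym 'u calg = "'u func \<times> 'u sq"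

definition \<Gamma> ::
  "('u::infinite scofib, 'u scofib \<times> 'u sq \<times> 'u scofib, 'u scofib \<times> 'u sq2 \<times> 'u scofib,
    'u calg, 'u calg \<times> 'u sq \<times> 'u calg, 'u calg \<times> 'u sq2 \<times> 'u calg) twofun"
where
  "\<Gamma> =
    (let g = (\<lambda>Z. (fst Z, L_action Z))
     in \<lparr>F0 = g, F1 = (\<lambda>(Z, f, Z'). (g Z, f, g Z')), F2 = (\<lambda>(Z, a, Z'). (g Z, a, g Z'))\<rparr>)"

definition free_lifts :: "'u::infinite func \<Rightarrow> 'u lifts" where
  "free_lifts P z v =
    (if z \<in> comma_ob P \<and> v \<in> Ar (fcod P) \<and> src (fcod P) v = tgt (fcod P) (usnd z)
     then carr z (ide (fdom P) (ufst z)) v (upair (ufst z) (cmp (fcod P) v (usnd z)))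
     else undefined)"

definition Free ::
  "('u::infinite func, 'u sq, 'u sq2,
    'u scofib, 'u scofib \<times> 'u sq \<times> 'u scofib, 'u scofib \<times> 'u sq2 \<times> 'u scofib) twofun"
where
  "Free =
    (let g = (\<lambda>P. (CodF P, free_lifts P))
     in \<lparr>F0 = g,
         F1 = (\<lambda>(P, T, S, Q). (g P, F1 comma_twofun (P, T, S, Q), g Q)),
         F2 = (\<lambda>(P, \<beta>, \<alpha>, Q). (g P, F2 comma_twofun (P, \<beta>, \<alpha>, Q), g Q))\<rparr>)"

definition free_counit :: "'u::infinite scofib \<Rightarrow> 'u scofib \<times> 'u sq \<times> 'u scofib" where
  "free_counit Z = (F0 Free (fst Z), L_action Z, Z)"

end

theory Submission
  imports Defs
begin

text \<open>For a split cofibration, \<open>L\<^sup>P\<close> is determined by the chosen lifts through cocartesianness, and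
  conversely the lift of \<open>u\<close> at \<open>x\<close> is \<open>L\<^sup>P (1, u)\<close> for \<open>(1, u) : (x, 1) \<rightarrow> (x, u)\<close>. Applied to an
  arbitrary strict action \<open>A\<close>, this formula gives a split cleavage: the unit law yields normality and
  the existence of factorizations, the multiplication law yields splitness and, through
  \<open>A (\<delta>, 1) = 1\<close>, uniqueness of factorizations. A square is compatible with the actions
  iff it preserves chosen lifts, and every 2-cell is compatible, again by cocartesianness. The
  multiplication of \<open>C\<close> is \<open>L\<close> of the free split cofibration, so the 2-monad laws and the
  algebra laws of \<open>(P, L\<^sup>P)\<close> come for free from the 2-adjunction.\<close>

section \<open>Arrow 2-categories and structured objects\<close>

text \<open>Both \<open>SCoFib\<close> and \<open>Alg_s\<close> consist of cells of
  \<open>CAT2\<close> tagged with structured endpoints. An isomorphism over \<open>CAT2\<close>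
  therefore amounts to a bijection of objects over \<open>CAT2\<close> under which the two
  conditions on 1-cells agree, and so do the conditions on 2-cells between such 1-cells. The
  remaining obstacle is strictness: every equation is a HOL equality of functors, cells or
  cleavages. Values outside a domain are \<open>undefined\<close>, so two split cleavages of P with
  the same L coincide as functions. L is a definite description and is accessible only through
  \<open>lift_action\<close>, which has exactly one solution; identifying L with a given functor
  (the multiplication, an arbitrary strict action) is a check of \<open>lift_action\<close>.
  Uniqueness of factorizations for a strict action L comes from an explicit formula: an arrow h out
  of u_!x equals L (h d, P h), where d is the lift of u at x, so h d and P h determine h. Local
  smallness is measured by the cardinality of the type, which makes its stability under comma
  categories a statement about cardinals of products.\<close>

context two_category
begin

text \<open>The boundary is a separate premise, so the unit laws still rewrite after
  \<open>s1 K f\<close> or \<open>t1 K f\<close> has been simplified to another term.\<close>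

lemma id_laws:
  "\<lbrakk>f \<in> C1 K; s1 K f = X\<rbrakk> \<Longrightarrow> comp1 K f (id1 K X) = f"
  "\<lbrakk>f \<in> C1 K; t1 K f = X\<rbrakk> \<Longrightarrow> comp1 K (id1 K X) f = f"
  "\<lbrakk>a \<in> C2 K; s2 K a = f\<rbrakk> \<Longrightarrow> vcomp K a (id2 K f) = a"
  "\<lbrakk>a \<in> C2 K; t2 K a = f\<rbrakk> \<Longrightarrow> vcomp K (id2 K f) a = a"
  "\<lbrakk>a \<in> C2 K; s1 K (s2 K a) = X\<rbrakk> \<Longrightarrow> hcomp K a (id2 K (id1 K X)) = a"
  "\<lbrakk>a \<in> C2 K; t1 K (s2 K a) = X\<rbrakk> \<Longrightarrow> hcomp K (id2 K (id1 K X)) a = a"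
  using comp1_id_right comp1_id_left vcomp_id_right vcomp_id_left hcomp_id_right hcomp_id_left
  by auto

lemmas laws = s1_in t1_in s2_in t2_in s1_t2 t1_t2 id1_in s1_id1 t1_id1 id2_in s2_id2 t2_id2
  comp1_in s1_comp1 t1_comp1 vcomp_in s2_vcomp t2_vcomp hcomp_in s2_hcomp t2_hcomp hcomp_id2
  id_laws

end

lemma arrow2_C1:
  "(P, T, S, Q) \<in> C1 (arrow2 K) \<longleftrightarrow> P \<in> C1 K \<and> Q \<in> C1 K \<and> T \<in> C1 K \<and> S \<in> C1 K
     \<and> s1 K T = s1 K P \<and> t1 K T = s1 K Q \<and> s1 K S = t1 K P \<and> t1 K S = t1 K Q
     \<and> comp1 K Q T = comp1 K S P"
  by (simp add: arrow2_def Let_def)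

lemma arrow2_simps [simp]:
  "C0 (arrow2 K) = C1 K"
  "(P, \<beta>, \<alpha>, Q) \<in> C2 (arrow2 K) \<longleftrightarrow> \<beta> \<in> C2 K \<and> \<alpha> \<in> C2 K
     \<and> (P, s2 K \<beta>, s2 K \<alpha>, Q) \<in> C1 (arrow2 K) \<and> (P, t2 K \<beta>, t2 K \<alpha>, Q) \<in> C1 (arrow2 K)
     \<and> hcomp K (id2 K Q) \<beta> = hcomp K \<alpha> (id2 K P)"
  "s1 (arrow2 K) (P, T, S, Q) = P"
  "t1 (arrow2 K) (P, T, S, Q) = Q"
  "s2 (arrow2 K) (P, \<beta>, \<alpha>, Q) = (P, s2 K \<beta>, s2 K \<alpha>, Q)"
  "t2 (arrow2 K) (P, \<beta>, \<alpha>, Q) = (P, t2 K \<beta>, t2 K \<alpha>, Q)"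
  "id1 (arrow2 K) P = (P, id1 K (s1 K P), id1 K (t1 K P), P)"
  "id2 (arrow2 K) (P, T, S, Q) = (P, id2 K T, id2 K S, Q)"
  "comp1 (arrow2 K) (Q', T', S', R) (P, T, S, Q) = (P, comp1 K T' T, comp1 K S' S, R)"
  "vcomp (arrow2 K) (P', \<beta>', \<alpha>', Q') (P, \<beta>, \<alpha>, Q) = (P, vcomp K \<beta>' \<beta>, vcomp K \<alpha>' \<alpha>, Q)"
  "hcomp (arrow2 K) (Q', \<beta>', \<alpha>', R) (P, \<beta>, \<alpha>, Q) = (P, hcomp K \<beta>' \<beta>, hcomp K \<alpha>' \<alpha>, R)"
  by (auto simp: arrow2_def Let_def)

lemma two_category_arrow2:
  assumes "two_category K"
  shows "two_category (arrow2 K)"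
proof -
  interpret K: two_category K by fact
  note K.laws [simp]
  have sq: "comp1 K R (comp1 K T' T) = comp1 K (comp1 K S' S) P"
    if "P \<in> C1 K" "Q \<in> C1 K" "R \<in> C1 K" "T \<in> C1 K" "T' \<in> C1 K" "S \<in> C1 K" "S' \<in> C1 K"
      "s1 K T = s1 K P" "t1 K T = s1 K Q" "s1 K S = t1 K P" "t1 K S = t1 K Q"
      "s1 K T' = s1 K Q" "t1 K T' = s1 K R" "s1 K S' = t1 K Q" "t1 K S' = t1 K R"
      "comp1 K Q T = comp1 K S P" "comp1 K R T' = comp1 K S' Q" for P Q R T T' S S'
    using that by (metis K.comp1_assoc)
  \<comment> \<open>The two 2-cells over their bases are pasted side by side:
    \<open>\<beta>'\<close> is traded for \<open>\<alpha>'\<close> first, then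
    \<open>\<beta>\<close> for \<open>\<alpha>\<close>.\<close>
  have h: "hcomp K (id2 K R) (hcomp K \<beta>' \<beta>) = hcomp K (hcomp K \<alpha>' \<alpha>) (id2 K P)"
    if "P \<in> C1 K" "Q \<in> C1 K" "R \<in> C1 K" "\<beta> \<in> C2 K" "\<beta>' \<in> C2 K" "\<alpha> \<in> C2 K" "\<alpha>' \<in> C2 K"
      "s1 K (s2 K \<beta>) = s1 K P" "t1 K (s2 K \<beta>) = s1 K Q" "s1 K (s2 K \<alpha>) = t1 K P"
      "t1 K (s2 K \<alpha>) = t1 K Q" "s1 K (s2 K \<beta>') = s1 K Q" "t1 K (s2 K \<beta>') = s1 K R"
      "s1 K (s2 K \<alpha>') = t1 K Q" "t1 K (s2 K \<alpha>') = t1 K R"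
      "hcomp K (id2 K Q) \<beta> = hcomp K \<alpha> (id2 K P)"
      "hcomp K (id2 K R) \<beta>' = hcomp K \<alpha>' (id2 K Q)" for P Q R \<beta> \<beta>' \<alpha> \<alpha>'
  proof -
    have "hcomp K (id2 K R) (hcomp K \<beta>' \<beta>) = hcomp K (hcomp K \<alpha>' (id2 K Q)) \<beta>"
      using that by (subst K.hcomp_assoc) simp_all
    also have "\<dots> = hcomp K \<alpha>' (hcomp K (id2 K Q) \<beta>)"
      using that by (subst K.hcomp_assoc) simp_all
    also have "\<dots> = hcomp K (hcomp K \<alpha>' \<alpha>) (id2 K P)"
      using that by (simp add: K.hcomp_assoc)
    finally show ?thesis .
  qed
  have v: "hcomp K (id2 K Q) (vcomp K \<beta>' \<beta>) = hcomp K (vcomp K \<alpha>' \<alpha>) (id2 K P)"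
    if "P \<in> C1 K" "Q \<in> C1 K" "\<beta> \<in> C2 K" "\<beta>' \<in> C2 K" "\<alpha> \<in> C2 K" "\<alpha>' \<in> C2 K"
      "t1 K (s2 K \<beta>) = s1 K Q" "s1 K (s2 K \<alpha>) = t1 K P"
      "t2 K \<beta> = s2 K \<beta>'" "t2 K \<alpha> = s2 K \<alpha>'"
      "hcomp K (id2 K Q) \<beta> = hcomp K \<alpha> (id2 K P)"
      "hcomp K (id2 K Q) \<beta>' = hcomp K \<alpha>' (id2 K P)" for P Q \<beta> \<beta>' \<alpha> \<alpha>'
  proof -
    \<comment> \<open>An identity 2-cell is its own vertical square. Written that way, interchange
      distributes whiskering over a vertical composite.\<close>
    have Q: "id2 K Q = vcomp K (id2 K Q) (id2 K Q)" and P: "id2 K P = vcomp K (id2 K P) (id2 K P)"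
      using K.vcomp_id_right[of "id2 K Q"] K.vcomp_id_right[of "id2 K P"] that by auto
    have "hcomp K (id2 K Q) (vcomp K \<beta>' \<beta>) = hcomp K (vcomp K (id2 K Q) (id2 K Q)) (vcomp K \<beta>' \<beta>)"
      using Q by simp
    also have "\<dots> = vcomp K (hcomp K \<alpha>' (id2 K P)) (hcomp K \<alpha> (id2 K P))"
      using that by (subst K.interchange) simp_all
    also have "\<dots> = hcomp K (vcomp K \<alpha>' \<alpha>) (vcomp K (id2 K P) (id2 K P))"
      using that by (subst K.interchange) simp_all
    finally show ?thesis using P by simp
  qed
  have comp: "(P, comp1 K T' T, comp1 K S' S, R) \<in> C1 (arrow2 K)"
    if "(P, T, S, Q) \<in> C1 (arrow2 K)" "(Q, T', S', R) \<in> C1 (arrow2 K)" for P Q R T T' S S'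
    using that sq[of P Q R T T' S S'] by (simp add: arrow2_C1)
  show ?thesis
  \<comment> \<open>The case numbers follow the order of the axioms of \<open>two_category\<close>.
    The cases singled out are closure and associativity of the three compositions, and
    interchange.\<close>
  proof (unfold_locales, goal_cases)
    case (13 f g) then show ?case by (cases f; cases g) (simp add: comp)
  next
    case (18 f g h)
    then show ?case by (cases f; cases g; cases h) (simp add: arrow2_C1 K.comp1_assoc)
  next
    case (19 a b) then show ?case by (cases a; cases b) (simp add: arrow2_C1 v)
  next
    case (24 a b c)
    then show ?case by (cases a; cases b; cases c) (simp add: K.vcomp_assoc)
  next
    case (25 a b)
    obtain P \<beta> \<alpha> Q where a: "a = (P, \<beta>, \<alpha>, Q)" by (cases a)
    moreover obtain R \<beta>' \<alpha>' where "b = (Q, \<beta>', \<alpha>', R)" using 25 a by (cases b) simp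
    ultimately show ?case using 25 h[of P Q R \<beta> \<beta>' \<alpha> \<alpha>']
        comp[of P "s2 K \<beta>" "s2 K \<alpha>" Q "s2 K \<beta>'" "s2 K \<alpha>'" R]
        comp[of P "t2 K \<beta>" "t2 K \<alpha>" Q "t2 K \<beta>'" "t2 K \<alpha>'" R]
      by (simp add: arrow2_C1)
  next
    case (30 a b c)
    then show ?case by (cases a; cases b; cases c) (simp add: arrow2_C1 K.hcomp_assoc)
  next
    case (32 a a' b b')
    then show ?case by (cases a; cases a'; cases b; cases b') (simp add: arrow2_C1 K.interchange)
  qed (auto simp: arrow2_C1)
qed

section \<open>Structured objects with tagged cells\<close>

lemma structured_simps [simp]:
  "C0 (structured K S und R1 R2) = S"
  "(X, f, Y) \<in> C1 (structured K S und R1 R2) \<longleftrightarrow>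
     X \<in> S \<and> Y \<in> S \<and> f \<in> C1 K \<and> s1 K f = und X \<and> t1 K f = und Y \<and> R1 X f Y"
  "(X, a, Y) \<in> C2 (structured K S und R1 R2) \<longleftrightarrow>
     a \<in> C2 K \<and> (X, s2 K a, Y) \<in> C1 (structured K S und R1 R2)
      \<and> (X, t2 K a, Y) \<in> C1 (structured K S und R1 R2) \<and> R2 X a Y"
  "s1 (structured K S und R1 R2) (X, f, Y) = X"
  "t1 (structured K S und R1 R2) (X, f, Y) = Y"
  "s2 (structured K S und R1 R2) (X, a, Y) = (X, s2 K a, Y)"
  "t2 (structured K S und R1 R2) (X, a, Y) = (X, t2 K a, Y)"
  "id1 (structured K S und R1 R2) X = (X, id1 K (und X), X)"
  "id2 (structured K S und R1 R2) (X, f, Y) = (X, id2 K f, Y)"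
  "comp1 (structured K S und R1 R2) (Y', g, Z) (X, f, Y) = (X, comp1 K g f, Z)"
  "vcomp (structured K S und R1 R2) (X', b, Y') (X, a, Y) = (X, vcomp K b a, Y)"
  "hcomp (structured K S und R1 R2) (Y', b, Z) (X, a, Y) = (X, hcomp K b a, Z)"
  by (auto simp: structured_def Let_def)

lemma forget_simps [simp]:
  "F0 (forget und) X = und X"
  "F1 (forget und) (X, f, Y) = f"
  "F2 (forget und) (X, a, Y) = a"
  by (simp_all add: forget_def)

text \<open>Closure of the two conditions is all that has to be asked, because the equational axioms
  are inherited from \<open>K\<close>. \<open>SCoFib\<close> and \<open>Alg_s\<close> are both
  instances.\<close>

locale structured_cells = two_category K for K :: "('o, 'm, 'c) twocat" +
  fixes S :: "'z set" and und :: "'z \<Rightarrow> 'o"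
    and R1 :: "'z \<Rightarrow> 'm \<Rightarrow> 'z \<Rightarrow> bool" and R2 :: "'z \<Rightarrow> 'c \<Rightarrow> 'z \<Rightarrow> bool"
  assumes und_in: "X \<in> S \<Longrightarrow> und X \<in> C0 K"
    and R1_id: "X \<in> S \<Longrightarrow> R1 X (id1 K (und X)) X"
    and R1_comp: "\<lbrakk>X \<in> S; Y \<in> S; Z \<in> S; f \<in> C1 K; g \<in> C1 K; s1 K f = und X; t1 K f = und Y;
        s1 K g = und Y; t1 K g = und Z; R1 X f Y; R1 Y g Z\<rbrakk> \<Longrightarrow> R1 X (comp1 K g f) Z"
    and R2_id: "\<lbrakk>X \<in> S; Y \<in> S; f \<in> C1 K; s1 K f = und X; t1 K f = und Y; R1 X f Y\<rbrakk>
        \<Longrightarrow> R2 X (id2 K f) Y"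
    and R2_vcomp: "\<lbrakk>X \<in> S; Y \<in> S; a \<in> C2 K; b \<in> C2 K; t2 K a = s2 K b; s1 K (s2 K a) = und X;
        t1 K (s2 K a) = und Y; R2 X a Y; R2 X b Y\<rbrakk> \<Longrightarrow> R2 X (vcomp K b a) Y"
    and R2_hcomp: "\<lbrakk>X \<in> S; Y \<in> S; Z \<in> S; a \<in> C2 K; b \<in> C2 K; s1 K (s2 K a) = und X;
        t1 K (s2 K a) = und Y; s1 K (s2 K b) = und Y; t1 K (s2 K b) = und Z;
        R2 X a Y; R2 Y b Z\<rbrakk> \<Longrightarrow> R2 X (hcomp K b a) Z"
begin

lemma two_category_structured: "two_category (structured K S und R1 R2)"
proof -
  note laws [simp] comp1_assoc [simp] vcomp_assoc [simp] hcomp_assoc [simp] interchange [simp]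
    und_in [simp] R1_id [simp] R1_comp [intro] R2_id [simp] R2_vcomp [intro] R2_hcomp [intro]
  show ?thesis
    by unfold_locales (auto 5 3)
qed

lemma two_functor_forget: "two_functor (structured K S und R1 R2) K (forget und)"
proof -
  interpret A: two_category "structured K S und R1 R2" by (rule two_category_structured)
  show ?thesis by unfold_locales (auto simp: und_in)
qed

end

section \<open>2-monads and algebras from a 2-adjunction\<close>

lemma tf_comp_simps [simp]:
  "F0 (tf_comp G F) X = F0 G (F0 F X)"
  "F1 (tf_comp G F) f = F1 G (F1 F f)"
  "F2 (tf_comp G F) a = F2 G (F2 F a)"
  by (simp_all add: tf_comp_def)

lemma tf_id_simps [simp]: "F0 tf_id X = X" "F1 tf_id f = f" "F2 tf_id a = a"
  by (simp_all add: tf_id_def)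

lemmas (in two_functor) functor_laws = F0_in F1_in F2_in F_s1 F_t1 F_s2 F_t2 F_id1 F_id2
  F_comp1 F_vcomp F_hcomp

lemma two_functor_comp:
  assumes "two_functor A B F" "two_functor B C G"
  shows "two_functor A C (tf_comp G F)"
proof -
  interpret F: two_functor A B F by fact
  interpret G: two_functor B C G by fact
  show ?thesis by unfold_locales (simp_all add: F.functor_laws G.functor_laws F.A.laws)
qed

lemma (in two_category) two_functor_id: "two_functor K K tf_id"
  by unfold_locales simp_all

text \<open>\<open>T\<close> preserves composites, so the compatibility squares of two composable
  cells paste to the square of their composite.\<close>

lemma structured_cells_algebras:
  assumes "two_functor K K (mfun T)"
  shows "structured_cells K (algebras K T) fst
     (\<lambda>(X, a) f (Y, b). comp1 K f a = comp1 K b (F1 (mfun T) f))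
     (\<lambda>(X, a) \<alpha> (Y, b). hcomp K \<alpha> (id2 K a) = hcomp K (id2 K b) (F2 (mfun T) \<alpha>))"
proof -
  interpret T: two_functor K K "mfun T" by fact
  note T.A.laws [simp] T.functor_laws [simp]
  show ?thesis
  proof (unfold_locales, goal_cases)
    case (3 X Y Z f g)
    then obtain x a y b z c where X: "X = (x, a)" "Y = (y, b)" "Z = (z, c)" by (cases X, cases Y, cases Z)
    note [simp] = 3(4-9)[unfolded X, simplified]
    have a [simp]: "a \<in> C1 K" "b \<in> C1 K" "c \<in> C1 K" "s1 K a = F0 (mfun T) x" "s1 K b = F0 (mfun T) y"
      "s1 K c = F0 (mfun T) z" "t1 K a = x" "t1 K b = y" "t1 K c = z"
      and R: "comp1 K f a = comp1 K b (F1 (mfun T) f)" "comp1 K g b = comp1 K c (F1 (mfun T) g)"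
      using 3 X by (auto simp: algebras_def)
    have "comp1 K (comp1 K g f) a = comp1 K g (comp1 K b (F1 (mfun T) f))"
      by (simp add: T.A.comp1_assoc flip: R)
    also have "\<dots> = comp1 K (comp1 K c (F1 (mfun T) g)) (F1 (mfun T) f)"
      by (simp add: T.A.comp1_assoc R)
    also have "\<dots> = comp1 K c (comp1 K (F1 (mfun T) g) (F1 (mfun T) f))"
      by (simp add: T.A.comp1_assoc)
    finally show ?case using 3 X by (auto simp: algebras_def)
  next
    case (5 X Y \<alpha> \<beta>)
    then obtain x a y b where X: "X = (x, a)" "Y = (y, b)" by (cases X, cases Y)
    \<comment> \<open>Doubling the identities on the actions prepares the two uses of interchange
      below.\<close>
    have i: "id2 K a = vcomp K (id2 K a) (id2 K a)" "id2 K b = vcomp K (id2 K b) (id2 K b)"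
      using T.A.id_laws(3)[of "id2 K a" a] T.A.id_laws(3)[of "id2 K b" b] 5 X
      by (auto simp: algebras_def)
    have "hcomp K (vcomp K \<beta> \<alpha>) (id2 K a) = hcomp K (vcomp K \<beta> \<alpha>) (vcomp K (id2 K a) (id2 K a))"
      using i by simp
    also have "\<dots> = vcomp K (hcomp K \<beta> (id2 K a)) (hcomp K \<alpha> (id2 K a))"
      using 5 X by (subst T.A.interchange) (auto simp: algebras_def)
    also have "\<dots> = vcomp K (hcomp K (id2 K b) (F2 (mfun T) \<beta>)) (hcomp K (id2 K b) (F2 (mfun T) \<alpha>))"
      using 5 X by simp
    also have "\<dots> = hcomp K (vcomp K (id2 K b) (id2 K b)) (vcomp K (F2 (mfun T) \<beta>) (F2 (mfun T) \<alpha>))"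
      using 5 X by (subst T.A.interchange) (auto simp: algebras_def)
    finally show ?case using 5 X i by auto
  next
    case (6 X Y Z \<alpha> \<beta>)
    then obtain x a y b z c where X: "X = (x, a)" "Y = (y, b)" "Z = (z, c)" by (cases X, cases Y, cases Z)
    note [simp] = 6(4-9)[unfolded X, simplified]
    have a [simp]: "a \<in> C1 K" "b \<in> C1 K" "c \<in> C1 K" "s1 K a = F0 (mfun T) x" "s1 K b = F0 (mfun T) y"
      "s1 K c = F0 (mfun T) z" "t1 K a = x" "t1 K b = y" "t1 K c = z"
      and R: "hcomp K \<alpha> (id2 K a) = hcomp K (id2 K b) (F2 (mfun T) \<alpha>)"
        "hcomp K \<beta> (id2 K b) = hcomp K (id2 K c) (F2 (mfun T) \<beta>)"
      using 6 X by (auto simp: algebras_def)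
    have "hcomp K (hcomp K \<beta> \<alpha>) (id2 K a) = hcomp K \<beta> (hcomp K (id2 K b) (F2 (mfun T) \<alpha>))"
      by (simp add: T.A.hcomp_assoc flip: R)
    also have "\<dots> = hcomp K (hcomp K (id2 K c) (F2 (mfun T) \<beta>)) (F2 (mfun T) \<alpha>)"
      by (simp add: T.A.hcomp_assoc R)
    also have "\<dots> = hcomp K (id2 K c) (hcomp K (F2 (mfun T) \<beta>) (F2 (mfun T) \<alpha>))"
      by (simp add: T.A.hcomp_assoc)
    finally show ?case using 6 X by (auto simp: algebras_def)
  qed (auto simp: algebras_def)
qed

context two_adjunction
begin

text \<open>This is U applied to naturality of \<open>\<epsilon>\<close> at cells in the image of F.
  The family \<open>m\<close> has to agree with the counit formula on objects only, so a
  multiplication defined by its own formula fits.\<close>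

lemma two_natural_mult:
  assumes T: "\<And>X. X \<in> C0 K \<Longrightarrow> m X = F1 U (\<epsilon> (F0 F X))"
  shows "two_natural K K (tf_comp (tf_comp U F) (tf_comp U F)) (tf_comp U F) m"
proof -
  interpret T: two_functor K K "tf_comp U F" by (rule \<eta>.G.two_functor_axioms)
  interpret TT: two_functor K K "tf_comp (tf_comp U F) (tf_comp U F)"
    by (rule two_functor_comp) (rule \<eta>.G.two_functor_axioms)+
  note F.functor_laws [simp] U.functor_laws [simp] F.A.laws [simp] F.B.laws [simp]
    \<epsilon>.component_in [simp] \<epsilon>.s1_component [simp] \<epsilon>.t1_component [simp]
  show ?thesis
  proof (unfold_locales, goal_cases)
    case (4 f)
    have "F1 U (comp1 A (F1 F f) (\<epsilon> (s1 A (F1 F f))))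
        = F1 U (comp1 A (\<epsilon> (t1 A (F1 F f))) (F1 F (F1 U (F1 F f))))"
      using 4 \<epsilon>.natural1[of "F1 F f"] by (simp del: U.F_comp1)
    then show ?case using 4 T by simp
  next
    case (5 a)
    have "F2 U (hcomp A (F2 F a) (id2 A (\<epsilon> (s1 A (s2 A (F2 F a))))))
        = F2 U (hcomp A (id2 A (\<epsilon> (t1 A (s2 A (F2 F a))))) (F2 F (F2 U (F2 F a))))"
      using 5 \<epsilon>.natural2[of "F2 F a"] by (simp del: U.F_hcomp)
    then show ?case using 5 T by simp
  qed (simp_all add: T)
qed

text \<open>One unit law is a triangle identity at F X, the other is U of the remaining triangle,
  and associativity is U of naturality of \<open>\<epsilon>\<close> at its own component at F
  X.\<close>

lemma two_monad_induced:
  assumes [simp]: "mfun T = tf_comp U F" "munit T = \<eta>"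
    and m [simp]: "\<And>X. X \<in> C0 K \<Longrightarrow> mmult T X = F1 U (\<epsilon> (F0 F X))"
  shows "two_monad K T"
proof -
  interpret T: two_functor K K "mfun T" using \<eta>.G.two_functor_axioms by simp
  interpret \<eta>: two_natural K K tf_id "mfun T" "munit T" using \<eta>.two_natural_axioms by simp
  interpret \<mu>: two_natural K K "tf_comp (mfun T) (mfun T)" "mfun T" "mmult T"
    using two_natural_mult[OF m] by simp
  note F.functor_laws [simp] U.functor_laws [simp] F.A.laws [simp] F.B.laws [simp]
    \<epsilon>.component_in [simp] \<epsilon>.s1_component [simp] \<epsilon>.t1_component [simp]
  show ?thesis
  proof (unfold_locales, goal_cases)
    case (1 X)
    then show ?case using triangle_U[of "F0 F X"] by simp
  next
    case (2 X)
    then have "F1 U (comp1 A (\<epsilon> (F0 F X)) (F1 F (\<eta> X))) = F1 U (id1 A (F0 F X))"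
      using triangle_F by simp
    moreover have "\<eta> X \<in> C1 K" "s1 K (\<eta> X) = X" "t1 K (\<eta> X) = F0 U (F0 F X)"
      using 2 \<eta>.component_in \<eta>.s1_component \<eta>.t1_component by auto
    ultimately show ?case using 2 by simp
  next
    case (3 X)
    then have "F1 U (comp1 A (\<epsilon> (F0 F X)) (\<epsilon> (s1 A (\<epsilon> (F0 F X)))))
        = F1 U (comp1 A (\<epsilon> (t1 A (\<epsilon> (F0 F X)))) (F1 F (F1 U (\<epsilon> (F0 F X)))))"
      using \<epsilon>.natural1[of "\<epsilon> (F0 F X)"] by (simp del: U.F_comp1)
    then show ?case using 3 by simp
  qed
qed

text \<open>The unit law is a triangle identity; the multiplication law is U of naturality of
  \<open>\<epsilon>\<close> at its own component at Z.\<close>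

lemma induced_algebra:
  assumes [simp]: "mfun T = tf_comp U F" "munit T = \<eta>"
    and m [simp]: "\<And>X. X \<in> C0 K \<Longrightarrow> mmult T X = F1 U (\<epsilon> (F0 F X))"
    and Z: "Z \<in> C0 A"
  shows "(F0 U Z, F1 U (\<epsilon> Z)) \<in> algebras K T"
proof -
  note F.functor_laws [simp] U.functor_laws [simp]
    \<epsilon>.component_in [simp] \<epsilon>.s1_component [simp] \<epsilon>.t1_component [simp]
  have "F1 U (comp1 A (\<epsilon> Z) (\<epsilon> (s1 A (\<epsilon> Z)))) = F1 U (comp1 A (\<epsilon> (t1 A (\<epsilon> Z))) (F1 F (F1 U (\<epsilon> Z))))"
    using \<epsilon>.natural1[of "\<epsilon> Z"] Z by (simp del: U.F_comp1)
  then show ?thesis using Z triangle_U[of Z] by (simp add: algebras_def)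
qed

end

text \<open>Corresponding cells on the two sides are the same cell of \<open>K\<close> with
  different tags, so a bijection of objects transports everything. The 2-cell conditions are
  compared only for cells whose boundary satisfies \<open>R1\<close>: compatibility with actions is
  automatic for 2-cells between squares that preserve lifts.\<close>

lemma two_iso_over_structured:
  fixes K :: "('o, 'm, 'c) twocat" and g :: "'z \<Rightarrow> 'y"
  assumes "structured_cells K S und R1 R2" "structured_cells K S' und' R1' R2'"
    and g: "bij_betw g S S'" "\<And>X. X \<in> S \<Longrightarrow> und' (g X) = und X"
    and R1: "\<And>X f Y. \<lbrakk>X \<in> S; Y \<in> S; f \<in> C1 K; s1 K f = und X; t1 K f = und Y\<rbrakk>
      \<Longrightarrow> R1' (g X) f (g Y) \<longleftrightarrow> R1 X f Y"
    and R2: "\<And>X a Y. \<lbrakk>X \<in> S; Y \<in> S; a \<in> C2 K; (X, s2 K a, Y) \<in> C1 (structured K S und R1 R2);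
        (X, t2 K a, Y) \<in> C1 (structured K S und R1 R2)\<rbrakk> \<Longrightarrow> R2' (g X) a (g Y) \<longleftrightarrow> R2 X a Y"
    and G: "\<And>X. F0 G X = g X" "\<And>X f Y. F1 G (X, f, Y) = (g X, f, g Y)"
      "\<And>X a Y. F2 G (X, a, Y) = (g X, a, g Y)"
  shows "two_iso_over K (structured K S und R1 R2) (forget und)
    (structured K S' und' R1' R2') (forget und') G"
proof -
  interpret A: structured_cells K S und R1 R2 by fact
  interpret B: structured_cells K S' und' R1' R2' by fact
  interpret SA: two_category "structured K S und R1 R2" by (rule A.two_category_structured)
  interpret SB: two_category "structured K S' und' R1' R2'" by (rule B.two_category_structured)
  define h where "h = inv_into S g"
  have gS: "g X \<in> S'" if "X \<in> S" for X using g(1) that by (auto simp: bij_betw_def)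
  have hS: "h X \<in> S" "g (h X) = X" if "X \<in> S'" for X
    using g(1) that by (auto simp: bij_betw_def h_def inv_into_into f_inv_into_f)
  have hg: "h (g X) = X" if "X \<in> S" for X
    using g(1) that by (auto simp: bij_betw_def h_def)
  have und: "und (h X) = und' X" if "X \<in> S'" for X
    using g(2)[of "h X"] hS[OF that] by simp
  have R1'': "R1 (h X) f (h Y) \<longleftrightarrow> R1' X f Y"
    if "X \<in> S'" "Y \<in> S'" "f \<in> C1 K" "s1 K f = und' X" "t1 K f = und' Y" for X f Y
    using R1[of "h X" "h Y" f] hS that und by simp
  define H :: "('y, 'y \<times> 'm \<times> 'y, 'y \<times> 'c \<times> 'y, 'z, 'z \<times> 'm \<times> 'z, 'z \<times> 'c \<times> 'z) twofun"
    where "H = \<lparr>F0 = h, F1 = (\<lambda>(X, f, Y). (h X, f, h Y)), F2 = (\<lambda>(X, a, Y). (h X, a, h Y))\<rparr>"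
  have H: "F0 H X = h X" "F1 H (X, f, Y) = (h X, f, h Y)" "F2 H (X, a, Y) = (h X, a, h Y)" for X Y f a
    by (simp_all add: H_def)
  have "two_functor (structured K S und R1 R2) (structured K S' und' R1' R2') G"
    by unfold_locales (auto simp: G gS g R1 R2 A.laws)
  moreover have "two_functor (structured K S' und' R1' R2') (structured K S und R1 R2) H"
  proof (unfold_locales, goal_cases)
    \<comment> \<open>Closure on 2-cells reads the hypothesis on \<open>R2\<close> backwards, so it
      is instantiated at the preimages of the endpoints.\<close>
    case (3 c)
    then show ?case
      using R2[of "h (fst c)" "h (snd (snd c))" "fst (snd c)"]
      by (cases c) (auto simp: H hS und R1'' A.laws)
  qed (auto simp: H hS und R1'' A.laws)
  moreover have "tf_eq (structured K S und R1 R2) (tf_comp H G) tf_id"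
    by (auto simp: tf_eq_def G H hg)
  moreover have "tf_eq (structured K S' und' R1' R2') (tf_comp G H) tf_id"
    by (auto simp: tf_eq_def G H hS)
  moreover have "tf_eq (structured K S und R1 R2) (tf_comp (forget und') G) (forget und)"
    by (auto simp: tf_eq_def G g)
  ultimately show ?thesis
    using A.two_functor_forget B.two_functor_forget
    unfolding two_iso_over_def two_iso_def by blast
qed

section \<open>The 2-category of categories\<close>

lemma hom_iff: "f \<in> hom C x y \<longleftrightarrow> f \<in> Ar C \<and> src C f = x \<and> tgt C f = y"
  by (simp add: hom_def)

context category
begin

lemma arrow_simps [simp]:
  "f \<in> Ar C \<Longrightarrow> src C f \<in> Ob C"
  "f \<in> Ar C \<Longrightarrow> tgt C f \<in> Ob C"
  "x \<in> Ob C \<Longrightarrow> ide C x \<in> Ar C"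
  "x \<in> Ob C \<Longrightarrow> src C (ide C x) = x"
  "x \<in> Ob C \<Longrightarrow> tgt C (ide C x) = x"
  "\<lbrakk>f \<in> Ar C; g \<in> Ar C; tgt C f = src C g\<rbrakk> \<Longrightarrow> cmp C g f \<in> Ar C"
  "\<lbrakk>f \<in> Ar C; g \<in> Ar C; tgt C f = src C g\<rbrakk> \<Longrightarrow> src C (cmp C g f) = src C f"
  "\<lbrakk>f \<in> Ar C; g \<in> Ar C; tgt C f = src C g\<rbrakk> \<Longrightarrow> tgt C (cmp C g f) = tgt C g"
  "\<lbrakk>f \<in> Ar C; src C f = x\<rbrakk> \<Longrightarrow> cmp C f (ide C x) = f"
  "\<lbrakk>f \<in> Ar C; tgt C f = x\<rbrakk> \<Longrightarrow> cmp C (ide C x) f = f"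
  using src_in tgt_in ide_in cmp_in cmp_ide_right cmp_ide_left by (auto simp: hom_iff)

lemma assoc:
  "\<lbrakk>f \<in> Ar C; g \<in> Ar C; h \<in> Ar C; tgt C f = src C g; tgt C g = src C h\<rbrakk>
    \<Longrightarrow> cmp C h (cmp C g f) = cmp C (cmp C h g) f"
  by (rule cmp_assoc) (auto simp: hom_iff)

end

lemma categoryI:
  assumes "src C \<in> extensional (Ar C)" "tgt C \<in> extensional (Ar C)" "ide C \<in> extensional (Ob C)"
    "\<And>f. f \<in> Ar C \<Longrightarrow> src C f \<in> Ob C" "\<And>f. f \<in> Ar C \<Longrightarrow> tgt C f \<in> Ob C"
    "\<And>x. x \<in> Ob C \<Longrightarrow> ide C x \<in> Ar C \<and> src C (ide C x) = x \<and> tgt C (ide C x) = x"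
    "\<And>f g. \<lbrakk>f \<in> Ar C; g \<in> Ar C; tgt C f = src C g\<rbrakk>
      \<Longrightarrow> cmp C g f \<in> Ar C \<and> src C (cmp C g f) = src C f \<and> tgt C (cmp C g f) = tgt C g"
    "\<And>f g. \<not> (f \<in> Ar C \<and> g \<in> Ar C \<and> tgt C f = src C g) \<Longrightarrow> cmp C g f = undefined"
    "\<And>f. f \<in> Ar C \<Longrightarrow> cmp C f (ide C (src C f)) = f"
    "\<And>f. f \<in> Ar C \<Longrightarrow> cmp C (ide C (tgt C f)) f = f"
    "\<And>f g h. \<lbrakk>f \<in> Ar C; g \<in> Ar C; h \<in> Ar C; tgt C f = src C g; tgt C g = src C h\<rbrakk>
      \<Longrightarrow> cmp C h (cmp C g f) = cmp C (cmp C h g) f"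
  shows "category C"
  using assms by unfold_locales (auto simp: hom_iff PiE_iff)

text \<open>Domain and codomain become parameters, so that rules about arrows of \<open>A\<close>
  and \<open>B\<close> apply directly once \<open>fdom F\<close> and \<open>fcod F\<close> are
  rewritten away.\<close>

locale functor_on =
  fixes A B :: "'u cat" and F :: "'u func"
  assumes functorial: "is_functor F" and fdom [simp]: "fdom F = A" and fcod [simp]: "fcod F = B"
begin

sublocale is_functor F by (rule functorial)

sublocale A: category A using dom.category_axioms by simp
sublocale B: category B using cod.category_axioms by simp

lemma functor_simps [simp]:
  "x \<in> Ob A \<Longrightarrow> fob F x \<in> Ob B"
  "f \<in> Ar A \<Longrightarrow> far F f \<in> Ar B"
  "f \<in> Ar A \<Longrightarrow> src B (far F f) = fob F (src A f)"
  "f \<in> Ar A \<Longrightarrow> tgt B (far F f) = fob F (tgt A f)"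
  "x \<in> Ob A \<Longrightarrow> far F (ide A x) = ide B (fob F x)"
  "\<lbrakk>f \<in> Ar A; g \<in> Ar A; tgt A f = src A g\<rbrakk> \<Longrightarrow> far F (cmp A g f) = cmp B (far F g) (far F f)"
  using fob_in far_in far_ide far_cmp by (auto simp: hom_iff)

lemma functor_ext: "fob F \<in> extensional (Ob A)" "far F \<in> extensional (Ar A)"
  using fob_in far_ext by (auto simp: PiE_iff)

end

lemma functor_onI:
  assumes "category A" "category B" "fdom F = A" "fcod F = B"
    "fob F \<in> extensional (Ob A)" "far F \<in> extensional (Ar A)"
    "\<And>x. x \<in> Ob A \<Longrightarrow> fob F x \<in> Ob B"
    "\<And>f. f \<in> Ar A \<Longrightarrow> far F f \<in> Ar B \<and> src B (far F f) = fob F (src A f) \<and> tgt B (far F f) = fob F (tgt A f)"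
    "\<And>x. x \<in> Ob A \<Longrightarrow> far F (ide A x) = ide B (fob F x)"
    "\<And>f g. \<lbrakk>f \<in> Ar A; g \<in> Ar A; tgt A f = src A g\<rbrakk> \<Longrightarrow> far F (cmp A g f) = cmp B (far F g) (far F f)"
  shows "functor_on A B F"
proof -
  interpret A: category A by fact
  interpret B: category B by fact
  show ?thesis
    using assms
    by (simp add: functor_on_def is_functor_def is_functor_axioms_def hom_iff PiE_iff)
qed

lemma functor_on_iff: "functor_on A B F \<longleftrightarrow> is_functor F \<and> fdom F = A \<and> fcod F = B"
  by (simp add: functor_on_def)

text \<open>Agreement on objects and arrows is enough for HOL equality because both maps are
  extensional.\<close>

lemma functor_eqI:
  assumes "functor_on A B F" "functor_on A B G"
    and "\<And>x. x \<in> Ob A \<Longrightarrow> fob F x = fob G x" "\<And>f. f \<in> Ar A \<Longrightarrow> far F f = far G f"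
  shows "F = G"
proof -
  interpret F: functor_on A B F by fact
  interpret G: functor_on A B G by fact
  have "fob F = fob G" "far F = far G"
    using F.functor_ext G.functor_ext assms(3,4) by (auto intro!: extensionalityI)
  then show ?thesis by simp
qed

lemma functor_on_idf:
  assumes "category C" shows "functor_on C C (idf C)"
proof -
  interpret category C by fact
  show ?thesis by (rule functor_onI) (auto simp: idf_def category_axioms)
qed

lemma fob_idf [simp]: "x \<in> Ob C \<Longrightarrow> fob (idf C) x = x"
  and far_idf [simp]: "f \<in> Ar C \<Longrightarrow> far (idf C) f = f"
  and fdom_idf [simp]: "fdom (idf C) = C"
  and fcod_idf [simp]: "fcod (idf C) = C"
  by (simp_all add: idf_def)

lemma fcomp_simps:
  "fdom (fcomp G F) = fdom F"
  "fcod (fcomp G F) = fcod G"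
  "x \<in> Ob (fdom F) \<Longrightarrow> fob (fcomp G F) x = fob G (fob F x)"
  "f \<in> Ar (fdom F) \<Longrightarrow> far (fcomp G F) f = far G (far F f)"
  by (simp_all add: fcomp_def)

lemma functor_on_fcomp:
  assumes "functor_on A B F" "functor_on B C G"
  shows "functor_on A C (fcomp G F)"
proof -
  interpret F: functor_on A B F by fact
  interpret G: functor_on B C G by fact
  show ?thesis
    by (rule functor_onI) (auto simp: fcomp_def F.A.category_axioms G.B.category_axioms)
qed

lemma fcomp_assoc:
  assumes "functor_on A B F" "functor_on B C G" "functor_on C D H"
  shows "fcomp H (fcomp G F) = fcomp (fcomp H G) F"
proof -
  interpret F: functor_on A B F by fact
  interpret G: functor_on B C G by fact
  interpret H: functor_on C D H by fact
  show ?thesis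
    by (rule functor_eqI[OF functor_on_fcomp[OF functor_on_fcomp[OF assms(1,2)] assms(3)]
          functor_on_fcomp[OF assms(1) functor_on_fcomp[OF assms(2,3)]]]) (simp_all add: fcomp_simps)
qed

lemma fcomp_idf:
  assumes "functor_on A B F"
  shows "fcomp F (idf A) = F" "fcomp (idf B) F = F"
proof -
  interpret F: functor_on A B F by fact
  have A: "functor_on A A (idf A)" and B: "functor_on B B (idf B)"
    by (simp_all add: functor_on_idf F.A.category_axioms F.B.category_axioms)
  show "fcomp F (idf A) = F"
    by (rule functor_eqI[OF functor_on_fcomp[OF A assms] assms]) (simp_all add: fcomp_simps)
  show "fcomp (idf B) F = F"
    by (rule functor_eqI[OF functor_on_fcomp[OF assms B] assms]) (simp_all add: fcomp_simps)
qed

locale ntrans_on = F: functor_on A B F + G: functor_on A B G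
  for A B F G + fixes \<alpha> :: "'u ntrans"
  assumes ntrans: "is_ntrans \<alpha>" and nsrc [simp]: "nsrc \<alpha> = F" and ntgt [simp]: "ntgt \<alpha> = G"
begin

lemma ntrans_simps [simp]:
  "x \<in> Ob A \<Longrightarrow> ncmp \<alpha> x \<in> Ar B"
  "x \<in> Ob A \<Longrightarrow> src B (ncmp \<alpha> x) = fob F x"
  "x \<in> Ob A \<Longrightarrow> tgt B (ncmp \<alpha> x) = fob G x"
  using is_ntrans.ncmp_in[OF ntrans] by (auto simp: hom_iff)

lemma natural:
  "f \<in> Ar A \<Longrightarrow> cmp B (far G f) (ncmp \<alpha> (src A f)) = cmp B (ncmp \<alpha> (tgt A f)) (far F f)"
  using is_ntrans.naturality[OF ntrans] by (auto simp: hom_iff)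

lemma ntrans_ext: "ncmp \<alpha> \<in> extensional (Ob A)"
  using is_ntrans.ncmp_ext[OF ntrans] by simp

end

lemma ntrans_onI:
  assumes "functor_on A B F" "functor_on A B G" "nsrc \<alpha> = F" "ntgt \<alpha> = G"
    "ncmp \<alpha> \<in> extensional (Ob A)"
    "\<And>x. x \<in> Ob A \<Longrightarrow> ncmp \<alpha> x \<in> Ar B \<and> src B (ncmp \<alpha> x) = fob F x \<and> tgt B (ncmp \<alpha> x) = fob G x"
    "\<And>f. f \<in> Ar A \<Longrightarrow> cmp B (far G f) (ncmp \<alpha> (src A f)) = cmp B (ncmp \<alpha> (tgt A f)) (far F f)"
  shows "ntrans_on A B F G \<alpha>"
proof -
  interpret F: functor_on A B F by fact
  interpret G: functor_on A B G by fact
  show ?thesis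
    using assms F.functorial G.functorial
    by (auto simp: ntrans_on_def ntrans_on_axioms_def is_ntrans_def is_ntrans_axioms_def hom_iff)
qed

lemma ntrans_on_iff:
  "ntrans_on A B F G \<alpha> \<longleftrightarrow> is_ntrans \<alpha> \<and> nsrc \<alpha> = F \<and> ntgt \<alpha> = G \<and> fdom F = A \<and> fcod F = B"
proof
  assume *: "is_ntrans \<alpha> \<and> nsrc \<alpha> = F \<and> ntgt \<alpha> = G \<and> fdom F = A \<and> fcod F = B"
  then interpret is_ntrans \<alpha> by simp
  show "ntrans_on A B F G \<alpha>"
    using * src.is_functor_axioms tgt.is_functor_axioms same_fdom same_fcod is_ntrans_axioms
    by (auto simp: ntrans_on_def ntrans_on_axioms_def functor_on_iff)
next
  assume "ntrans_on A B F G \<alpha>"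
  then interpret ntrans_on A B F G \<alpha> .
  show "is_ntrans \<alpha> \<and> nsrc \<alpha> = F \<and> ntgt \<alpha> = G \<and> fdom F = A \<and> fcod F = B"
    by (simp add: ntrans)
qed

lemma ntrans_eqI:
  assumes "ntrans_on A B F G \<alpha>" "ntrans_on A B F G \<beta>"
    and "\<And>x. x \<in> Ob A \<Longrightarrow> ncmp \<alpha> x = ncmp \<beta> x"
  shows "\<alpha> = \<beta>"
proof -
  interpret \<alpha>: ntrans_on A B F G \<alpha> by fact
  interpret \<beta>: ntrans_on A B F G \<beta> by fact
  have "ncmp \<alpha> = ncmp \<beta>"
    using \<alpha>.ntrans_ext \<beta>.ntrans_ext assms(3) by (rule extensionalityI)
  then show ?thesis by simp
qed

lemma CAT_simps [simp]:
  "C \<in> C0 CAT \<longleftrightarrow> category C \<and> locally_small C"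
  "F \<in> C1 CAT \<longleftrightarrow> is_functor F \<and> locally_small (fdom F) \<and> locally_small (fcod F)"
  "\<alpha> \<in> C2 CAT \<longleftrightarrow> is_ntrans \<alpha> \<and> nsrc \<alpha> \<in> C1 CAT \<and> ntgt \<alpha> \<in> C1 CAT"
  "s1 CAT = fdom" "t1 CAT = fcod" "s2 CAT = nsrc" "t2 CAT = ntgt" "id1 CAT = idf"
  "comp1 CAT = fcomp"
  by (simp_all add: CAT_def Let_def)

lemma CAT_id2 [simp]:
  "nsrc (id2 CAT F) = F" "ntgt (id2 CAT F) = F"
  "x \<in> Ob (fdom F) \<Longrightarrow> ncmp (id2 CAT F) x = ide (fcod F) (fob F x)"
  by (simp_all add: CAT_def Let_def)

lemma CAT_vcomp [simp]:
  "nsrc (vcomp CAT \<beta> \<alpha>) = nsrc \<alpha>" "ntgt (vcomp CAT \<beta> \<alpha>) = ntgt \<beta>"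
  "x \<in> Ob (fdom (nsrc \<alpha>)) \<Longrightarrow> ncmp (vcomp CAT \<beta> \<alpha>) x = cmp (fcod (nsrc \<alpha>)) (ncmp \<beta> x) (ncmp \<alpha> x)"
  by (simp_all add: CAT_def Let_def)

lemma CAT_hcomp [simp]:
  "nsrc (hcomp CAT \<beta> \<alpha>) = fcomp (nsrc \<beta>) (nsrc \<alpha>)"
  "ntgt (hcomp CAT \<beta> \<alpha>) = fcomp (ntgt \<beta>) (ntgt \<alpha>)"
  "x \<in> Ob (fdom (nsrc \<alpha>)) \<Longrightarrow> ncmp (hcomp CAT \<beta> \<alpha>) x
    = cmp (fcod (nsrc \<beta>)) (ncmp \<beta> (fob (ntgt \<alpha>) x)) (far (nsrc \<beta>) (ncmp \<alpha> x))"
  by (simp_all add: CAT_def Let_def)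

lemma ntrans_on_id2:
  assumes "functor_on A B F" shows "ntrans_on A B F F (id2 CAT F)"
proof -
  interpret F: functor_on A B F by fact
  show ?thesis
    by (rule ntrans_onI) (simp_all add: assms, simp add: CAT_def Let_def)
qed

lemma ntrans_on_vcomp:
  assumes "ntrans_on A B F G \<alpha>" "ntrans_on A B G H \<beta>"
  shows "ntrans_on A B F H (vcomp CAT \<beta> \<alpha>)"
proof -
  interpret \<alpha>: ntrans_on A B F G \<alpha> by fact
  interpret \<beta>: ntrans_on A B G H \<beta> by fact
  show ?thesis
  proof (rule ntrans_onI)
    fix f assume [simp]: "f \<in> Ar A"
    show "cmp B (far H f) (ncmp (vcomp CAT \<beta> \<alpha>) (src A f))
        = cmp B (ncmp (vcomp CAT \<beta> \<alpha>) (tgt A f)) (far F f)"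
      using \<alpha>.natural[of f] \<beta>.natural[of f] \<alpha>.F.B.assoc
      by (simp add: \<alpha>.F.B.assoc) (simp flip: \<alpha>.F.B.assoc)
  qed (simp_all add: \<alpha>.F.functor_on_axioms \<beta>.G.functor_on_axioms, simp add: CAT_def Let_def)
qed

text \<open>Naturality of \<open>\<beta>\<close> is used at \<open>far G f\<close>, and naturality
  of \<open>\<alpha>\<close> is then transported along \<open>H\<close>.\<close>

lemma ntrans_on_hcomp:
  assumes "ntrans_on A B F G \<alpha>" "ntrans_on B C H K \<beta>"
  shows "ntrans_on A C (fcomp H F) (fcomp K G) (hcomp CAT \<beta> \<alpha>)"
proof -
  interpret \<alpha>: ntrans_on A B F G \<alpha> by fact
  interpret \<beta>: ntrans_on B C H K \<beta> by fact
  show ?thesis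
  proof (rule ntrans_onI)
    fix f assume [simp]: "f \<in> Ar A"
    have "cmp C (far K (far G f)) (cmp C (ncmp \<beta> (fob G (src A f))) (far H (ncmp \<alpha> (src A f))))
        = cmp C (ncmp \<beta> (fob G (tgt A f))) (far H (cmp B (far G f) (ncmp \<alpha> (src A f))))"
      using \<beta>.natural[of "far G f"] by (simp add: \<beta>.F.B.assoc)
    also have "\<dots> = cmp C (cmp C (ncmp \<beta> (fob G (tgt A f))) (far H (ncmp \<alpha> (tgt A f)))) (far H (far F f))"
      using \<alpha>.natural[of f] by (simp add: \<beta>.F.B.assoc)
    finally show "cmp C (far (fcomp K G) f) (ncmp (hcomp CAT \<beta> \<alpha>) (src A f))
        = cmp C (ncmp (hcomp CAT \<beta> \<alpha>) (tgt A f)) (far (fcomp H F) f)"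
      by (simp add: fcomp_simps)
  qed (simp_all add: fcomp_simps functor_on_fcomp[OF \<alpha>.F.functor_on_axioms \<beta>.F.functor_on_axioms]
      functor_on_fcomp[OF \<alpha>.G.functor_on_axioms \<beta>.G.functor_on_axioms], simp add: CAT_def Let_def)
qed

lemma hcomp_id2_idf:
  assumes a: "ntrans_on A B F G \<alpha>"
  shows "hcomp CAT \<alpha> (id2 CAT (idf A)) = \<alpha>" "hcomp CAT (id2 CAT (idf B)) \<alpha> = \<alpha>"
proof -
  interpret ntrans_on A B F G \<alpha> by fact
  note idf = functor_on_idf[OF F.A.category_axioms] functor_on_idf[OF F.B.category_axioms]
  note FG = fcomp_idf[OF F.functor_on_axioms] fcomp_idf[OF G.functor_on_axioms]
  show "hcomp CAT \<alpha> (id2 CAT (idf A)) = \<alpha>"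
    by (rule ntrans_eqI[OF ntrans_on_hcomp[OF ntrans_on_id2[OF idf(1)] a, unfolded FG] a]) simp
  show "hcomp CAT (id2 CAT (idf B)) \<alpha> = \<alpha>"
    by (rule ntrans_eqI[OF ntrans_on_hcomp[OF a ntrans_on_id2[OF idf(2)], unfolded FG] a]) simp
qed

lemma two_category_CAT: "two_category (CAT :: ('u cat, 'u func, 'u ntrans) twocat)"
proof -
  have f: "\<exists>A B. functor_on A B F" if "F \<in> C1 CAT" for F :: "'u func"
    using that by (auto simp: functor_on_iff)
  have n: "\<exists>B F G. ntrans_on A B F G \<alpha>" if "\<alpha> \<in> C2 CAT" "fdom (nsrc \<alpha>) = A"
    for \<alpha> :: "'u ntrans" and A
    using that by (auto simp: ntrans_on_iff)
  \<comment> \<open>For vertically composable cells the source functor is already named; this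
    variant keeps that name, so that the cells share \<open>A\<close> and \<open>B\<close>.\<close>
  have n': "\<exists>G. ntrans_on A B F G \<alpha>" if "\<alpha> \<in> C2 CAT" "fdom F = A" "fcod F = B" "nsrc \<alpha> = F"
    for \<alpha> :: "'u ntrans" and A B F
    using that by (auto simp: ntrans_on_iff)
  show ?thesis
  proof (unfold_locales, goal_cases)
    case (1 f)
    then show ?case by (auto simp: is_functor_def)
  next
    case (2 f)
    then show ?case by (auto simp: is_functor_def)
  next
    case (3 a)
    then show ?case by auto
  next
    case (4 a)
    then show ?case by auto
  next
    case (5 a)
    then show ?case by (auto simp: is_ntrans.same_fdom)
  next
    case (6 a)
    then show ?case by (auto simp: is_ntrans.same_fcod)
  next
    case (7 X)
    then show ?case using functor_on_idf[of X] by (auto simp: functor_on_iff)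
  next
    case (10 f)
    then show ?case using ntrans_on_id2[of "fdom f" "fcod f" f] by (auto simp: ntrans_on_iff functor_on_iff)
  next
    case (13 f g)
    then show ?case using functor_on_fcomp[of "fdom f" "fcod f" f "fcod g" g]
      by (auto simp: functor_on_iff)
  next
    case (16 f)
    then obtain A B where "functor_on A B f" using f by blast
    then interpret functor_on A B f .
    show ?case by (simp add: fcomp_idf(1)[OF functor_on_axioms])
  next
    case (17 f)
    then obtain A B where "functor_on A B f" using f by blast
    then interpret functor_on A B f .
    show ?case by (simp add: fcomp_idf(2)[OF functor_on_axioms])
  next
    case (18 f g h)
    then show ?case
      using fcomp_assoc[of "fdom f" "fcod f" f "fcod g" g "fcod h" h] by (auto simp: functor_on_iff)
  next
    case (19 a b)
    then have "fdom (nsrc b) = fdom (nsrc a)" "fcod (nsrc b) = fcod (nsrc a)"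
      using is_ntrans.same_fdom[of a] is_ntrans.same_fcod[of a] by auto
    with 19 show ?case
      using ntrans_on_vcomp[of "fdom (nsrc a)" "fcod (nsrc a)" "nsrc a" "ntgt a" a "ntgt b" b]
      by (auto simp: ntrans_on_iff)
  next
    case (22 a)
    then obtain A B F G where "ntrans_on A B F G a" using n[OF 22(1) refl] by blast
    then interpret ntrans_on A B F G a .
    show ?case
      by (simp, rule ntrans_eqI[OF ntrans_on_vcomp[OF ntrans_on_id2] ntrans_on_axioms])
        (auto simp: F.functor_on_axioms ntrans_on_axioms)
  next
    case (23 a)
    then obtain A B F G where "ntrans_on A B F G a" using n[OF 23(1) refl] by blast
    then interpret ntrans_on A B F G a .
    show ?case
      by (simp, rule ntrans_eqI[OF ntrans_on_vcomp[OF _ ntrans_on_id2] ntrans_on_axioms])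
        (auto simp: G.functor_on_axioms ntrans_on_axioms)
  next
    case (24 a b c)
    obtain A B F G where a: "ntrans_on A B F G a" using n[OF 24(1) refl] by blast
    then interpret a: ntrans_on A B F G a .
    have eqb: "nsrc b = G" using 24(4) by simp
    then obtain H where b: "ntrans_on A B G H b" using n'[OF 24(2) a.G.fdom a.G.fcod eqb] by blast
    then interpret b: ntrans_on A B G H b .
    have eqc: "nsrc c = H" using 24(5) by simp
    then obtain K where c: "ntrans_on A B H K c" using n'[OF 24(3) b.G.fdom b.G.fcod eqc] by blast
    then interpret c: ntrans_on A B H K c .
    show ?case
      by (rule ntrans_eqI[OF ntrans_on_vcomp[OF ntrans_on_vcomp[OF a b] c]
            ntrans_on_vcomp[OF a ntrans_on_vcomp[OF b c]]])
        (simp add: a.F.B.assoc)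
  next
    case (25 a b)
    obtain A B F G where a: "ntrans_on A B F G a" using n[OF 25(1) refl] by blast
    then interpret a: ntrans_on A B F G a .
    have "fdom (nsrc b) = B" using 25(3) by simp
    then obtain C H K where b: "ntrans_on B C H K b" using n[OF 25(2)] by blast
    then interpret b: ntrans_on B C H K b .
    show ?case
      using 25 ntrans_on_hcomp[OF a b] functor_on_fcomp[OF a.F.functor_on_axioms b.F.functor_on_axioms]
        functor_on_fcomp[OF a.G.functor_on_axioms b.G.functor_on_axioms]
      by (simp add: ntrans_on_iff functor_on_iff)
  next
    case (28 a)
    then obtain A B F G where "ntrans_on A B F G a" using n[OF 28(1) refl] by blast
    then interpret ntrans_on A B F G a .
    show ?case by (simp add: hcomp_id2_idf(1)[OF ntrans_on_axioms])
  next
    case (29 a)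
    then obtain A B F G where "ntrans_on A B F G a" using n[OF 29(1) refl] by blast
    then interpret ntrans_on A B F G a .
    show ?case by (simp add: hcomp_id2_idf(2)[OF ntrans_on_axioms])
  next
    case (30 a b c)
    obtain A B F G where a: "ntrans_on A B F G a" using n[OF 30(1) refl] by blast
    then interpret a: ntrans_on A B F G a .
    have "fdom (nsrc b) = B" using 30(4) by simp
    then obtain C H K where b: "ntrans_on B C H K b" using n[OF 30(2)] by blast
    then interpret b: ntrans_on B C H K b .
    have "fdom (nsrc c) = C" using 30(5) by simp
    then obtain D L M where c: "ntrans_on C D L M c" using n[OF 30(3)] by blast
    then interpret c: ntrans_on C D L M c .
    have eq: "fcomp L (fcomp H F) = fcomp (fcomp L H) F" "fcomp M (fcomp K G) = fcomp (fcomp M K) G"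
      by (rule fcomp_assoc a.F.functor_on_axioms b.F.functor_on_axioms c.F.functor_on_axioms
        a.G.functor_on_axioms b.G.functor_on_axioms c.G.functor_on_axioms)+
    show ?case
      by (rule ntrans_eqI[OF ntrans_on_hcomp[OF ntrans_on_hcomp[OF a b] c, unfolded eq]
            ntrans_on_hcomp[OF a ntrans_on_hcomp[OF b c]]])
        (simp add: fcomp_simps c.F.B.assoc)
  next
    case (31 f g)
    obtain A B where f: "functor_on A B f" using f[OF 31(1)] by blast
    then interpret f: functor_on A B f .
    from 31 obtain C where g: "functor_on B C g" by (auto simp: functor_on_iff)
    then interpret g: functor_on B C g .
    show ?case
      by (simp, rule ntrans_eqI[OF ntrans_on_hcomp[OF ntrans_on_id2[OF f] ntrans_on_id2[OF g]]
          ntrans_on_id2[OF functor_on_fcomp[OF f g]]]) (simp add: fcomp_simps)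
  next
    case (32 a a' b b')
    obtain A B F G where a: "ntrans_on A B F G a" using n[OF 32(1) refl] by blast
    then interpret a: ntrans_on A B F G a .
    have eqa': "nsrc a' = G" using 32(5) by simp
    then obtain G' where a': "ntrans_on A B G G' a'" using n'[OF 32(2) a.G.fdom a.G.fcod eqa'] by blast
    then interpret a': ntrans_on A B G G' a' .
    have "fdom (nsrc b) = B" using 32(7) by simp
    then obtain C H K where b: "ntrans_on B C H K b" using n[OF 32(3)] by blast
    then interpret b: ntrans_on B C H K b .
    have eqb': "nsrc b' = K" using 32(6) by simp
    then obtain K' where b': "ntrans_on B C K K' b'" using n'[OF 32(4) b.G.fdom b.G.fcod eqb'] by blast
    then interpret b': ntrans_on B C K K' b' .
    show ?case
    proof (rule ntrans_eqI[OF ntrans_on_hcomp[OF ntrans_on_vcomp[OF a a'] ntrans_on_vcomp[OF b b']]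
          ntrans_on_vcomp[OF ntrans_on_hcomp[OF a b] ntrans_on_hcomp[OF a' b']]])
      fix x assume [simp]: "x \<in> Ob A"
      \<comment> \<open>The two sides of interchange differ only in their two middle factors, which
        naturality of \<open>b\<close> at the component of \<open>a'\<close> exchanges.\<close>
      have "cmp C (ncmp b (fob G' x)) (far H (ncmp a' x)) = cmp C (far K (ncmp a' x)) (ncmp b (fob G x))"
        using b.natural[of "ncmp a' x"] by simp
      then have "cmp C (cmp C (ncmp b' (fob G' x)) (ncmp b (fob G' x))) (far H (ncmp a' x))
          = cmp C (cmp C (ncmp b' (fob G' x)) (far K (ncmp a' x))) (ncmp b (fob G x))"
        by (simp flip: b.F.B.assoc)
      then show "ncmp (hcomp CAT (vcomp CAT b' b) (vcomp CAT a' a)) x =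
        ncmp (vcomp CAT (hcomp CAT b' a') (hcomp CAT b a)) x"
        by (simp add: fcomp_simps b.F.B.assoc)
    qed
  qed (auto simp: fcomp_simps)
qed

section \<open>Comma categories and squares\<close>

text \<open>An infinite product of nonempty sets is equipollent to its larger factor, and a finite
  one is smaller than any infinite type. This is the size argument for comma categories, whose
  hom-sets embed in products of two hom-sets.\<close>

lemma lesspoll_Times:
  includes cardinal_syntax
  fixes X Y :: "'u::infinite set"
  assumes "X \<prec> (UNIV :: 'u set)" "Y \<prec> (UNIV :: 'u set)"
  shows "X \<times> Y \<prec> (UNIV :: 'u set)"
proof (cases "finite (X \<times> Y)")
  case True
  then show ?thesis by (simp add: finite_lesspoll_infinite infinite_UNIV)
next
  case False
  then have ne: "X \<noteq> {}" "Y \<noteq> {}" by auto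
  have "|X| \<le>o |Y| \<or> |Y| \<le>o |X|"
    by (simp add: card_of_Well_order ordLeq_total)
  then show ?thesis
  proof
    assume le: "|X| \<le>o |Y|"
    with False have "infinite Y" using card_of_ordLeq_finite[OF le] by auto
    then have "X \<times> Y \<approx> Y"
      using card_of_Times_infinite[OF _ ne(1) le] by (simp add: eqpoll_iff_card_of_ordIso)
    then show ?thesis using assms(2) by (rule eq_lesspoll_trans)
  next
    assume le: "|Y| \<le>o |X|"
    with False have "infinite X" using card_of_ordLeq_finite[OF le] by auto
    then have "X \<times> Y \<approx> X"
      using card_of_Times_infinite[OF _ ne(2) le] by (simp add: eqpoll_iff_card_of_ordIso)
    then show ?thesis using assms(1) by (rule eq_lesspoll_trans)
  qed
qed

section \<open>The comma category and its projection to the base\<close>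

lemma carr_proj [simp]:
  "csrc (carr z f v z') = z" "ctop (carr z f v z') = f"
  "cbot (carr z f v z') = v" "ctgt (carr z f v z') = z'"
  by (simp_all add: carr_def csrc_def ctop_def cbot_def ctgt_def)

lemma carr_eq_iff [simp]: "carr z f v z' = carr y g w y' \<longleftrightarrow> z = y \<and> f = g \<and> v = w \<and> z' = y'"
  by (auto simp: carr_def)

lemma comma_ob_iff [simp]:
  "upair x u \<in> comma_ob P \<longleftrightarrow> x \<in> Ob (fdom P) \<and> u \<in> Ar (fcod P) \<and> src (fcod P) u = fob P x"
  by (auto simp: comma_ob_def)

lemma comma_obD:
  assumes "z \<in> comma_ob P"
  shows "ufst z \<in> Ob (fdom P)" "usnd z \<in> Ar (fcod P)" "src (fcod P) (usnd z) = fob P (ufst z)"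
    "upair (ufst z) (usnd z) = z"
  using assms by (auto simp: comma_ob_def)

text \<open>Injectivity of the pairing lets projections replace the existential quantifiers of
  \<open>comma_ar\<close>, which makes membership a rewrite rule.\<close>

lemma comma_ar_iff:
  "carr z f v z' \<in> comma_ar P \<longleftrightarrow> z \<in> comma_ob P \<and> z' \<in> comma_ob P
     \<and> f \<in> Ar (fdom P) \<and> src (fdom P) f = ufst z \<and> tgt (fdom P) f = ufst z'
     \<and> v \<in> Ar (fcod P) \<and> src (fcod P) v = tgt (fcod P) (usnd z) \<and> tgt (fcod P) v = tgt (fcod P) (usnd z')
     \<and> cmp (fcod P) v (usnd z) = cmp (fcod P) (usnd z') (far P f)"
  (is "?L \<longleftrightarrow> ?R")
proof
  assume ?L
  then show ?R unfolding comma_ar_def hom_iff by auto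
next
  assume R: ?R
  then obtain x u y w where z: "z = upair x u" "z' = upair y w" unfolding comma_ob_def by blast
  show ?L unfolding comma_ar_def hom_iff mem_Collect_eq
    by (rule exI[of _ x], rule exI[of _ u], rule exI[of _ f], rule exI[of _ v],
        rule exI[of _ y], rule exI[of _ w]) (use R z in simp)
qed

lemma comma_arD:
  assumes "a \<in> comma_ar P"
  shows "csrc a \<in> comma_ob P" "ctgt a \<in> comma_ob P" "ctop a \<in> Ar (fdom P)" "cbot a \<in> Ar (fcod P)"
    "src (fdom P) (ctop a) = ufst (csrc a)" "tgt (fdom P) (ctop a) = ufst (ctgt a)"
    "src (fcod P) (cbot a) = tgt (fcod P) (usnd (csrc a))"
    "tgt (fcod P) (cbot a) = tgt (fcod P) (usnd (ctgt a))"
    "cmp (fcod P) (cbot a) (usnd (csrc a)) = cmp (fcod P) (usnd (ctgt a)) (far P (ctop a))"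
    "carr (csrc a) (ctop a) (cbot a) (ctgt a) = a"
  using assms by (auto simp: comma_ar_def hom_iff)

lemma comma_simps [simp]:
  "Ob (comma P) = comma_ob P" "Ar (comma P) = comma_ar P"
  "a \<in> comma_ar P \<Longrightarrow> src (comma P) a = csrc a"
  "a \<in> comma_ar P \<Longrightarrow> tgt (comma P) a = ctgt a"
  "z \<in> comma_ob P \<Longrightarrow> ide (comma P) z = carr z (ide (fdom P) (ufst z))
      (ide (fcod P) (tgt (fcod P) (usnd z))) z"
  "\<lbrakk>a \<in> comma_ar P; b \<in> comma_ar P; ctgt a = csrc b\<rbrakk>
     \<Longrightarrow> cmp (comma P) b a
        = carr (csrc a) (cmp (fdom P) (ctop b) (ctop a)) (cmp (fcod P) (cbot b) (cbot a)) (ctgt b)"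
  by (simp_all add: comma_def Let_def)

lemma CodF_simps [simp]:
  "fdom (CodF P) = comma P" "fcod (CodF P) = fcod P"
  "z \<in> comma_ob P \<Longrightarrow> fob (CodF P) z = tgt (fcod P) (usnd z)"
  "a \<in> comma_ar P \<Longrightarrow> far (CodF P) a = cbot a"
  by (simp_all add: CodF_def)

text \<open>A functor over an infinite type: the sort makes the pairing behind comma categories
  available.\<close>

locale comma_functor = functor_on E B P for E B :: "'u::infinite cat" and P
begin

lemma comma_obD' [simp]:
  assumes "z \<in> comma_ob P"
  shows "ufst z \<in> Ob E" "usnd z \<in> Ar B" "src B (usnd z) = fob P (ufst z)" "upair (ufst z) (usnd z) = z"
  using comma_obD[OF assms] by simp_all

lemma comma_arD' [simp]:
  assumes "a \<in> comma_ar P"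
  shows "csrc a \<in> comma_ob P" "ctgt a \<in> comma_ob P" "ctop a \<in> Ar E" "cbot a \<in> Ar B"
    "src E (ctop a) = ufst (csrc a)" "tgt E (ctop a) = ufst (ctgt a)"
    "src B (cbot a) = tgt B (usnd (csrc a))" "tgt B (cbot a) = tgt B (usnd (ctgt a))"
    "carr (csrc a) (ctop a) (cbot a) (ctgt a) = a"
  using comma_arD[OF assms] by simp_all

lemma comma_square:
  "a \<in> comma_ar P \<Longrightarrow> cmp B (cbot a) (usnd (csrc a)) = cmp B (usnd (ctgt a)) (far P (ctop a))"
  using comma_arD(9)[of a P] by simp

lemma comma_ide_in:
  "z \<in> comma_ob P \<Longrightarrow> carr z (ide E (ufst z)) (ide B (tgt B (usnd z))) z \<in> comma_ar P"
  by (simp add: comma_ar_iff)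

lemma comma_cmp_in:
  assumes [simp]: "a \<in> comma_ar P" "b \<in> comma_ar P" "ctgt a = csrc b"
  shows "carr (csrc a) (cmp E (ctop b) (ctop a)) (cmp B (cbot b) (cbot a)) (ctgt b) \<in> comma_ar P"
proof -
  have "cmp B (cmp B (cbot b) (cbot a)) (usnd (csrc a)) = cmp B (cbot b) (cmp B (cbot a) (usnd (csrc a)))"
    by (simp add: B.assoc)
  also have "\<dots> = cmp B (cmp B (cbot b) (usnd (csrc b))) (far P (ctop a))"
    by (simp add: comma_square B.assoc)
  also have "\<dots> = cmp B (usnd (ctgt b)) (far P (cmp E (ctop b) (ctop a)))"
    by (simp add: comma_square B.assoc)
  finally show ?thesis by (simp add: comma_ar_iff)
qed

lemma category_comma: "category (comma P)"
proof (rule categoryI, goal_cases)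
  case (9 a)
  then show ?case by (simp add: comma_ide_in)
next
  case (10 a)
  then show ?case by (simp add: comma_ide_in)
next
  case (11 a b c)
  then show ?case using comma_cmp_in[of a b] comma_cmp_in[of b c] by (simp add: A.assoc B.assoc)
qed (auto simp: comma_ide_in comma_cmp_in, auto simp: comma_def)

lemma functor_on_CodF: "functor_on (comma P) B (CodF P)"
  by (rule functor_onI)
    (auto simp: category_comma B.category_axioms comma_ide_in comma_cmp_in, auto simp: CodF_def)

end

lemma locally_small_comma:
  fixes P :: "'u::infinite func"
  assumes "functor_on E B P" "locally_small E" "locally_small B"
  shows "locally_small (comma P)"
  unfolding locally_small_def
proof (intro ballI)
  interpret P: comma_functor E B P using assms(1) by (simp add: comma_functor_def)
  fix z z' assume z: "z \<in> Ob (comma P)" "z' \<in> Ob (comma P)"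
  let ?X = "hom E (ufst z) (ufst z') \<times> hom B (tgt B (usnd z)) (tgt B (usnd z'))"
  \<comment> \<open>Between fixed endpoints an encoded arrow is determined by its two
    components.\<close>
  have "inj_on (\<lambda>a. (ctop a, cbot a)) (hom (comma P) z z')"
    by (rule inj_onI) (metis P.comma_arD'(9) comma_simps(2-4) hom_iff old.prod.inject)
  moreover have "(\<lambda>a. (ctop a, cbot a)) ` hom (comma P) z z' \<subseteq> ?X"
    by (auto simp: hom_iff)
  ultimately have "hom (comma P) z z' \<lesssim> ?X" unfolding lepoll_def by blast
  also have "?X \<prec> (UNIV :: 'u set)"
    using z assms(2,3) by (intro lesspoll_Times) (auto simp: locally_small_def)
  finally show "hom (comma P) z z' \<prec> (UNIV :: 'u set)" .
qed

section \<open>Squares of functors and the cells of \<open>CAT2\<close>\<close>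

locale square = P: comma_functor E B P + Q: comma_functor E' B' Q + T: functor_on E E' T + S: functor_on
    B B' S
  for E B :: "'u::infinite cat" and P E' B' Q T S +
  assumes commutes: "fcomp Q T = fcomp S P"
begin

lemma square_ob [simp]: "x \<in> Ob E \<Longrightarrow> fob Q (fob T x) = fob S (fob P x)"
  using arg_cong[OF commutes, of "\<lambda>F. fob F x"] by (simp add: fcomp_simps)

lemma square_ar [simp]: "f \<in> Ar E \<Longrightarrow> far Q (far T f) = far S (far P f)"
  using arg_cong[OF commutes, of "\<lambda>F. far F f"] by (simp add: fcomp_simps)

end

lemma squareI:
  assumes "functor_on E B P" "functor_on E' B' Q" "functor_on E E' T" "functor_on B B' S"
    "\<And>x. x \<in> Ob E \<Longrightarrow> fob Q (fob T x) = fob S (fob P x)"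
    "\<And>f. f \<in> Ar E \<Longrightarrow> far Q (far T f) = far S (far P f)"
  shows "square E B P E' B' Q T S"
proof -
  interpret P: functor_on E B P by fact
  interpret T: functor_on E E' T by fact
  have "fcomp Q T = fcomp S P"
    by (rule functor_eqI[OF functor_on_fcomp[OF assms(3,2)] functor_on_fcomp[OF assms(1,4)]])
      (simp_all add: fcomp_simps assms)
  then show ?thesis using assms by (simp add: square_def square_axioms_def comma_functor_def)
qed

lemma CAT2_C0: "P \<in> C0 CAT2 \<longleftrightarrow> (\<exists>E B. functor_on E B P \<and> locally_small E \<and> locally_small B)"
  by (auto simp: CAT2_def functor_on_iff)

lemma CAT2_C1: "(P, T, S, Q) \<in> C1 CAT2 \<longleftrightarrow>
  (\<exists>E B E' B'. square E B P E' B' Q T S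
    \<and> locally_small E \<and> locally_small B \<and> locally_small E' \<and> locally_small B')"
  unfolding CAT2_def by (auto simp: arrow2_C1 functor_on_iff square_def square_axioms_def comma_functor_def)

lemma CAT2_simps [simp]:
  "s1 CAT2 (P, T, S, Q) = P" "t1 CAT2 (P, T, S, Q) = Q"
  "s2 CAT2 (P, \<beta>, \<alpha>, Q) = (P, nsrc \<beta>, nsrc \<alpha>, Q)" "t2 CAT2 (P, \<beta>, \<alpha>, Q) = (P, ntgt \<beta>, ntgt \<alpha>, Q)"
  "id1 CAT2 P = (P, idf (fdom P), idf (fcod P), P)"
  "id2 CAT2 (P, T, S, Q) = (P, id2 CAT T, id2 CAT S, Q)"
  "comp1 CAT2 (Q', T', S', R) (P, T, S, Q) = (P, fcomp T' T, fcomp S' S, R)"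
  "vcomp CAT2 (P', \<beta>', \<alpha>', Q') (P, \<beta>, \<alpha>, Q) = (P, vcomp CAT \<beta>' \<beta>, vcomp CAT \<alpha>' \<alpha>, Q)"
  "hcomp CAT2 (Q', \<beta>', \<alpha>', R) (P, \<beta>, \<alpha>, Q) = (P, hcomp CAT \<beta>' \<beta>, hcomp CAT \<alpha>' \<alpha>, R)"
  by (simp_all add: CAT2_def)

locale square2 = F: square E B P E' B' Q T S + G: square E B P E' B' Q T' S' +
  \<beta>: ntrans_on E E' T T' \<beta> + \<alpha>: ntrans_on B B' S S' \<alpha>
  for E B :: "'u::infinite cat" and P E' B' Q T S T' S' \<beta> \<alpha> +
  assumes over [simp]: "x \<in> Ob E \<Longrightarrow> far Q (ncmp \<beta> x) = ncmp \<alpha> (fob P x)"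

text \<open>Whiskering by an identity 2-cell gives the components Q \<beta>_x on one side and
  \<alpha>_(P x) on the other, so the pointwise condition \<open>over\<close> is the equation
  required of 2-cells of \<open>CAT2\<close>.\<close>

lemma square2_hcomp:
  assumes "square E B P E' B' Q T S" "square E B P E' B' Q T' S'"
    and \<beta>: "ntrans_on E E' T T' \<beta>" and \<alpha>: "ntrans_on B B' S S' \<alpha>"
  shows "square2 E B P E' B' Q T S T' S' \<beta> \<alpha> \<longleftrightarrow> hcomp CAT (id2 CAT Q) \<beta> = hcomp CAT \<alpha> (id2 CAT P)"
    (is "_ \<longleftrightarrow> ?l = ?r")
proof -
  interpret F: square E B P E' B' Q T S by fact
  interpret G: square E B P E' B' Q T' S' by fact
  interpret \<beta>: ntrans_on E E' T T' \<beta> by fact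
  interpret \<alpha>: ntrans_on B B' S S' \<alpha> by fact
  have c: "ncmp ?l x = far Q (ncmp \<beta> x)" "ncmp ?r x = ncmp \<alpha> (fob P x)" if "x \<in> Ob E" for x
    using that by simp_all
  have l: "ntrans_on E B' (fcomp Q T) (fcomp Q T') ?l"
    by (rule ntrans_on_hcomp[OF \<beta> ntrans_on_id2[OF F.Q.functor_on_axioms]])
  have r: "ntrans_on E B' (fcomp S P) (fcomp S' P) ?r"
    by (rule ntrans_on_hcomp[OF ntrans_on_id2[OF F.P.functor_on_axioms] \<alpha>])
  have "?l = ?r \<longleftrightarrow> (\<forall>x\<in>Ob E. far Q (ncmp \<beta> x) = ncmp \<alpha> (fob P x))"
  proof
    assume eq: "?l = ?r"
    show "\<forall>x\<in>Ob E. far Q (ncmp \<beta> x) = ncmp \<alpha> (fob P x)"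
      using c eq by metis
  next
    assume "\<forall>x\<in>Ob E. far Q (ncmp \<beta> x) = ncmp \<alpha> (fob P x)"
    then show "?l = ?r"
      by (intro ntrans_eqI[OF l[unfolded F.commutes G.commutes] r]) (simp only: c)
  qed
  then show ?thesis using assms by (simp add: square2_def square2_axioms_def Ball_def)
qed

lemma CAT2_C2: "(P, \<beta>, \<alpha>, Q) \<in> C2 CAT2 \<longleftrightarrow>
  (\<exists>E B E' B' T S T' S'. square2 E B P E' B' Q T S T' S' \<beta> \<alpha>
    \<and> locally_small E \<and> locally_small B \<and> locally_small E' \<and> locally_small B')"
  (is "_ \<longleftrightarrow> ?R")
proof -
  have "(P, \<beta>, \<alpha>, Q) \<in> C2 CAT2 \<longleftrightarrow> is_ntrans \<beta> \<and> is_ntrans \<alpha>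
      \<and> (P, nsrc \<beta>, nsrc \<alpha>, Q) \<in> C1 CAT2 \<and> (P, ntgt \<beta>, ntgt \<alpha>, Q) \<in> C1 CAT2
      \<and> hcomp CAT (id2 CAT Q) \<beta> = hcomp CAT \<alpha> (id2 CAT P)"
    unfolding CAT2_def by (auto simp: arrow2_C1)
  also have "\<dots> \<longleftrightarrow> ?R" (is "?L \<longleftrightarrow> _")
  proof
    assume L: ?L
    then obtain E B E' B' where sq: "square E B P E' B' Q (nsrc \<beta>) (nsrc \<alpha>)"
        "locally_small E" "locally_small B" "locally_small E'" "locally_small B'"
      unfolding CAT2_C1 by blast
    from L obtain F C F' C' where sq': "square F C P F' C' Q (ntgt \<beta>) (ntgt \<alpha>)"
      unfolding CAT2_C1 by blast
    have eq: "F = E" "C = B" "F' = E'" "C' = B'"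
      using sq(1) sq' by (auto simp: square_def comma_functor_def functor_on_iff)
    have "ntrans_on E E' (nsrc \<beta>) (ntgt \<beta>) \<beta>" "ntrans_on B B' (nsrc \<alpha>) (ntgt \<alpha>) \<alpha>"
      using L sq(1) by (simp_all add: ntrans_on_iff square_def functor_on_iff)
    then show ?R
      using L sq square2_hcomp[OF sq(1) sq'[unfolded eq]] by blast
  next
    assume ?R
    then obtain E B E' B' T S T' S' where sq: "square2 E B P E' B' Q T S T' S' \<beta> \<alpha>"
        "locally_small E" "locally_small B" "locally_small E'" "locally_small B'" by blast
    interpret square2 E B P E' B' Q T S T' S' \<beta> \<alpha> by fact
    show ?L
      using sq square2_hcomp[OF F.square_axioms G.square_axioms \<beta>.ntrans_on_axioms \<alpha>.ntrans_on_axioms]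
        \<beta>.ntrans \<alpha>.ntrans F.square_axioms G.square_axioms unfolding CAT2_C1 by auto
  qed
  finally show ?thesis .
qed

section \<open>Functoriality of the comma construction\<close>

lemma bar_simps [simp]:
  "fdom (bar (P, T, S, Q)) = comma P" "fcod (bar (P, T, S, Q)) = comma Q"
  "z \<in> comma_ob P \<Longrightarrow> fob (bar (P, T, S, Q)) z = upair (fob T (ufst z)) (far S (usnd z))"
  "a \<in> comma_ar P \<Longrightarrow> far (bar (P, T, S, Q)) a
    = carr (upair (fob T (ufst (csrc a))) (far S (usnd (csrc a)))) (far T (ctop a)) (far S (cbot a))
        (upair (fob T (ufst (ctgt a))) (far S (usnd (ctgt a))))"
  by (simp_all add: bar_def Let_def)

lemma bar2_simps [simp]:
  "nsrc (bar2 (P, \<beta>, \<alpha>, Q)) = bar (P, nsrc \<beta>, nsrc \<alpha>, Q)"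
  "ntgt (bar2 (P, \<beta>, \<alpha>, Q)) = bar (P, ntgt \<beta>, ntgt \<alpha>, Q)"
  "z \<in> comma_ob P \<Longrightarrow> ncmp (bar2 (P, \<beta>, \<alpha>, Q)) z
    = carr (upair (fob (nsrc \<beta>) (ufst z)) (far (nsrc \<alpha>) (usnd z))) (ncmp \<beta> (ufst z))
        (ncmp \<alpha> (tgt (fcod P) (usnd z))) (upair (fob (ntgt \<beta>) (ufst z)) (far (ntgt \<alpha>) (usnd z)))"
  by (simp_all add: bar2_def Let_def)

context square
begin

text \<open>S is applied to the commuting square of \<open>a\<close>, and Q T = S P rewrites its top
  edge. Naming the endpoints \<open>z\<close> and \<open>z'\<close> lets the rule match after
  \<open>csrc a\<close> and \<open>ctgt a\<close> have been rewritten.\<close>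

lemma bar_ar_in:
  assumes [simp]: "a \<in> comma_ar P" and z: "csrc a = z" "ctgt a = z'"
  shows "carr (upair (fob T (ufst z)) (far S (usnd z))) (far T (ctop a)) (far S (cbot a))
        (upair (fob T (ufst z')) (far S (usnd z'))) \<in> comma_ar Q"
  using arg_cong[OF P.comma_square[of a], of "far S"] by (simp add: comma_ar_iff flip: z)

lemma functor_on_bar: "functor_on (comma P) (comma Q) (bar (P, T, S, Q))"
  by (rule functor_onI)
    (auto simp: P.category_comma Q.category_comma bar_ar_in P.comma_ide_in P.comma_cmp_in,
      auto simp: bar_def)

lemma square_bar:
  "square (comma P) B (CodF P) (comma Q) B' (CodF Q) (bar (P, T, S, Q)) S"
  by (rule squareI)
    (simp_all add: P.functor_on_CodF Q.functor_on_CodF functor_on_bar S.functor_on_axioms bar_ar_in)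

end

lemma square_id:
  assumes "comma_functor E B P"
  shows "square E B P E B P (idf E) (idf B)"
proof -
  interpret comma_functor E B P by fact
  show ?thesis
    by (rule squareI) (simp_all add: functor_on_axioms functor_on_idf A.category_axioms B.category_axioms)
qed

lemma square_comp:
  assumes "square E B P E' B' Q T S" "square E' B' Q E'' B'' R T' S'"
  shows "square E B P E'' B'' R (fcomp T' T) (fcomp S' S)"
proof -
  interpret F: square E B P E' B' Q T S by fact
  interpret G: square E' B' Q E'' B'' R T' S' by fact
  show ?thesis
    by (rule squareI) (simp_all add: F.P.functor_on_axioms G.Q.functor_on_axioms fcomp_simps
        functor_on_fcomp[OF F.T.functor_on_axioms G.T.functor_on_axioms]
        functor_on_fcomp[OF F.S.functor_on_axioms G.S.functor_on_axioms])
qed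

context square2
begin

text \<open>The square to check is naturality of \<open>\<alpha>\<close> at \<open>usnd z\<close>,
  since Q \<beta>_x is \<alpha>_(P x).\<close>

lemma bar2_ar_in:
  assumes [simp]: "z \<in> comma_ob P"
  shows "carr (upair (fob T (ufst z)) (far S (usnd z))) (ncmp \<beta> (ufst z))
        (ncmp \<alpha> (tgt B (usnd z))) (upair (fob T' (ufst z)) (far S' (usnd z))) \<in> comma_ar Q"
  using \<alpha>.natural[of "usnd z"] by (simp add: comma_ar_iff)

lemma ntrans_on_bar2:
  "ntrans_on (comma P) (comma Q) (bar (P, T, S, Q)) (bar (P, T', S', Q)) (bar2 (P, \<beta>, \<alpha>, Q))"
proof (rule ntrans_onI)
  fix a assume "a \<in> Ar (comma P)"
  then have [simp]: "a \<in> comma_ar P" by simp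
  show "cmp (comma Q) (far (bar (P, T', S', Q)) a) (ncmp (bar2 (P, \<beta>, \<alpha>, Q)) (src (comma P) a))
      = cmp (comma Q) (ncmp (bar2 (P, \<beta>, \<alpha>, Q)) (tgt (comma P) a)) (far (bar (P, T, S, Q)) a)"
    using \<alpha>.natural[of "cbot a"] \<beta>.natural[of "ctop a"]
    by (simp add: F.bar_ar_in G.bar_ar_in bar2_ar_in)
qed (auto simp: F.functor_on_bar G.functor_on_bar bar2_ar_in, auto simp: bar2_def Let_def)

lemma square2_bar:
  "square2 (comma P) B (CodF P) (comma Q) B' (CodF Q) (bar (P, T, S, Q)) S (bar (P, T', S', Q)) S'
    (bar2 (P, \<beta>, \<alpha>, Q)) \<alpha>"
  using F.square_bar G.square_bar ntrans_on_bar2 \<alpha>.ntrans_on_axioms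
  by (simp add: square2_def square2_axioms_def bar2_ar_in)

end

lemma bar_id:
  assumes "comma_functor E B P"
  shows "bar (P, idf E, idf B, P) = idf (comma P)"
proof -
  interpret square E B P E B P "idf E" "idf B" using assms by (rule square_id)
  show ?thesis
    by (rule functor_eqI[OF functor_on_bar functor_on_idf]) (simp_all add: P.category_comma)
qed

lemma bar_comp:
  assumes "square E B P E' B' Q T S" "square E' B' Q E'' B'' R T' S'"
  shows "bar (P, fcomp T' T, fcomp S' S, R) = fcomp (bar (Q, T', S', R)) (bar (P, T, S, Q))"
proof -
  interpret F: square E B P E' B' Q T S by fact
  interpret G: square E' B' Q E'' B'' R T' S' by fact
  interpret H: square E B P E'' B'' R "fcomp T' T" "fcomp S' S" by (rule square_comp) fact+
  show ?thesis
    by (rule functor_eqI[OF H.functor_on_bar functor_on_fcomp[OF F.functor_on_bar G.functor_on_bar]])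
      (simp_all add: fcomp_simps F.bar_ar_in)
qed

lemma bar2_id2:
  assumes "square E B P E' B' Q T S"
  shows "bar2 (P, id2 CAT T, id2 CAT S, Q) = id2 CAT (bar (P, T, S, Q))"
proof -
  interpret F: square E B P E' B' Q T S by fact
  interpret \<beta>: ntrans_on E E' T T "id2 CAT T" by (rule ntrans_on_id2[OF F.T.functor_on_axioms])
  interpret \<alpha>: ntrans_on B B' S S "id2 CAT S" by (rule ntrans_on_id2[OF F.S.functor_on_axioms])
  interpret S: square2 E B P E' B' Q T S T S "id2 CAT T" "id2 CAT S"
    by unfold_locales simp
  show ?thesis
    by (rule ntrans_eqI[OF S.ntrans_on_bar2 ntrans_on_id2[OF F.functor_on_bar]]) simp
qed

lemma bar2_vcomp:
  assumes "square2 E B P E' B' Q T S T' S' \<beta> \<alpha>" "square2 E B P E' B' Q T' S' T'' S'' \<beta>' \<alpha>'"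
  shows "bar2 (P, vcomp CAT \<beta>' \<beta>, vcomp CAT \<alpha>' \<alpha>, Q)
    = vcomp CAT (bar2 (P, \<beta>', \<alpha>', Q)) (bar2 (P, \<beta>, \<alpha>, Q))"
proof -
  interpret F: square2 E B P E' B' Q T S T' S' \<beta> \<alpha> by fact
  interpret G: square2 E B P E' B' Q T' S' T'' S'' \<beta>' \<alpha>' by fact
  interpret \<beta>: ntrans_on E E' T T'' "vcomp CAT \<beta>' \<beta>"
    by (rule ntrans_on_vcomp[OF F.\<beta>.ntrans_on_axioms G.\<beta>.ntrans_on_axioms])
  interpret \<alpha>: ntrans_on B B' S S'' "vcomp CAT \<alpha>' \<alpha>"
    by (rule ntrans_on_vcomp[OF F.\<alpha>.ntrans_on_axioms G.\<alpha>.ntrans_on_axioms])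
  interpret H: square2 E B P E' B' Q T S T'' S'' "vcomp CAT \<beta>' \<beta>" "vcomp CAT \<alpha>' \<alpha>"
    by unfold_locales simp
  show ?thesis
    by (rule ntrans_eqI[OF H.ntrans_on_bar2 ntrans_on_vcomp[OF F.ntrans_on_bar2 G.ntrans_on_bar2]])
      (simp add: F.bar2_ar_in G.bar2_ar_in)
qed

lemma bar2_hcomp:
  assumes "square2 E B P E' B' Q T S T' S' \<beta> \<alpha>" "square2 E' B' Q E'' B'' R U V U' V' \<beta>' \<alpha>'"
  shows "bar2 (P, hcomp CAT \<beta>' \<beta>, hcomp CAT \<alpha>' \<alpha>, R)
    = hcomp CAT (bar2 (Q, \<beta>', \<alpha>', R)) (bar2 (P, \<beta>, \<alpha>, Q))"
proof -
  interpret F: square2 E B P E' B' Q T S T' S' \<beta> \<alpha> by fact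
  interpret G: square2 E' B' Q E'' B'' R U V U' V' \<beta>' \<alpha>' by fact
  interpret \<beta>: ntrans_on E E'' "fcomp U T" "fcomp U' T'" "hcomp CAT \<beta>' \<beta>"
    by (rule ntrans_on_hcomp[OF F.\<beta>.ntrans_on_axioms G.\<beta>.ntrans_on_axioms])
  interpret \<alpha>: ntrans_on B B'' "fcomp V S" "fcomp V' S'" "hcomp CAT \<alpha>' \<alpha>"
    by (rule ntrans_on_hcomp[OF F.\<alpha>.ntrans_on_axioms G.\<alpha>.ntrans_on_axioms])
  interpret a: square E B P E'' B'' R "fcomp U T" "fcomp V S"
    by (rule square_comp[OF F.F.square_axioms G.F.square_axioms])
  interpret b: square E B P E'' B'' R "fcomp U' T'" "fcomp V' S'"
    by (rule square_comp[OF F.G.square_axioms G.G.square_axioms])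
  interpret H: square2 E B P E'' B'' R "fcomp U T" "fcomp V S" "fcomp U' T'" "fcomp V' S'"
    "hcomp CAT \<beta>' \<beta>" "hcomp CAT \<alpha>' \<alpha>"
    by unfold_locales simp
  show ?thesis
  \<comment> \<open>Both sides have syntactically the same boundary only after
    \<open>bar_comp\<close> has split the bar of a composite square.\<close>
  proof (rule ntrans_eqI[OF H.ntrans_on_bar2[unfolded bar_comp[OF F.F.square_axioms G.F.square_axioms]
            bar_comp[OF F.G.square_axioms G.G.square_axioms]]
          ntrans_on_hcomp[OF F.ntrans_on_bar2 G.ntrans_on_bar2]])
    fix z assume "z \<in> Ob (comma P)"
    then have [simp]: "z \<in> comma_ob P" by simp
    show "ncmp (bar2 (P, hcomp CAT \<beta>' \<beta>, hcomp CAT \<alpha>' \<alpha>, R)) z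
        = ncmp (hcomp CAT (bar2 (Q, \<beta>', \<alpha>', R)) (bar2 (P, \<beta>, \<alpha>, Q))) z"
      using G.bar2_ar_in[of "upair (fob T' (ufst z)) (far S' (usnd z))"]
        G.F.bar_ar_in[OF F.bar2_ar_in[of z] refl refl]
      by (simp add: fcomp_simps F.bar2_ar_in)
  qed
qed

section \<open>Cleavages and the functor L\<close>

text \<open>The equation between \<open>far F g\<close> and the composite forces the target of
  \<open>v\<close>, so the object z can be read off as \<open>tgt A g\<close>.\<close>

lemma (in functor_on) cocartesian_iff:
  "cocartesian F e \<longleftrightarrow> e \<in> Ar A \<and>
    (\<forall>g v. g \<in> Ar A \<and> src A g = src A e \<and> v \<in> Ar B \<and> src B v = fob F (tgt A e) \<and> far F g = cmp B v (far F e)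
      \<longrightarrow> (\<exists>!h. h \<in> Ar A \<and> src A h = tgt A e \<and> tgt A h = tgt A g \<and> cmp A h e = g \<and> far F h = v))"
    (is "_ \<longleftrightarrow> _ \<and> ?R")
proof (cases "e \<in> Ar A")
  case e [simp]: True
  have tgt: "tgt B v = fob F (tgt A g)"
    if "g \<in> Ar A" "v \<in> Ar B" "src B v = fob F (tgt A e)" "far F g = cmp B v (far F e)" for g v
  proof -
    have "tgt B v = tgt B (far F g)" using that by simp
    then show ?thesis using that(1) by simp
  qed
  have "cocartesian F e \<longleftrightarrow> ?R"
  proof (intro iffI allI impI)
    fix g v
    assume c: "cocartesian F e" and g: "g \<in> Ar A \<and> src A g = src A e \<and> v \<in> Ar B \<and> src B v = fob F (tgt A e)
      \<and> far F g = cmp B v (far F e)"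
    from c[unfolded cocartesian_def fdom fcod hom_iff conj_assoc, THEN conjunct2, THEN spec[of _ "tgt A g"],
        THEN spec[of _ g], THEN spec[of _ v]]
    show "\<exists>!h. h \<in> Ar A \<and> src A h = tgt A e \<and> tgt A h = tgt A g \<and> cmp A h e = g \<and> far F h = v"
      using g tgt[of g v] by (elim mp) simp
  next
    assume R: ?R
    show "cocartesian F e"
      unfolding cocartesian_def fdom fcod hom_iff conj_assoc
    proof (intro conjI allI impI e)
      fix z g v
      assume g: "g \<in> Ar A \<and> src A g = src A e \<and> tgt A g = z \<and> v \<in> Ar B \<and> src B v = fob F (tgt A e)
        \<and> tgt B v = fob F z \<and> far F g = cmp B v (far F e)"
      from R[THEN spec[of _ g], THEN spec[of _ v]]
      have "\<exists>!h. h \<in> Ar A \<and> src A h = tgt A e \<and> tgt A h = tgt A g \<and> cmp A h e = g \<and> far F h = v"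
        using g by (elim mp) simp
      then show "\<exists>!h. h \<in> Ar A \<and> src A h = tgt A e \<and> tgt A h = z \<and> cmp A h e = g \<and> far F h = v"
        using g by simp
    qed
  qed
  then show ?thesis by simp
qed (simp add: cocartesian_def)

section \<open>Fibres and the functors induced by chosen lifts\<close>

lemma fibre_simps [simp]:
  "x \<in> Ob (fibre P b) \<longleftrightarrow> x \<in> Ob (fdom P) \<and> fob P x = b"
  "f \<in> Ar (fibre P b) \<longleftrightarrow> f \<in> Ar (fdom P) \<and> far P f = ide (fcod P) b"
  "\<lbrakk>f \<in> Ar (fdom P); far P f = ide (fcod P) b\<rbrakk> \<Longrightarrow> src (fibre P b) f = src (fdom P) f"
  "\<lbrakk>f \<in> Ar (fdom P); far P f = ide (fcod P) b\<rbrakk> \<Longrightarrow> tgt (fibre P b) f = tgt (fdom P) f"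
  by (simp_all add: fibre_def Let_def)

lemma push_simps:
  "fdom (push P \<delta> u) = fibre P (src (fcod P) u)"
  "fcod (push P \<delta> u) = fibre P (tgt (fcod P) u)"
  "x \<in> Ob (fibre P (src (fcod P) u)) \<Longrightarrow> fob (push P \<delta> u) x = tgt (fdom P) (\<delta> x u)"
  "fob (push P \<delta> u) \<in> extensional (Ob (fibre P (src (fcod P) u)))"
  "far (push P \<delta> u) \<in> extensional (Ar (fibre P (src (fcod P) u)))"
  "f \<in> Ar (fibre P (src (fcod P) u)) \<Longrightarrow> far (push P \<delta> u) f
    = (THE h. h \<in> hom (fibre P (tgt (fcod P) u)) (tgt (fdom P) (\<delta> (src (fdom P) f) u))
        (tgt (fdom P) (\<delta> (tgt (fdom P) f) u))
        \<and> cmp (fdom P) h (\<delta> (src (fdom P) f) u) = cmp (fdom P) (\<delta> (tgt (fdom P) f) u) f)"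
  by (simp_all add: push_def Let_def)

locale cloven = comma_functor E B P + cleavage P \<delta>
  for E B :: "'u::infinite cat" and P and \<delta> :: "'u lifts"
begin

lemma lift_simps [simp]:
  assumes "x \<in> Ob E" "u \<in> Ar B" "src B u = fob P x"
  shows "\<delta> x u \<in> Ar E" "src E (\<delta> x u) = x" "far P (\<delta> x u) = u" "fob P (tgt E (\<delta> x u)) = tgt B u"
proof -
  show ar: "\<delta> x u \<in> Ar E" and "src E (\<delta> x u) = x" and far: "far P (\<delta> x u) = u"
    using assms lift_src lift_over lift_cocartesian[of x u] by (simp_all add: cocartesian_iff)
  then show "fob P (tgt E (\<delta> x u)) = tgt B u"
    using functor_simps(4)[of "\<delta> x u"] by simp
qed

lemma lift_factor1:
  assumes "x \<in> Ob E" "u \<in> Ar B" "src B u = fob P x" "g \<in> Ar E" "src E g = x" "v \<in> Ar B" "src B v = tgt B u"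
    "far P g = cmp B v u"
  shows "\<exists>!h. h \<in> Ar E \<and> src E h = tgt E (\<delta> x u) \<and> tgt E h = tgt E g \<and> cmp E h (\<delta> x u) = g \<and> far P h = v"
proof -
  have "cocartesian P (\<delta> x u)" using assms lift_cocartesian[of x u] by simp
  then show ?thesis using assms unfolding cocartesian_iff by simp
qed

text \<open>Both arrows solve the factorization problem posed by the composite of \<open>h\<close>
  with the lift. Equalities of arrows out of u_!x are reduced to this rule from here on.\<close>

lemma lift_unique:
  assumes xu: "x \<in> Ob E" "u \<in> Ar B" "src B u = fob P x"
    and "h \<in> Ar E" "src E h = tgt E (\<delta> x u)" "h' \<in> Ar E" "src E h' = tgt E (\<delta> x u)"
    "cmp E h (\<delta> x u) = cmp E h' (\<delta> x u)" "far P h = far P h'"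
  shows "h = h'"
proof -
  let ?g = "cmp E h (\<delta> x u)"
  have "\<exists>!k. k \<in> Ar E \<and> src E k = tgt E (\<delta> x u) \<and> tgt E k = tgt E ?g \<and> cmp E k (\<delta> x u) = ?g
      \<and> far P k = far P h"
    by (rule lift_factor1) (use assms in simp_all)
  moreover have "tgt E h = tgt E ?g" using assms(1-5) by simp
  moreover have "tgt E h' = tgt E (cmp E h' (\<delta> x u))" using xu assms(6,7) by simp
  ultimately show ?thesis using assms(4-9) by metis
qed

text \<open>This makes the description in \<open>push\<close> well defined: the required vertical
  arrow is the cocartesian factorization over an identity.\<close>

lemma push_far1:
  assumes [simp]: "u \<in> Ar B" "f \<in> Ar E" and vertical [simp]: "far P f = ide B (src B u)"
  shows "\<exists>!h. h \<in> hom (fibre P (tgt B u)) (tgt E (\<delta> (src E f) u)) (tgt E (\<delta> (tgt E f) u))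
    \<and> cmp E h (\<delta> (src E f) u) = cmp E (\<delta> (tgt E f) u) f" (is "\<exists>!h. ?Q h")
proof -
  have [simp]: "src B u = fob P (src E f)" "fob P (tgt E f) = fob P (src E f)"
    using functor_simps(3,4)[of f] by simp_all
  have "?Q h \<longleftrightarrow> h \<in> Ar E \<and> src E h = tgt E (\<delta> (src E f) u) \<and> tgt E h = tgt E (cmp E (\<delta> (tgt E f) u) f)
      \<and> cmp E h (\<delta> (src E f) u) = cmp E (\<delta> (tgt E f) u) f \<and> far P h = ide B (tgt B u)" for h
    by (auto simp: hom_iff)
  moreover have "\<exists>!h. h \<in> Ar E \<and> src E h = tgt E (\<delta> (src E f) u) \<and> tgt E h = tgt E (cmp E (\<delta> (tgt E f) u) f)
      \<and> cmp E h (\<delta> (src E f) u) = cmp E (\<delta> (tgt E f) u) f \<and> far P h = ide B (tgt B u)"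
    by (rule lift_factor1) simp_all
  ultimately show ?thesis by simp
qed

lemma push_far:
  assumes "u \<in> Ar B" "f \<in> Ar E" "far P f = ide B (src B u)"
  shows "far (push P \<delta> u) f \<in> Ar E"
    "src E (far (push P \<delta> u) f) = tgt E (\<delta> (src E f) u)"
    "tgt E (far (push P \<delta> u) f) = tgt E (\<delta> (tgt E f) u)"
    "far P (far (push P \<delta> u) f) = ide B (tgt B u)"
    "cmp E (far (push P \<delta> u) f) (\<delta> (src E f) u) = cmp E (\<delta> (tgt E f) u) f"
  using theI'[OF push_far1[OF assms]] assms push_simps(6)[of f P u \<delta>]
  by (auto simp: hom_iff)

text \<open>The equation of functors (vu)_! = v_! u_! follows from the equations on lifts: on a
  vertical f, the arrow v_! u_! f satisfies the defining equation of (vu)_! f, which has only one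
  solution.\<close>

lemma split_cleavageI:
  assumes normal: "\<And>x. x \<in> Ob E \<Longrightarrow> \<delta> x (ide B (fob P x)) = ide E x"
    and split: "\<And>x u v. \<lbrakk>x \<in> Ob E; u \<in> Ar B; v \<in> Ar B; src B u = fob P x; tgt B u = src B v\<rbrakk>
      \<Longrightarrow> \<delta> x (cmp B v u) = cmp E (\<delta> (tgt E (\<delta> x u)) v) (\<delta> x u)"
  shows "split_cleavage P \<delta>"
proof (unfold_locales, goal_cases)
  case (2 u v)
  then have [simp]: "u \<in> Ar B" "v \<in> Ar B" "src B v = tgt B u" by simp_all
  let ?l = "push P \<delta> (cmp B v u)" and ?r = "fcomp (push P \<delta> v) (push P \<delta> u)"
  have "fob ?l = fob ?r"
  proof (rule extensionalityI[of _ "Ob (fibre P (src B u))"])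
    fix x assume "x \<in> Ob (fibre P (src B u))"
    then show "fob ?l x = fob ?r x"
      by (simp add: push_simps fcomp_simps split)
  qed (use push_simps(4)[of P \<delta> "cmp B v u"] in \<open>simp_all add: fcomp_def push_simps\<close>)
  moreover have "far ?l = far ?r"
  proof (rule extensionalityI[of _ "Ar (fibre P (src B u))"])
    fix f assume "f \<in> Ar (fibre P (src B u))"
    then have f [simp]: "f \<in> Ar E" "far P f = ide B (src B u)" by simp_all
    have ob [simp]: "fob P (src E f) = src B u" "fob P (tgt E f) = src B u"
      using functor_simps(3,4)[of f] by simp_all
    let ?u = "far (push P \<delta> u) f"
    note [simp] = push_far[of u f]
    have v [simp]: "far P ?u = ide B (src B v)" by simp
    note [simp] = push_far[of v ?u]
    let ?v = "far (push P \<delta> v) ?u"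
    \<comment> \<open>The defining squares of u_! f and of v_! (u_! f) are pasted along the
      decomposed lift of vu.\<close>
    have "cmp E ?v (\<delta> (src E f) (cmp B v u)) = cmp E (cmp E ?v (\<delta> (src E ?u) v)) (\<delta> (src E f) u)"
      by (simp del: push_far(5) add: split A.assoc)
    also have "\<dots> = cmp E (\<delta> (tgt E ?u) v) (cmp E ?u (\<delta> (src E f) u))"
      by (subst push_far(5)[of v ?u], simp, simp, simp, rule A.assoc[symmetric]) simp_all
    also have "\<dots> = cmp E (\<delta> (tgt E f) (cmp B v u)) f"
      by (simp add: split A.assoc)
    finally have eq: "cmp E ?v (\<delta> (src E f) (cmp B v u)) = cmp E (\<delta> (tgt E f) (cmp B v u)) f" .
    have vu: "cmp B v u \<in> Ar B" "far P f = ide B (src B (cmp B v u))" "src B (cmp B v u) = fob P (src E f)"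
      by simp_all
    have tgt: "tgt E (\<delta> (src E f) (cmp B v u)) = tgt E (\<delta> (tgt E (\<delta> (src E f) u)) v)"
      by (simp add: split)
    note l = push_far[OF vu(1) f(1) vu(2)]
    have "?v = far ?l f"
    proof (rule lift_unique[OF _ vu(1,3)])
      show "cmp E ?v (\<delta> (src E f) (cmp B v u)) = cmp E (far ?l f) (\<delta> (src E f) (cmp B v u))"
        using eq l(5) by simp
    qed (use l tgt in simp_all)
    then show "far ?l f = far ?r f"
      by (simp add: fcomp_simps push_simps(1))
  qed (use push_simps(5)[of P \<delta> "cmp B v u"] in \<open>simp_all add: fcomp_def push_simps\<close>)
  ultimately show ?case by (simp add: fcomp_simps push_simps(1,2))
next
  case (3 x u v)
  then show ?case by (simp add: push_simps split)
qed (simp add: normal)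

end

text \<open>The description inside \<open>LF\<close>, restated with projections instead of
  quantified pairs and with P L = Cod required on arrows only, the object part following from the
  prescribed values of L.\<close>

definition lift_action :: "'u::infinite func \<Rightarrow> 'u lifts \<Rightarrow> 'u func \<Rightarrow> bool" where
  "lift_action P \<delta> L \<longleftrightarrow> functor_on (comma P) (fdom P) L
    \<and> (\<forall>z\<in>comma_ob P. fob L z = tgt (fdom P) (\<delta> (ufst z) (usnd z)))
    \<and> (\<forall>a\<in>comma_ar P. far P (far L a) = cbot a
        \<and> cmp (fdom P) (far L a) (\<delta> (ufst (csrc a)) (usnd (csrc a)))
          = cmp (fdom P) (\<delta> (ufst (ctgt a)) (usnd (ctgt a))) (ctop a))"

context cloven
begin

lemma lift_actionD:
  assumes "lift_action P \<delta> L"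
  shows "functor_on (comma P) E L"
    "z \<in> comma_ob P \<Longrightarrow> fob L z = tgt E (\<delta> (ufst z) (usnd z))"
    "a \<in> comma_ar P \<Longrightarrow> far L a \<in> Ar E"
    "a \<in> comma_ar P \<Longrightarrow> src E (far L a) = tgt E (\<delta> (ufst (csrc a)) (usnd (csrc a)))"
    "a \<in> comma_ar P \<Longrightarrow> tgt E (far L a) = tgt E (\<delta> (ufst (ctgt a)) (usnd (ctgt a)))"
    "a \<in> comma_ar P \<Longrightarrow> far P (far L a) = cbot a"
    "a \<in> comma_ar P \<Longrightarrow> cmp E (far L a) (\<delta> (ufst (csrc a)) (usnd (csrc a)))
      = cmp E (\<delta> (ufst (ctgt a)) (usnd (ctgt a))) (ctop a)"
proof -
  show L: "functor_on (comma P) E L" using assms unfolding lift_action_def by simp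
  show ob: "fob L z = tgt E (\<delta> (ufst z) (usnd z))" if "z \<in> comma_ob P" for z
    using assms that unfolding lift_action_def fdom by blast
  show "far P (far L a) = cbot a" "cmp E (far L a) (\<delta> (ufst (csrc a)) (usnd (csrc a)))
      = cmp E (\<delta> (ufst (ctgt a)) (usnd (ctgt a))) (ctop a)" if "a \<in> comma_ar P"
    using assms that unfolding lift_action_def fdom by blast+
  assume a: "a \<in> comma_ar P"
  then show "far L a \<in> Ar E" using functor_on.functor_simps(2)[OF L] by simp
  show "src E (far L a) = tgt E (\<delta> (ufst (csrc a)) (usnd (csrc a)))"
    using functor_on.functor_simps(3)[OF L, of a] a ob[of "csrc a"] by simp
  show "tgt E (far L a) = tgt E (\<delta> (ufst (ctgt a)) (usnd (ctgt a)))"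
    using functor_on.functor_simps(4)[OF L, of a] a ob[of "ctgt a"] by simp
qed

lemma lift_action_unique:
  assumes L: "lift_action P \<delta> L" and L': "lift_action P \<delta> L'"
  shows "L = L'"
proof (rule functor_eqI[OF lift_actionD(1)[OF L] lift_actionD(1)[OF L']])
  fix a assume "a \<in> Ar (comma P)"
  then have a: "a \<in> comma_ar P" by simp
  show "far L a = far L' a"
    by (rule lift_unique[of "ufst (csrc a)" "usnd (csrc a)"])
      (use a in \<open>simp_all add: lift_actionD[OF L] lift_actionD[OF L']\<close>)
qed (simp add: lift_actionD[OF L] lift_actionD[OF L'])

text \<open>The value at (f, v) : (x, u) -> (y, w) is the factorization over v of the lift of w
  after f through the lift of u. It exists because v u = w P f, and functoriality follows from
  uniqueness of factorizations.\<close>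

lemma ex_lift_action: "\<exists>L. lift_action P \<delta> L"
proof -
  let ?d = "\<lambda>z. \<delta> (ufst z) (usnd z)"
  define R where "R a h \<longleftrightarrow> h \<in> Ar E \<and> src E h = tgt E (?d (csrc a)) \<and> tgt E h = tgt E (?d (ctgt a))
      \<and> cmp E h (?d (csrc a)) = cmp E (?d (ctgt a)) (ctop a) \<and> far P h = cbot a" for a h
  have "\<exists>h. R a h" if [simp]: "a \<in> comma_ar P" for a
  proof -
    let ?g = "cmp E (?d (ctgt a)) (ctop a)"
    have "\<exists>!h. h \<in> Ar E \<and> src E h = tgt E (?d (csrc a)) \<and> tgt E h = tgt E ?g \<and> cmp E h (?d (csrc a))
        = ?g \<and> far P h = cbot a"
      by (rule lift_factor1) (simp_all add: comma_square)
    then show ?thesis unfolding R_def by auto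
  qed
  \<comment> \<open>\<open>R\<close> fixes each value uniquely, so this choice involves no
    freedom.\<close>
  then obtain l where l: "R a (l a)" if "a \<in> comma_ar P" for a by metis
  note l' [simp] = l[unfolded R_def]
  define L where "L = \<lparr>fdom = comma P, fcod = E, fob = (\<lambda>z\<in>comma_ob P. tgt E (?d z)), far
      = restrict l (comma_ar P)\<rparr>"
  have "functor_on (comma P) E L"
  proof (rule functor_onI, goal_cases)
    case (9 z)
    then have [simp]: "z \<in> comma_ob P" by simp
    note [simp] = comma_ide_in
    show ?case
      by (rule lift_unique[of "ufst z" "usnd z"])
        (use l'[OF comma_ide_in[of z]] in \<open>simp_all add: L_def\<close>)
  next
    case (10 a b)
    then have [simp]: "a \<in> comma_ar P" "b \<in> comma_ar P" "ctgt a = csrc b" by simp_all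
    let ?c = "carr (csrc a) (cmp E (ctop b) (ctop a)) (cmp B (cbot b) (cbot a)) (ctgt b)"
    have c [simp]: "?c \<in> comma_ar P" by (simp add: comma_cmp_in)
    have "cmp E (cmp E (l b) (l a)) (?d (csrc a)) = cmp E (l b) (cmp E (l a) (?d (csrc a)))"
      by (rule A.assoc[symmetric]) simp_all
    also have "\<dots> = cmp E (l b) (cmp E (?d (csrc b)) (ctop a))" by simp
    also have "\<dots> = cmp E (cmp E (l b) (?d (csrc b))) (ctop a)"
      by (rule A.assoc) simp_all
    also have "\<dots> = cmp E (cmp E (?d (ctgt b)) (ctop b)) (ctop a)" by simp
    also have "\<dots> = cmp E (?d (ctgt b)) (cmp E (ctop b) (ctop a))"
      by (rule A.assoc[symmetric]) simp_all
    finally have eq: "cmp E (cmp E (l b) (l a)) (?d (csrc a))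
        = cmp E (?d (ctgt b)) (cmp E (ctop b) (ctop a))" .
    have "l ?c = cmp E (l b) (l a)"
      by (rule lift_unique[of "ufst (csrc a)" "usnd (csrc a)"]) (use l'[OF c] eq in simp_all)
    then show ?case by (simp add: L_def)
  qed (auto simp: L_def category_comma A.category_axioms)
  then have "lift_action P \<delta> L" by (simp add: lift_action_def L_def)
  then show ?thesis ..
qed

lemma LF_eq_The: "LF P \<delta> = (THE L. lift_action P \<delta> L)"
proof -
  have "(is_functor L \<and> fdom L = comma P \<and> fcod L = fdom P
     \<and> (\<forall>x u. upair x u \<in> Ob (comma P) \<longrightarrow> fob L (upair x u) = fob (push P \<delta> u) x)
     \<and> fcomp P L = CodF P
     \<and> (\<forall>x u f v y w. carr (upair x u) f v (upair y w) \<in> Ar (comma P) \<longrightarrow>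
          cmp (fdom P) (far L (carr (upair x u) f v (upair y w))) (\<delta> x u)
            = cmp (fdom P) (\<delta> y w) f)) \<longleftrightarrow> lift_action P \<delta> L" (is "?D \<longleftrightarrow> _") for L
  proof
    assume D: ?D
    then interpret L: functor_on "comma P" E L by (simp add: functor_on_iff)
    have "fob L z = tgt E (\<delta> (ufst z) (usnd z))" if "z \<in> comma_ob P" for z
    proof -
      from D that have "fob L (upair (ufst z) (usnd z)) = fob (push P \<delta> (usnd z)) (ufst z)"
        using comma_obD'(4)[OF that] by (metis comma_simps(1))
      then show ?thesis using that by (simp add: push_simps)
    qed
    moreover have "far P (far L a) = cbot a" if "a \<in> comma_ar P" for a
    proof -
      from D have "far (fcomp P L) a = far (CodF P) a" by simp
      then show ?thesis using that by (simp add: fcomp_simps)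
    qed
    moreover have "cmp E (far L a) (\<delta> (ufst (csrc a)) (usnd (csrc a)))
        = cmp E (\<delta> (ufst (ctgt a)) (usnd (ctgt a))) (ctop a)" if a: "a \<in> comma_ar P" for a
    proof -
      have "carr (upair (ufst (csrc a)) (usnd (csrc a))) (ctop a) (cbot a)
          (upair (ufst (ctgt a)) (usnd (ctgt a))) = a"
        using a by (simp del: comma_ob_iff)
      then show ?thesis using D a unfolding fdom comma_simps by metis
    qed
    ultimately show "lift_action P \<delta> L"
      by (simp add: lift_action_def L.functor_on_axioms)
  next
    assume l: "lift_action P \<delta> L"
    then interpret L: functor_on "comma P" E L by (simp add: lift_action_def)
    have "fcomp P L = CodF P"
      by (rule functor_eqI[OF functor_on_fcomp[OF L.functor_on_axioms functor_on_axioms] functor_on_CodF])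
        (use l in \<open>simp_all add: fcomp_simps lift_action_def\<close>)
    moreover have "cmp E (far L (carr (upair x u) f v (upair y w))) (\<delta> x u) = cmp E (\<delta> y w) f"
      if "carr (upair x u) f v (upair y w) \<in> comma_ar P" for x u f v y w
      using l[unfolded lift_action_def fdom, THEN conjunct2, THEN conjunct2, THEN bspec, OF that] by simp
    ultimately show ?D using l L.functorial
      by (simp add: lift_action_def push_simps)
  qed
  then show ?thesis unfolding LF_def by simp
qed

lemma lift_action_LF: "lift_action P \<delta> (LF P \<delta>)"
  unfolding LF_eq_The using ex_lift_action lift_action_unique by (metis theI')

lemma LF_eqI: "lift_action P \<delta> L \<Longrightarrow> LF P \<delta> = L"
  using lift_action_LF lift_action_unique by blast

end

section \<open>Split cofibrations and the free split cofibration\<close>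

lemma two_category_CAT2: "two_category CAT2"
  unfolding CAT2_def by (intro two_category_arrow2 two_category_CAT)

definition preserves_lifts :: "'u scofib \<Rightarrow> 'u sq \<Rightarrow> 'u scofib \<Rightarrow> bool" where
  "preserves_lifts = (\<lambda>(P, \<delta>) (_, T, S, _) (Q, \<delta>').
     \<forall>x\<in>Ob (fdom P). \<forall>u\<in>Ar (fcod P). src (fcod P) u = fob P x
       \<longrightarrow> far T (\<delta> x u) = \<delta>' (fob T x) (far S u))"

lemma SCoFib_eq:
  "SCoFib = structured CAT2 {(P, \<delta>). P \<in> C0 CAT2 \<and> split_cleavage P \<delta>} fst preserves_lifts (\<lambda>_ _ _. True)"
  unfolding SCoFib_def preserves_lifts_def ..

lemma clovenI:
  "\<lbrakk>functor_on E B P; cleavage P \<delta>\<rbrakk> \<Longrightarrow> cloven E B P \<delta>"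
  by (simp add: cloven_def comma_functor_def)

lemma SCoFib_objE:
  assumes "P \<in> C0 CAT2" "split_cleavage P \<delta>"
  obtains E B where "cloven E B P \<delta>" "functor_on E B P" "locally_small E" "locally_small B"
proof -
  obtain E B where "functor_on E B P" "locally_small E" "locally_small B"
    using assms(1) by (auto simp: CAT2_C0)
  moreover have "cleavage P \<delta>" using assms(2) by (simp add: split_cleavage_def)
  ultimately show ?thesis using that clovenI by blast
qed

lemma structured_cells_SCoFib:
  "structured_cells CAT2 {(P :: 'u::infinite func, \<delta>). P \<in> C0 CAT2 \<and> split_cleavage P \<delta>} fst
    preserves_lifts (\<lambda>_ _ _. True)"
proof -
  interpret two_category "CAT2 :: ('u func, 'u sq, 'u sq2) twocat" by (rule two_category_CAT2)
  show ?thesis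
  proof (unfold_locales, goal_cases)
    case (2 X)
    then obtain P \<delta> where X: "X = (P, \<delta>)" "P \<in> C0 CAT2" "split_cleavage P \<delta>" by (cases X) auto
    then obtain E B where "cloven E B P \<delta>" by (elim SCoFib_objE)
    then interpret cloven E B P \<delta> .
    show ?case by (simp add: X preserves_lifts_def)
  next
    case (3 X Y Z f g)
    obtain P \<delta> where X: "X = (P, \<delta>)" "P \<in> C0 CAT2" "split_cleavage P \<delta>" using 3(1) by (cases X) auto
    obtain Q \<delta>' where Y: "Y = (Q, \<delta>')" by (cases Y)
    obtain R \<delta>'' where Z: "Z = (R, \<delta>'')" by (cases Z)
    obtain T S where f: "f = (P, T, S, Q)" using 3(6,7) X Y by (cases f) simp
    obtain T' S' where g: "g = (Q, T', S', R)" using 3(8,9) Y Z by (cases g) simp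
    obtain E B E' B' where "square E B P E' B' Q T S" using 3(4) f by (auto simp: CAT2_C1)
    then interpret F: square E B P E' B' Q T S .
    obtain E'' B'' C D where "square C D Q E'' B'' R T' S'" using 3(5) g by (auto simp: CAT2_C1)
    then interpret G: square C D Q E'' B'' R T' S' .
    have [simp]: "C = E'" "D = B'" using G.P.fdom G.P.fcod F.Q.fdom F.Q.fcod by simp_all
    have "split_cleavage P \<delta>" by fact
    then have "cleavage P \<delta>" by (simp add: split_cleavage_def)
    then interpret cloven E B P \<delta> using F.P.functor_on_axioms by (rule clovenI[rotated])
    show ?case
      using 3(10,11) by (simp add: X Y Z f g preserves_lifts_def fcomp_simps)
  qed auto
qed

lemma two_category_SCoFib: "two_category (SCoFib :: 'u::infinite scofib_twocat)"
  unfolding SCoFib_eq by (rule structured_cells.two_category_structured[OF structured_cells_SCoFib])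

lemma two_functor_forget_SCoFib: "two_functor (SCoFib :: 'u::infinite scofib_twocat) CAT2 (forget fst)"
  unfolding SCoFib_eq by (rule structured_cells.two_functor_forget[OF structured_cells_SCoFib])

section \<open>The free split cofibration on a functor\<close>

lemma free_lifts_eq:
  "\<lbrakk>z \<in> comma_ob P; v \<in> Ar (fcod P); src (fcod P) v = tgt (fcod P) (usnd z)\<rbrakk>
    \<Longrightarrow> free_lifts P z v = carr z (ide (fdom P) (ufst z)) v (upair (ufst z) (cmp (fcod P) v (usnd z)))"
  by (simp add: free_lifts_def)

context comma_functor
begin

lemma free_lifts_in:
  assumes "z \<in> comma_ob P" "v \<in> Ar B" "src B v = tgt B (usnd z)"
  shows "carr z (ide E (ufst z)) v (upair (ufst z) (cmp B v (usnd z))) \<in> comma_ar P"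
  using assms by (simp add: comma_ar_iff)

lemma comma_functor_CodF: "comma_functor (comma P) B (CodF P)"
  using functor_on_CodF by (simp add: comma_functor_def)

text \<open>The top component of the lift is an identity, so a factorization must have the top
  component of g, while its bottom component is the prescribed s.\<close>

lemma cocartesian_free_lifts:
  assumes z [simp]: "z \<in> comma_ob P" and v [simp]: "v \<in> Ar B" "src B v = tgt B (usnd z)"
  shows "cocartesian (CodF P) (free_lifts P z v)"
proof -
  interpret C: comma_functor "comma P" B "CodF P" by (rule comma_functor_CodF)
  let ?e = "carr z (ide E (ufst z)) v (upair (ufst z) (cmp B v (usnd z)))"
  have e [simp]: "?e \<in> comma_ar P" by (simp add: free_lifts_in)
  show ?thesis
    unfolding C.cocartesian_iff
  proof (intro conjI allI impI)
    fix g s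
    assume "g \<in> Ar (comma P) \<and> src (comma P) g = src (comma P) (free_lifts P z v) \<and> s \<in> Ar B
      \<and> src B s = fob (CodF P) (tgt (comma P) (free_lifts P z v))
      \<and> far (CodF P) g = cmp B s (far (CodF P) (free_lifts P z v))"
    then have g [simp]: "g \<in> comma_ar P" and z: "csrc g = z" and s [simp]: "s \<in> Ar B" "src B s = tgt B v"
      and cbot: "cbot g = cmp B s v"
      by (auto simp: free_lifts_eq)
    define h where "h = carr (upair (ufst z) (cmp B v (usnd z))) (ctop g) s (ctgt g)"
    have tgt [simp]: "src E (ctop g) = ufst z" "tgt B s = tgt B (usnd (ctgt g))"
      using comma_arD'(5,8)[OF g] by (simp_all add: z cbot)
    \<comment> \<open>The square of \<open>h\<close> is that of \<open>g\<close> after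
      reassociating, since \<open>cbot g\<close> is s v.\<close>
    have h [simp]: "h \<in> comma_ar P"
      using comma_square[OF g] by (simp add: h_def comma_ar_iff z cbot B.assoc)
    have eq: "k = h" if k: "k \<in> comma_ar P" "csrc k = upair (ufst z) (cmp B v (usnd z))" "ctgt k = ctgt g"
      "cmp (comma P) k ?e = g" "cbot k = s" for k
    proof -
      have "ctop g = ctop (cmp (comma P) k ?e)" using k(4) by simp
      also have "\<dots> = ctop k" using k(1,2) comma_arD'(5)[OF k(1)] by simp
      finally show "k = h" using k comma_arD'(9)[OF k(1)] by (simp add: h_def)
    qed
    have "cmp (comma P) h ?e = carr (csrc g) (ctop g) (cbot g) (ctgt g)"
      using h by (simp add: h_def z cbot)
    then have he: "cmp (comma P) h ?e = g" by simp
    have h': "csrc h = upair (ufst z) (cmp B v (usnd z))" "ctgt h = ctgt g" "cbot h = s"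
      by (simp_all add: h_def)
    show "\<exists>!h. h \<in> Ar (comma P) \<and> src (comma P) h = tgt (comma P) (free_lifts P z v)
      \<and> tgt (comma P) h = tgt (comma P) g \<and> cmp (comma P) h (free_lifts P z v) = g \<and> far (CodF P) h = s"
    proof (rule ex1I[of _ h], goal_cases)
      case 1
      show ?case using he h' by (simp add: free_lifts_eq)
    next
      case (2 k)
      have fl: "free_lifts P z v = ?e" by (simp add: free_lifts_eq)
      have k: "k \<in> comma_ar P" using 2 by simp
      have "src (comma P) k = tgt (comma P) ?e" "tgt (comma P) k = tgt (comma P) g"
        "cmp (comma P) k ?e = g" "far (CodF P) k = s"
        using 2 unfolding fl by blast+
      then show ?case using eq[OF k] k by simp
    qed
  qed (simp add: free_lifts_eq)
qed

lemma cloven_free: "cloven (comma P) B (CodF P) (free_lifts P)"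
proof -
  interpret C: comma_functor "comma P" B "CodF P" by (rule comma_functor_CodF)
  show ?thesis
  proof (rule clovenI[OF functor_on_CodF], unfold_locales, goal_cases)
    case (1 z v)
    then show ?case by (auto simp: free_lifts_def)
  next
    case (2 z v)
    then show ?case using free_lifts_in[of z v] by (simp add: free_lifts_eq)
  next
    case (3 z v)
    then show ?case using cocartesian_free_lifts[of z v] by simp
  next
    case (4 z v)
    then show ?case using free_lifts_in[of z v] by (simp add: free_lifts_eq)
  qed
qed

text \<open>Lifts compose as (1, v)(1, u) = (1, vu), and associativity in B makes the two targets
  the same object.\<close>

lemma split_cleavage_free: "split_cleavage (CodF P) (free_lifts P)"
proof -
  interpret C: cloven "comma P" B "CodF P" "free_lifts P" by (rule cloven_free)
  show ?thesis
  proof (rule C.split_cleavageI, goal_cases)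
    case (1 z)
    then show ?case by (simp add: free_lifts_eq)
  next
    case (2 z u v)
    then have [simp]: "z \<in> comma_ob P" "u \<in> Ar B" "v \<in> Ar B" "src B v = tgt B u" "src B u = tgt B (usnd z)"
      by simp_all
    show ?case
      using free_lifts_in[of z u] free_lifts_in[of "upair (ufst z) (cmp B u (usnd z))" v]
      by (simp add: free_lifts_eq B.assoc)
  qed
qed

end

text \<open>T preserves identities and S preserves composites, so (1, v) goes to (1, S v) with the
  correct target.\<close>

lemma (in square) preserves_free_lifts:
  "preserves_lifts (CodF P, free_lifts P) (CodF P, bar (P, T, S, Q), S, CodF Q) (CodF Q, free_lifts Q)"
  by (simp add: preserves_lifts_def free_lifts_eq P.free_lifts_in)

lemma Free_simps [simp]:
  "F0 Free P = (CodF P, free_lifts P)"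
  "F1 Free (P, T, S, Q) = ((CodF P, free_lifts P), (CodF P, bar (P, T, S, Q), S, CodF Q),
      (CodF Q, free_lifts Q))"
  "F2 Free (P, \<beta>, \<alpha>, Q) = ((CodF P, free_lifts P), (CodF P, bar2 (P, \<beta>, \<alpha>, Q), \<alpha>, CodF Q),
      (CodF Q, free_lifts Q))"
  by (simp_all add: Free_def comma_twofun_def)

lemma Free_obj:
  assumes "P \<in> C0 CAT2"
  shows "CodF P \<in> C0 CAT2" "split_cleavage (CodF P) (free_lifts P)"
proof -
  obtain E B where P: "functor_on E B P" "locally_small E" "locally_small B"
    using assms by (auto simp: CAT2_C0)
  interpret comma_functor E B P using P by (simp add: comma_functor_def)
  show "CodF P \<in> C0 CAT2"
    unfolding CAT2_C0 using functor_on_CodF locally_small_comma[OF P] P(3) by blast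
  show "split_cleavage (CodF P) (free_lifts P)" by (rule split_cleavage_free)
qed

lemma Free_1cell:
  assumes "(P, T, S, Q) \<in> C1 CAT2"
  shows "(CodF P, bar (P, T, S, Q), S, CodF Q) \<in> C1 CAT2"
    "preserves_lifts (CodF P, free_lifts P) (CodF P, bar (P, T, S, Q), S, CodF Q) (CodF Q, free_lifts Q)"
proof -
  obtain E B E' B' where sq: "square E B P E' B' Q T S" "locally_small E" "locally_small B"
      "locally_small E'" "locally_small B'"
    using assms by (auto simp: CAT2_C1)
  interpret square E B P E' B' Q T S by fact
  show "(CodF P, bar (P, T, S, Q), S, CodF Q) \<in> C1 CAT2"
    unfolding CAT2_C1 using square_bar locally_small_comma[OF P.functor_on_axioms]
        locally_small_comma[OF Q.functor_on_axioms] sq by blast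
  show "preserves_lifts (CodF P, free_lifts P) (CodF P, bar (P, T, S, Q), S, CodF Q) (CodF Q, free_lifts Q)"
    by (rule preserves_free_lifts)
qed

text \<open>Each membership fact brings its own names for the categories; the shared middle functor
  identifies them.\<close>

lemma CAT2_composableE:
  assumes "(P, T, S, Q) \<in> C1 CAT2" "(Q, T', S', R) \<in> C1 CAT2"
  obtains E B E' B' E'' B'' where "square E B P E' B' Q T S" "square E' B' Q E'' B'' R T' S'"
proof -
  obtain E B E' B' where 1: "square E B P E' B' Q T S" using assms by (auto simp: CAT2_C1)
  obtain C D E'' B'' where 2: "square C D Q E'' B'' R T' S'" using assms by (auto simp: CAT2_C1)
  have "C = E'" "D = B'" using 1 2 by (auto simp: square_def comma_functor_def functor_on_iff)
  with 1 2 that show ?thesis by blast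
qed

lemma square2_sides:
  assumes "square2 E B P E' B' Q T S T' S' \<beta> \<alpha>"
  shows "fdom P = E" "fcod P = B" "fdom Q = E'" "fcod Q = B'" "nsrc \<beta> = T" "ntgt \<beta> = T'" "nsrc \<alpha> = S"
      "ntgt \<alpha> = S'"
proof -
  interpret square2 E B P E' B' Q T S T' S' \<beta> \<alpha> by fact
  show "fdom P = E" "fcod P = B" "fdom Q = E'" "fcod Q = B'" "nsrc \<beta> = T" "ntgt \<beta> = T'" "nsrc \<alpha> = S"
      "ntgt \<alpha> = S'"
    by simp_all
qed

lemma two_functor_Free: "two_functor (CAT2 :: ('u::infinite func, 'u sq, 'u sq2) twocat) SCoFib Free"
proof -
  interpret K: two_category "CAT2 :: ('u func, 'u sq, 'u sq2) twocat" by (rule two_category_CAT2)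
  interpret A: two_category "SCoFib :: 'u scofib_twocat" by (rule two_category_SCoFib)
  show ?thesis
  proof (unfold_locales, goal_cases)
    case (1 P)
    then show ?case by (simp add: SCoFib_eq Free_obj)
  next
    case (2 f)
    then obtain P T S Q where f: "f = (P, T, S, Q)" by (cases f)
    with 2 have "P \<in> C0 CAT2" "Q \<in> C0 CAT2" using K.s1_in[of f] K.t1_in[of f] by auto
    with 2 f show ?case by (simp add: SCoFib_eq Free_obj Free_1cell)
  next
    case (3 a)
    then obtain P \<beta> \<alpha> Q where a: "a = (P, \<beta>, \<alpha>, Q)" by (cases a)
    have f: "(P, nsrc \<beta>, nsrc \<alpha>, Q) \<in> C1 CAT2" "(P, ntgt \<beta>, ntgt \<alpha>, Q) \<in> C1 CAT2"
      using K.s2_in[OF 3] K.t2_in[OF 3] a by simp_all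
    have P: "P \<in> C0 CAT2" "Q \<in> C0 CAT2" using K.s1_in[OF f(1)] K.t1_in[OF f(1)] by auto
    obtain E B E' B' T S T' S' where sq: "square2 E B P E' B' Q T S T' S' \<beta> \<alpha>"
        "locally_small E" "locally_small B" "locally_small E'" "locally_small B'"
      using 3 a by (auto simp: CAT2_C2)
    interpret square2 E B P E' B' Q T S T' S' \<beta> \<alpha> by fact
    have "(CodF P, bar2 (P, \<beta>, \<alpha>, Q), \<alpha>, CodF Q) \<in> C2 CAT2"
      unfolding CAT2_C2 using square2_bar sq locally_small_comma[OF F.P.functor_on_axioms]
        locally_small_comma[OF F.Q.functor_on_axioms] by blast
    then show ?case using a f P by (simp add: SCoFib_eq Free_obj Free_1cell)
  next
    case (4 f) then show ?case by (cases f) (simp add: SCoFib_eq)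
  next
    case (5 f) then show ?case by (cases f) (simp add: SCoFib_eq)
  next
    case (6 a) then show ?case by (cases a) (simp add: SCoFib_eq)
  next
    case (7 a) then show ?case by (cases a) (simp add: SCoFib_eq)
  next
    case (8 P)
    then obtain E B where P: "functor_on E B P" by (auto simp: CAT2_C0)
    then interpret comma_functor E B P by (simp add: comma_functor_def)
    show ?case by (simp add: SCoFib_eq bar_id[OF comma_functor_axioms])
  next
    case (9 f)
    obtain P T S Q where f: "f = (P, T, S, Q)" by (cases f)
    with 9 obtain E B E' B' where "square E B P E' B' Q T S" by (auto simp: CAT2_C1)
    then show ?case by (simp add: f SCoFib_eq bar2_id2)
  next
    case (10 f g)
    obtain P T S Q where f: "f = (P, T, S, Q)" by (cases f)
    obtain T' S' R where g: "g = (Q, T', S', R)" using 10(3) f by (cases g) simp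
    obtain E B E' B' E'' B'' where "square E B P E' B' Q T S" "square E' B' Q E'' B'' R T' S'"
      using 10(1,2) f g by (auto elim: CAT2_composableE)
    then show ?case by (simp add: f g SCoFib_eq bar_comp)
  next
    case (11 a b)
    obtain P \<beta> \<alpha> Q where a: "a = (P, \<beta>, \<alpha>, Q)" by (cases a)
    obtain \<beta>' \<alpha>' where b: "b = (P, \<beta>', \<alpha>', Q)" using 11(3) a by (cases b) simp
    obtain E B E' B' T S T' S' where sq: "square2 E B P E' B' Q T S T' S' \<beta> \<alpha>"
      using 11(1) a by (auto simp: CAT2_C2)
    obtain C D C' D' U V T'' S'' where sq': "square2 C D P C' D' Q U V T'' S'' \<beta>' \<alpha>'"
      using 11(2) b by (auto simp: CAT2_C2)
    have eq: "C = E" "D = B" "C' = E'" "D' = B'" "U = T'" "V = S'"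
      using square2_sides[OF sq] square2_sides[OF sq'] 11(3) a b by auto
    show ?case using bar2_vcomp[OF sq sq'[unfolded eq]] by (simp add: a b SCoFib_eq)
  next
    case (12 a b)
    obtain P \<beta> \<alpha> Q where a: "a = (P, \<beta>, \<alpha>, Q)" by (cases a)
    obtain \<beta>' \<alpha>' R where b: "b = (Q, \<beta>', \<alpha>', R)" using 12(3) a by (cases b) simp
    obtain E B E' B' T S T' S' where sq: "square2 E B P E' B' Q T S T' S' \<beta> \<alpha>"
      using 12(1) a by (auto simp: CAT2_C2)
    obtain C D E'' B'' U V U' V' where sq': "square2 C D Q E'' B'' R U V U' V' \<beta>' \<alpha>'"
      using 12(2) b by (auto simp: CAT2_C2)
    have eq: "C = E'" "D = B'"
      using square2_sides[OF sq] square2_sides[OF sq'] by auto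
    show ?case using bar2_hcomp[OF sq sq'[unfolded eq]] by (simp add: a b SCoFib_eq)
  qed
qed

section \<open>Unit, counit and the 2-adjunction\<close>

lemma HF_simps [simp]:
  "fdom (HF P) = fdom P" "fcod (HF P) = comma P"
  "x \<in> Ob (fdom P) \<Longrightarrow> fob (HF P) x = upair x (ide (fcod P) (fob P x))"
  "f \<in> Ar (fdom P) \<Longrightarrow> far (HF P) f = carr (upair (src (fdom P) f) (ide (fcod P) (fob P (src (fdom P) f)))) f
     (far P f) (upair (tgt (fdom P) f) (ide (fcod P) (fob P (tgt (fdom P) f))))"
  by (simp_all add: HF_def Let_def)

context comma_functor
begin

lemma unit_ar_in:
  assumes "f \<in> Ar E" "src E f = x" "tgt E f = y"
  shows "carr (upair x (ide B (fob P x))) f (far P f) (upair y (ide B (fob P y))) \<in> comma_ar P"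
  using assms by (auto simp: comma_ar_iff)

lemma functor_on_HF: "functor_on E (comma P) (HF P)"
  by (rule functor_onI)
    (auto simp: A.category_axioms category_comma unit_ar_in, auto simp: HF_def)

lemma square_HF: "square E B P (comma P) B (CodF P) (HF P) (idf B)"
  by (rule squareI) (simp_all add: functor_on_axioms functor_on_CodF functor_on_HF
      functor_on_idf B.category_axioms unit_ar_in)

end

lemma (in square) HF_natural:
  "fcomp (bar (P, T, S, Q)) (HF P) = fcomp (HF Q) T"
  by (rule functor_eqI[OF functor_on_fcomp[OF P.functor_on_HF functor_on_bar]
        functor_on_fcomp[OF T.functor_on_axioms Q.functor_on_HF]])
    (simp_all add: fcomp_simps P.unit_ar_in)

lemma (in square2) HF_natural2:
  "hcomp CAT (bar2 (P, \<beta>, \<alpha>, Q)) (id2 CAT (HF P)) = hcomp CAT (id2 CAT (HF Q)) \<beta>"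
proof (rule ntrans_eqI[OF ntrans_on_hcomp[OF ntrans_on_id2[OF F.P.functor_on_HF] ntrans_on_bar2,
        unfolded F.HF_natural G.HF_natural]
      ntrans_on_hcomp[OF \<beta>.ntrans_on_axioms ntrans_on_id2[OF F.Q.functor_on_HF]]])
  fix x assume [simp]: "x \<in> Ob E"
  let ?z = "upair x (ide B (fob P x))"
  have "carr (upair (fob T x) (ide B' (fob S (fob P x)))) (ncmp \<beta> x) (ncmp \<alpha> (fob P x))
      (upair (fob T' x) (ide B' (fob S' (fob P x)))) \<in> comma_ar Q"
    using bar2_ar_in[of ?z] by simp
  then show "ncmp (hcomp CAT (bar2 (P, \<beta>, \<alpha>, Q)) (id2 CAT (HF P))) x
      = ncmp (hcomp CAT (id2 CAT (HF Q)) \<beta>) x"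
    using F.P.comma_ide_in[of ?z] F.bar_ar_in[OF F.P.comma_ide_in[of ?z] refl refl]
      F.Q.comma_ide_in[of "upair (fob T' x) (ide B' (fob S' (fob P x)))"]
    by simp
qed

section \<open>The action of a split cofibration and its naturality\<close>

locale split_cloven = cloven E B P \<delta> + split_cleavage P \<delta>
  for E B :: "'u::infinite cat" and P and \<delta> :: "'u lifts"
begin

lemma lift_ide [simp]: "x \<in> Ob E \<Longrightarrow> \<delta> x (ide B (fob P x)) = ide E x"
  using normal[of x] by simp

lemma lift_cmp:
  "\<lbrakk>x \<in> Ob E; u \<in> Ar B; v \<in> Ar B; src B u = fob P x; tgt B u = src B v\<rbrakk>
    \<Longrightarrow> \<delta> x (cmp B v u) = cmp E (\<delta> (tgt E (\<delta> x u)) v) (\<delta> x u)"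
  using split_lift[of x u v] by (simp add: push_simps)

lemmas LF_simps = lift_actionD[OF lift_action_LF]

lemma square_LF: "square (comma P) B (CodF P) E B P (LF P \<delta>) (idf B)"
  by (rule squareI) (simp_all add: functor_on_axioms functor_on_CodF LF_simps
      functor_on_idf B.category_axioms)

text \<open>Write u for \<open>usnd z\<close>. Precomposed with the lift of u, the left side becomes
  the lift of vu, which splitness decomposes; cancelling the lift of u gives the claim. It makes the
  counit a 1-cell of \<open>SCoFib\<close>.\<close>

lemma far_LF_lift:
  assumes [simp]: "z \<in> comma_ob P" "v \<in> Ar B" "src B v = tgt B (usnd z)"
  shows "far (LF P \<delta>) (carr z (ide E (ufst z)) v (upair (ufst z) (cmp B v (usnd z))))
    = \<delta> (tgt E (\<delta> (ufst z) (usnd z))) v"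
    (is "far _ ?a = _")
proof (rule lift_unique[of "ufst z" "usnd z"])
  have a: "?a \<in> comma_ar P" by (simp add: free_lifts_in)
  note L = LF_simps(3-)[OF a]
  show "far (LF P \<delta>) ?a \<in> Ar E" "src E (far (LF P \<delta>) ?a) = tgt E (\<delta> (ufst z) (usnd z))"
    "far P (far (LF P \<delta>) ?a) = far P (\<delta> (tgt E (\<delta> (ufst z) (usnd z))) v)"
    "cmp E (far (LF P \<delta>) ?a) (\<delta> (ufst z) (usnd z))
        = cmp E (\<delta> (tgt E (\<delta> (ufst z) (usnd z))) v) (\<delta> (ufst z) (usnd z))"
    using L by (simp_all add: lift_cmp)
qed simp_all

lemma preserves_lifts_LF:
  "preserves_lifts (CodF P, free_lifts P) (CodF P, LF P \<delta>, idf B, P) (P, \<delta>)"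
  by (simp add: preserves_lifts_def free_lifts_eq LF_simps far_LF_lift)

text \<open>By normality both lifts in the defining equation of L (f, P f) are identities. This is
  the triangle identity on the side of U.\<close>

lemma LF_HF: "fcomp (LF P \<delta>) (HF P) = idf E"
proof (rule functor_eqI[OF functor_on_fcomp[OF functor_on_HF LF_simps(1)] functor_on_idf])
  fix f assume f: "f \<in> Ar E"
  let ?a = "carr (upair (src E f) (ide B (fob P (src E f)))) f (far P f)
      (upair (tgt E f) (ide B (fob P (tgt E f))))"
  have a: "?a \<in> comma_ar P" using f by (simp add: unit_ar_in)
  have "far (LF P \<delta>) ?a = f" using LF_simps(3-)[OF a] f by simp
  then show "far (fcomp (LF P \<delta>) (HF P)) f = far (idf E) f" using f by (simp add: fcomp_simps)
qed (simp_all add: A.category_axioms fcomp_simps LF_simps)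

end

locale lift_square = P: cloven E B P \<delta> + Q: cloven E' B' Q \<delta>' + square E B P E' B' Q T S
  for E B :: "'u::infinite cat" and P \<delta> E' B' Q \<delta>' T S +
  assumes lifts [simp]: "\<lbrakk>x \<in> Ob E; u \<in> Ar B; src B u = fob P x\<rbrakk> \<Longrightarrow> far T (\<delta> x u) = \<delta>' (fob T x) (far S u)"
begin

lemma tgt_lift: "\<lbrakk>x \<in> Ob E; u \<in> Ar B; src B u = fob P x\<rbrakk> \<Longrightarrow> fob T (tgt E (\<delta> x u))
    = tgt E' (\<delta>' (fob T x) (far S u))"
  using T.functor_simps(4)[of "\<delta> x u"] by simp

text \<open>After precomposition with a chosen lift of Q both sides become T of the defining
  equation of L on P, because T preserves lifts. Uniqueness of factorizations then applies.\<close>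

lemma LF_natural: "fcomp T (LF P \<delta>) = fcomp (LF Q \<delta>') (bar (P, T, S, Q))"
proof (rule functor_eqI[OF functor_on_fcomp[OF P.lift_actionD(1)[OF P.lift_action_LF] T.functor_on_axioms]
      functor_on_fcomp[OF functor_on_bar Q.lift_actionD(1)[OF Q.lift_action_LF]]])
  note L = P.lift_actionD[OF P.lift_action_LF] and L' = Q.lift_actionD[OF Q.lift_action_LF]
  show "fob (fcomp T (LF P \<delta>)) z = fob (fcomp (LF Q \<delta>') (bar (P, T, S, Q))) z" if "z \<in> Ob (comma P)" for z
    using that by (simp add: fcomp_simps L L' functor_on.fdom[OF L(1)] tgt_lift)
  fix a assume "a \<in> Ar (comma P)"
  then have a [simp]: "a \<in> comma_ar P" by simp
  let ?b = "carr (upair (fob T (ufst (csrc a))) (far S (usnd (csrc a)))) (far T (ctop a)) (far S (cbot a))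
        (upair (fob T (ufst (ctgt a))) (far S (usnd (ctgt a))))"
  have b: "?b \<in> comma_ar Q" by (simp add: bar_ar_in)
  have l: "far (LF P \<delta>) a \<in> Ar E" "src E (far (LF P \<delta>) a) = tgt E (\<delta> (ufst (csrc a)) (usnd (csrc a)))"
    "far P (far (LF P \<delta>) a) = cbot a"
    "cmp E (far (LF P \<delta>) a) (\<delta> (ufst (csrc a)) (usnd (csrc a)))
        = cmp E (\<delta> (ufst (ctgt a)) (usnd (ctgt a))) (ctop a)"
    by (simp_all add: L)
  have "far T (far (LF P \<delta>) a) = far (LF Q \<delta>') ?b"
  proof (rule Q.lift_unique[of "fob T (ufst (csrc a))" "far S (usnd (csrc a))"])
    show "far T (far (LF P \<delta>) a) \<in> Ar E'" "far (LF Q \<delta>') ?b \<in> Ar E'"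
      "src E' (far T (far (LF P \<delta>) a)) = tgt E' (\<delta>' (fob T (ufst (csrc a))) (far S (usnd (csrc a))))"
      "src E' (far (LF Q \<delta>') ?b) = tgt E' (\<delta>' (fob T (ufst (csrc a))) (far S (usnd (csrc a))))"
      "far Q (far T (far (LF P \<delta>) a)) = far Q (far (LF Q \<delta>') ?b)"
      using l L'(3-)[OF b] by (simp_all add: tgt_lift)
    \<comment> \<open>T must first distribute over both composites; \<open>lifts\<close> is withheld
      until that is done.\<close>
    have "cmp E' (far T (far (LF P \<delta>) a)) (far T (\<delta> (ufst (csrc a)) (usnd (csrc a))))
        = cmp E' (far T (\<delta> (ufst (ctgt a)) (usnd (ctgt a)))) (far T (ctop a))"
      using arg_cong[OF l(4), of "far T"] l(1,2) by (simp del: lifts)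
    then show "cmp E' (far T (far (LF P \<delta>) a)) (\<delta>' (fob T (ufst (csrc a))) (far S (usnd (csrc a))))
        = cmp E' (far (LF Q \<delta>') ?b) (\<delta>' (fob T (ufst (csrc a))) (far S (usnd (csrc a))))"
      using L'(7)[OF b] by simp
  qed simp_all
  then show "far (fcomp T (LF P \<delta>)) a = far (fcomp (LF Q \<delta>') (bar (P, T, S, Q))) a"
    by (simp add: fcomp_simps functor_on.fdom[OF L(1)])
qed

end

text \<open>Naturality of \<open>\<beta>\<close> at the lift of u determines its component at u_!x
  from its component at x, and the right-hand side satisfies the same factorization equation over
  the same base arrow.\<close>

lemma LF_natural2:
  assumes "lift_square E B P \<delta> E' B' Q \<delta>' T S" "lift_square E B P \<delta> E' B' Q \<delta>' T' S'"
    and "square2 E B P E' B' Q T S T' S' \<beta> \<alpha>"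
  shows "hcomp CAT \<beta> (id2 CAT (LF P \<delta>)) = hcomp CAT (id2 CAT (LF Q \<delta>')) (bar2 (P, \<beta>, \<alpha>, Q))"
proof -
  interpret F: lift_square E B P \<delta> E' B' Q \<delta>' T S by fact
  interpret G: lift_square E B P \<delta> E' B' Q \<delta>' T' S' by fact
  interpret square2 E B P E' B' Q T S T' S' \<beta> \<alpha> by fact
  note L = F.P.lift_actionD[OF F.P.lift_action_LF] and L' = F.Q.lift_actionD[OF F.Q.lift_action_LF]
  show ?thesis
  proof (rule ntrans_eqI[OF ntrans_on_hcomp[OF ntrans_on_id2[OF L(1)] \<beta>.ntrans_on_axioms,
      unfolded F.LF_natural G.LF_natural]
      ntrans_on_hcomp[OF ntrans_on_bar2 ntrans_on_id2[OF L'(1)]]])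
    fix z assume "z \<in> Ob (comma P)"
    then have z [simp]: "z \<in> comma_ob P" by simp
    let ?x = "ufst z" and ?u = "usnd z"
    let ?b = "carr (upair (fob T ?x) (far S ?u)) (ncmp \<beta> ?x) (ncmp \<alpha> (tgt B ?u))
        (upair (fob T' ?x) (far S' ?u))"
    let ?y = "tgt E (\<delta> ?x ?u)"
    have b: "?b \<in> comma_ar Q" by (rule bar2_ar_in) simp
    have eq: "ncmp \<beta> ?y = far (LF Q \<delta>') ?b"
    proof (rule F.Q.lift_unique[of "fob T ?x" "far S ?u"])
      have "cmp E' (ncmp \<beta> ?y) (far T (\<delta> ?x ?u)) = cmp E' (far T' (\<delta> ?x ?u)) (ncmp \<beta> ?x)"
        using \<beta>.natural[of "\<delta> ?x ?u"] by (simp del: F.lifts G.lifts)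
      then show "cmp E' (ncmp \<beta> ?y) (\<delta>' (fob T ?x) (far S ?u))
          = cmp E' (far (LF Q \<delta>') ?b) (\<delta>' (fob T ?x) (far S ?u))"
        using L'(7)[OF b] by simp
    qed (use L'(3-)[OF b] in \<open>simp_all add: F.tgt_lift\<close>)
    have d: "fdom (LF P \<delta>) = comma P" "fdom (LF Q \<delta>') = comma Q" "fcod (LF P \<delta>) = E" "fcod (LF Q \<delta>') = E'"
      using L(1) L'(1) by (simp_all add: functor_on_iff)
    have "far T (ide E ?y) = ide E' (fob T ?y)" by simp
    moreover have "cmp E' (ncmp \<beta> ?y) (ide E' (fob T ?y)) = ncmp \<beta> ?y" by simp
    moreover have "cmp E' (ide E' (tgt E' (\<delta>' (fob T' ?x) (far S' ?u)))) (far (LF Q \<delta>') ?b)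
        = far (LF Q \<delta>') ?b"
      using L'(3-)[OF b] by simp
    ultimately show "ncmp (hcomp CAT \<beta> (id2 CAT (LF P \<delta>))) z
        = ncmp (hcomp CAT (id2 CAT (LF Q \<delta>')) (bar2 (P, \<beta>, \<alpha>, Q))) z"
      by (simp add: d L L' eq)
  qed
qed

section \<open>The multiplication as the action of the free split cofibration\<close>

lemma MF_simps [simp]:
  "fdom (MF P) = comma (CodF P)" "fcod (MF P) = comma P"
  "z \<in> comma_ob (CodF P) \<Longrightarrow> fob (MF P) z = upair (ufst (ufst z)) (cmp (fcod P) (usnd z) (usnd (ufst z)))"
  "a \<in> comma_ar (CodF P) \<Longrightarrow> far (MF P) a
    = carr (upair (ufst (ufst (csrc a))) (cmp (fcod P) (usnd (csrc a)) (usnd (ufst (csrc a)))))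
        (ctop (ctop a)) (cbot a)
        (upair (ufst (ufst (ctgt a))) (cmp (fcod P) (usnd (ctgt a)) (usnd (ufst (ctgt a)))))"
  by (simp_all add: MF_def Let_def)

context comma_functor
begin

lemma comma_CodF_obD [simp]:
  assumes "z \<in> comma_ob (CodF P)"
  shows "ufst z \<in> comma_ob P" "usnd z \<in> Ar B" "src B (usnd z) = tgt B (usnd (ufst z))"
    "upair (ufst z) (usnd z) = z"
  using comma_obD[OF assms] by simp_all

lemma comma_CodF_arD [simp]:
  assumes "a \<in> comma_ar (CodF P)"
  shows "csrc a \<in> comma_ob (CodF P)" "ctgt a \<in> comma_ob (CodF P)" "ctop a \<in> comma_ar P" "cbot a \<in> Ar B"
    "csrc (ctop a) = ufst (csrc a)" "ctgt (ctop a) = ufst (ctgt a)"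
    "src B (cbot a) = tgt B (usnd (csrc a))" "tgt B (cbot a) = tgt B (usnd (ctgt a))"
    "src E (ctop (ctop a)) = ufst (ufst (csrc a))" "tgt E (ctop (ctop a)) = ufst (ufst (ctgt a))"
    "src B (cbot (ctop a)) = tgt B (usnd (ufst (csrc a)))" "tgt B (cbot (ctop a))
        = tgt B (usnd (ufst (ctgt a)))"
    "carr (csrc a) (ctop a) (cbot a) (ctgt a) = a"
  using comma_arD[OF assms] comma_arD'[of "ctop a"] by auto

text \<open>Two squares are pasted: the one of \<open>a\<close> and the one of its top component,
  itself an arrow of the comma category of P.\<close>

lemma MF_ar_in:
  assumes a [simp]: "a \<in> comma_ar (CodF P)" and z: "csrc a = z" "ctgt a = z'"
  shows "carr (upair (ufst (ufst z)) (cmp B (usnd z) (usnd (ufst z)))) (ctop (ctop a)) (cbot a)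
        (upair (ufst (ufst z')) (cmp B (usnd z') (usnd (ufst z')))) \<in> comma_ar P"
proof -
  have 1: "cmp B (cbot a) (usnd (csrc a)) = cmp B (usnd (ctgt a)) (cbot (ctop a))"
    using comma_arD(9)[OF a] by simp
  have 2: "cmp B (cbot (ctop a)) (usnd (ufst (csrc a)))
      = cmp B (usnd (ufst (ctgt a))) (far P (ctop (ctop a)))"
    using comma_square[of "ctop a"] by simp
  have "cmp B (cbot a) (cmp B (usnd (csrc a)) (usnd (ufst (csrc a))))
      = cmp B (usnd (ctgt a)) (cmp B (cbot (ctop a)) (usnd (ufst (csrc a))))"
    by (simp add: B.assoc 1)
  also have "\<dots> = cmp B (cmp B (usnd (ctgt a)) (usnd (ufst (ctgt a)))) (far P (ctop (ctop a)))"
    by (simp add: B.assoc 2)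
  finally show ?thesis by (simp add: comma_ar_iff flip: z)
qed

lemma functor_on_MF: "functor_on (comma (CodF P)) (comma P) (MF P)"
proof -
  interpret C: comma_functor "comma P" B "CodF P" by (rule comma_functor_CodF)
  show ?thesis
  proof (rule functor_onI, goal_cases)
    case (9 z)
    then have [simp]: "z \<in> comma_ob (CodF P)" by simp
    show ?case using C.comma_ide_in[of z] by simp
  next
    case (10 a b)
    then have [simp]: "a \<in> comma_ar (CodF P)" "b \<in> comma_ar (CodF P)" and eq: "ctgt a = csrc b" by simp_all
    have m: "ctgt (ctop a) = csrc (ctop b)" by (simp add: eq)
    show ?case
      using C.comma_cmp_in[of a b] MF_ar_in[of a, OF _ refl refl] MF_ar_in[of b, OF _ refl refl] eq m
          by simp
  qed (auto simp: category_comma C.category_comma MF_ar_in, auto simp: MF_def)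
qed

text \<open>\<open>MF P\<close> is checked against \<open>lift_action\<close>, and uniqueness of its
  solution does the rest. This identifies the multiplication with the counit at a free
  object.\<close>

lemma LF_free: "LF (CodF P) (free_lifts P) = MF P"
proof -
  interpret F: cloven "comma P" B "CodF P" "free_lifts P" by (rule cloven_free)
  have "lift_action (CodF P) (free_lifts P) (MF P)"
    unfolding lift_action_def
  proof (intro conjI ballI)
    fix z assume "z \<in> comma_ob (CodF P)"
    then show "fob (MF P) z = tgt (fdom (CodF P)) (free_lifts P (ufst z) (usnd z))"
      using free_lifts_in[of "ufst z" "usnd z"] by (simp add: free_lifts_eq)
  next
    fix a assume [simp]: "a \<in> comma_ar (CodF P)"
    show "far (CodF P) (far (MF P) a) = cbot a" by (simp add: MF_ar_in)
    have "cmp B (cbot a) (usnd (csrc a)) = cmp B (usnd (ctgt a)) (cbot (ctop a))"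
      using comma_arD(9)[of a "CodF P"] by simp
    then show "cmp (fdom (CodF P)) (far (MF P) a) (free_lifts P (ufst (csrc a)) (usnd (csrc a)))
        = cmp (fdom (CodF P)) (free_lifts P (ufst (ctgt a)) (usnd (ctgt a))) (ctop a)"
      using free_lifts_in[of "ufst (csrc a)" "usnd (csrc a)"]
          free_lifts_in[of "ufst (ctgt a)" "usnd (ctgt a)"]
      by (simp add: free_lifts_eq MF_ar_in)
  qed (simp add: functor_on_MF)
  then show ?thesis by (rule F.LF_eqI)
qed

text \<open>The triangle identity on the side of \<open>Free\<close>: the inner identity arrow added
  by the unit is absorbed by composition.\<close>

lemma MF_bar_HF: "fcomp (MF P) (bar (P, HF P, idf B, CodF P)) = idf (comma P)"
proof -
  interpret square E B P "comma P" B "CodF P" "HF P" "idf B" by (rule square_HF)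
  show ?thesis
  proof (rule functor_eqI[OF functor_on_fcomp[OF functor_on_bar functor_on_MF]
      functor_on_idf[OF category_comma]])
    fix a assume "a \<in> Ar (comma P)"
    then have [simp]: "a \<in> comma_ar P" by simp
    show "far (fcomp (MF P) (bar (P, HF P, idf B, CodF P))) a = far (idf (comma P)) a"
      using bar_ar_in[of a, OF _ refl refl] by (simp add: fcomp_simps)
  qed (simp add: fcomp_simps)
qed

end

lemma free_counit_simp [simp]:
  "free_counit (P, \<delta>) = ((CodF P, free_lifts P), (CodF P, LF P \<delta>, idf (fcod P), P), (P, \<delta>))"
  by (simp add: free_counit_def L_action_def)

section \<open>Cells of \<open>SCoFib\<close> read as squares between split cofibrations\<close>

lemma lift_square_iff:
  assumes "square E B P E' B' Q T S" "split_cleavage P \<delta>" "split_cleavage Q \<delta>'"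
  shows "lift_square E B P \<delta> E' B' Q \<delta>' T S \<longleftrightarrow> preserves_lifts (P, \<delta>) (P, T, S, Q) (Q, \<delta>')"
proof -
  interpret square E B P E' B' Q T S by fact
  have "cloven E B P \<delta>" "cloven E' B' Q \<delta>'"
    using assms(2,3) P.functor_on_axioms Q.functor_on_axioms
    by (auto intro: clovenI simp: split_cleavage_def)
  then show ?thesis
    using assms(1) by (auto simp: lift_square_def lift_square_axioms_def preserves_lifts_def)
qed

lemma split_clovenI:
  "\<lbrakk>functor_on E B P; split_cleavage P \<delta>\<rbrakk> \<Longrightarrow> split_cloven E B P \<delta>"
  by (simp add: split_cloven_def clovenI split_cleavage_def)

lemma SCoFib_C0E:
  fixes Z :: "'u::infinite scofib"
  assumes "Z \<in> C0 SCoFib"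
  obtains E B P \<delta> where "Z = (P, \<delta>)" "P \<in> C0 CAT2" "split_cloven E B P \<delta>" "locally_small E"
      "locally_small B"
proof -
  obtain P \<delta> where Z: "Z = (P, \<delta>)" "P \<in> C0 CAT2" "split_cleavage P \<delta>"
    using assms by (cases Z) (auto simp: SCoFib_eq)
  then show ?thesis using that by (metis SCoFib_objE split_clovenI)
qed

lemma SCoFib_C1E:
  fixes f :: "'u::infinite scofib \<times> 'u sq \<times> 'u scofib"
  assumes "f \<in> C1 SCoFib"
  obtains E B P \<delta> E' B' Q \<delta>' T S where "f = ((P, \<delta>), (P, T, S, Q), (Q, \<delta>'))"
    "lift_square E B P \<delta> E' B' Q \<delta>' T S" "split_cloven E B P \<delta>" "split_cloven E' B' Q \<delta>'"
proof -
  obtain P \<delta> g Q \<delta>' where f: "f = ((P, \<delta>), g, (Q, \<delta>'))" by (metis prod.collapse)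
  have d: "split_cleavage P \<delta>" "split_cleavage Q \<delta>'" and g: "g \<in> C1 CAT2" "s1 CAT2 g = P" "t1 CAT2 g = Q"
    "preserves_lifts (P, \<delta>) g (Q, \<delta>')"
    using assms by (simp_all add: f SCoFib_eq)
  obtain T S where T: "g = (P, T, S, Q)" using g by (cases g) simp
  obtain E B E' B' where sq: "square E B P E' B' Q T S" using g(1) unfolding T CAT2_C1 by blast
  then interpret square E B P E' B' Q T S .
  show ?thesis
    using that[OF f[unfolded T]] lift_square_iff[OF sq d] d g(4) T
      split_clovenI[OF P.functor_on_axioms] split_clovenI[OF Q.functor_on_axioms] by blast
qed

lemma SCoFib_C2E:
  fixes a :: "'u::infinite scofib \<times> 'u sq2 \<times> 'u scofib"
  assumes "a \<in> C2 SCoFib"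
  obtains E B P \<delta> E' B' Q \<delta>' T S T' S' \<beta> \<alpha> where "a = ((P, \<delta>), (P, \<beta>, \<alpha>, Q), (Q, \<delta>'))"
    "square2 E B P E' B' Q T S T' S' \<beta> \<alpha>"
    "lift_square E B P \<delta> E' B' Q \<delta>' T S" "lift_square E B P \<delta> E' B' Q \<delta>' T' S'"
proof -
  obtain P \<delta> g Q \<delta>' where a: "a = ((P, \<delta>), g, (Q, \<delta>'))" by (metis prod.collapse)
  have d: "split_cleavage P \<delta>" "split_cleavage Q \<delta>'" and g: "g \<in> C2 CAT2" "s1 CAT2 (s2 CAT2 g) = P"
      "t1 CAT2 (s2 CAT2 g) = Q"
    "preserves_lifts (P, \<delta>) (s2 CAT2 g) (Q, \<delta>')" "preserves_lifts (P, \<delta>) (t2 CAT2 g) (Q, \<delta>')"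
    using assms by (simp_all add: a SCoFib_eq)
  obtain \<beta> \<alpha> where T: "g = (P, \<beta>, \<alpha>, Q)" using g by (cases g) simp
  obtain E B E' B' T S T' S' where sq: "square2 E B P E' B' Q T S T' S' \<beta> \<alpha>"
    using g(1) unfolding T CAT2_C2 by blast
  then interpret square2 E B P E' B' Q T S T' S' \<beta> \<alpha> .
  have "preserves_lifts (P, \<delta>) (P, T, S, Q) (Q, \<delta>')" "preserves_lifts (P, \<delta>) (P, T', S', Q) (Q, \<delta>')"
    using g(4,5) by (simp_all add: T)
  then show ?thesis
    using that[OF a[unfolded T] sq] lift_square_iff[OF F.square_axioms d]
        lift_square_iff[OF G.square_axioms d] by blast
qed

section \<open>Unit, counit and the triangle identities\<close>

lemma comma_unit_in:
  assumes "P \<in> C0 CAT2"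
  shows "comma_unit P \<in> C1 CAT2"
proof -
  obtain E B where P: "functor_on E B P" "locally_small E" "locally_small B"
    using assms by (auto simp: CAT2_C0)
  interpret comma_functor E B P using P by (simp add: comma_functor_def)
  show ?thesis
    using square_HF locally_small_comma[OF P] P unfolding comma_unit_def CAT2_C1 by auto
qed

lemma two_natural_unit:
  "two_natural (CAT2 :: ('u::infinite func, 'u sq, 'u sq2) twocat) CAT2 tf_id
      (tf_comp (forget fst) Free) comma_unit"
proof -
  interpret K: two_category "CAT2 :: ('u func, 'u sq, 'u sq2) twocat" by (rule two_category_CAT2)
  interpret I: two_functor "CAT2 :: ('u func, 'u sq, 'u sq2) twocat" CAT2 tf_id by (rule K.two_functor_id)
  interpret T: two_functor "CAT2 :: ('u func, 'u sq, 'u sq2) twocat" CAT2 "tf_comp (forget fst) Free"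
    by (rule two_functor_comp[OF two_functor_Free two_functor_forget_SCoFib])
  show ?thesis
  proof (unfold_locales, goal_cases)
    case (1 P)
    then show ?case by (rule comma_unit_in)
  next
    case (4 f)
    obtain P T S Q where f: "f = (P, T, S, Q)" by (cases f)
    with 4 obtain E B E' B' where "square E B P E' B' Q T S" by (auto simp: CAT2_C1)
    then interpret square E B P E' B' Q T S .
    show ?case by (simp add: f comma_unit_def HF_natural fcomp_idf[OF S.functor_on_axioms])
  next
    case (5 a)
    obtain P \<beta> \<alpha> Q where a: "a = (P, \<beta>, \<alpha>, Q)" by (cases a)
    with 5 obtain E B E' B' T S T' S' where "square2 E B P E' B' Q T S T' S' \<beta> \<alpha>"
      by (auto simp: CAT2_C2)
    then interpret square2 E B P E' B' Q T S T' S' \<beta> \<alpha> .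
    show ?case by (simp add: a comma_unit_def HF_natural2 hcomp_id2_idf[OF \<alpha>.ntrans_on_axioms])
  qed (simp_all add: comma_unit_def)
qed

lemma free_counit_in:
  fixes Z :: "'u::infinite scofib"
  assumes "Z \<in> C0 SCoFib"
  shows "free_counit Z \<in> C1 SCoFib"
proof -
  obtain E B P \<delta> where Z: "Z = (P, \<delta>)" "P \<in> C0 CAT2" "split_cloven E B P \<delta>" "locally_small E"
      "locally_small B"
    using assms by (rule SCoFib_C0E)
  interpret split_cloven E B P \<delta> by fact
  have "(CodF P, LF P \<delta>, idf B, P) \<in> C1 CAT2"
    using square_LF locally_small_comma[OF functor_on_axioms] Z(4,5) unfolding CAT2_C1 by auto
  then show ?thesis
    using Z(2) split_cleavage_axioms preserves_lifts_LF Free_obj[OF Z(2)] by (simp add: Z(1) SCoFib_eq)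
qed

lemma two_natural_counit:
  "two_natural (SCoFib :: 'u::infinite scofib_twocat) SCoFib (tf_comp Free (forget fst)) tf_id free_counit"
proof -
  interpret A: two_category "SCoFib :: 'u scofib_twocat" by (rule two_category_SCoFib)
  interpret I: two_functor "SCoFib :: 'u scofib_twocat" SCoFib tf_id by (rule A.two_functor_id)
  interpret T: two_functor "SCoFib :: 'u scofib_twocat" SCoFib "tf_comp Free (forget fst)"
    by (rule two_functor_comp[OF two_functor_forget_SCoFib two_functor_Free])
  show ?thesis
  proof (unfold_locales, goal_cases)
    case (1 Z)
    then show ?case by (rule free_counit_in)
  next
    case (2 Z)
    then show ?case by (cases Z) (simp add: SCoFib_eq)
  next
    case (3 Z)
    then show ?case by (cases Z) (simp add: SCoFib_eq)
  next
    case (4 f)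
    then obtain E B P \<delta> E' B' Q \<delta>' T S where f: "f = ((P, \<delta>), (P, T, S, Q), (Q, \<delta>'))"
      and "lift_square E B P \<delta> E' B' Q \<delta>' T S" by (rule SCoFib_C1E)
    then interpret lift_square E B P \<delta> E' B' Q \<delta>' T S by simp
    show ?case by (simp add: f SCoFib_eq LF_natural fcomp_idf[OF S.functor_on_axioms])
  next
    case (5 a)
    then obtain E B P \<delta> E' B' Q \<delta>' T S T' S' \<beta> \<alpha> where a: "a = ((P, \<delta>), (P, \<beta>, \<alpha>, Q), (Q, \<delta>'))"
      and sq: "square2 E B P E' B' Q T S T' S' \<beta> \<alpha>"
        "lift_square E B P \<delta> E' B' Q \<delta>' T S" "lift_square E B P \<delta> E' B' Q \<delta>' T' S'" by (rule SCoFib_C2E)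
    interpret square2 E B P E' B' Q T S T' S' \<beta> \<alpha> by fact
    show ?case
      by (simp add: a SCoFib_eq LF_natural2[OF sq(2,3,1)] hcomp_id2_idf[OF \<alpha>.ntrans_on_axioms])
  qed
qed

lemma two_adjunction_Free:
  "two_adjunction (SCoFib :: 'u::infinite scofib_twocat) CAT2 Free (forget fst) comma_unit free_counit"
proof -
  interpret F: two_functor "CAT2 :: ('u func, 'u sq, 'u sq2) twocat" SCoFib Free by (rule two_functor_Free)
  interpret U: two_functor "SCoFib :: 'u scofib_twocat" CAT2 "forget fst"
      by (rule two_functor_forget_SCoFib)
  interpret \<eta>: two_natural "CAT2 :: ('u func, 'u sq, 'u sq2) twocat"
      CAT2 tf_id "tf_comp (forget fst) Free" comma_unit
    by (rule two_natural_unit)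
  interpret \<epsilon>: two_natural "SCoFib :: 'u scofib_twocat" SCoFib "tf_comp Free (forget fst)" tf_id free_counit
    by (rule two_natural_counit)
  show ?thesis
  proof (unfold_locales, goal_cases)
    case (1 P)
    then obtain E B where P: "functor_on E B P" by (auto simp: CAT2_C0)
    then interpret comma_functor E B P by (simp add: comma_functor_def)
    show ?case
      by (simp add: SCoFib_eq comma_unit_def LF_free MF_bar_HF
          fcomp_idf[OF functor_on_idf[OF B.category_axioms]])
  next
    case (2 Z)
    then obtain E B P \<delta> where Z: "Z = (P, \<delta>)" and "split_cloven E B P \<delta>" by (rule SCoFib_C0E)
    then interpret split_cloven E B P \<delta> by simp
    show ?case
      by (simp add: Z comma_unit_def LF_HF fcomp_idf[OF functor_on_idf[OF B.category_axioms]])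
  qed
qed

section \<open>From strict algebras to split cleavages\<close>

text \<open>The top components of a strict action whose base component is already known to be an
  identity; \<open>over\<close> is commutativity of the action square.\<close>

locale strict_algebra = comma_functor E B P + L: functor_on "comma P" E L
  for E B :: "'u::infinite cat" and P L +
  assumes over: "fcomp P L = CodF P"
    and unit: "fcomp L (HF P) = idf E"
    and mult: "fcomp L (MF P) = fcomp L (bar (CodF P, L, idf B, P))"
begin

lemma over_ob: "z \<in> comma_ob P \<Longrightarrow> fob P (fob L z) = tgt B (usnd z)"
  using arg_cong[OF over, of "\<lambda>F. fob F z"] by (simp add: fcomp_simps)

lemma over_ar: "a \<in> comma_ar P \<Longrightarrow> far P (far L a) = cbot a"
  using arg_cong[OF over, of "\<lambda>F. far F a"] by (simp add: fcomp_simps)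

lemma unit_ob: "x \<in> Ob E \<Longrightarrow> fob L (upair x (ide B (fob P x))) = x"
  using arg_cong[OF unit, of "\<lambda>F. fob F x"] by (simp add: fcomp_simps)

lemma unit_ar:
  "\<lbrakk>f \<in> Ar E; src E f = x; tgt E f = y\<rbrakk>
    \<Longrightarrow> far L (carr (upair x (ide B (fob P x))) f (far P f) (upair y (ide B (fob P y)))) = f"
  using arg_cong[OF unit, of "\<lambda>F. far F f"] by (auto simp: fcomp_simps)

lemma mult_ar:
  assumes "carr (upair z v) a s (upair z' v') \<in> comma_ar (CodF P)"
  shows "far L (carr (upair (ufst z) (cmp B v (usnd z))) (ctop a) s (upair (ufst z') (cmp B v' (usnd z'))))
    = far L (carr (upair (fob L z) v) (far L a) s (upair (fob L z') v'))"
  using arg_cong[OF mult, of "\<lambda>F. far F (carr (upair z v) a s (upair z' v'))"] assms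
    comma_CodF_arD(4)[OF assms] comma_CodF_obD(2)[OF comma_CodF_arD(1)[OF assms]]
    comma_CodF_obD(2)[OF comma_CodF_arD(2)[OF assms]]
  by (simp add: fcomp_simps)

text \<open>The chosen lift of \<open>u\<close> at \<open>x\<close> is the image under the action of \<open>(1, u) : (x, 1) \<rightarrow> (x, u)\<close>.\<close>

definition lift :: "'u lifts" where
  "lift x u = (if x \<in> Ob E \<and> u \<in> Ar B \<and> src B u = fob P x
     then far L (carr (upair x (ide B (fob P x))) (ide E x) u (upair x u)) else undefined)"

lemma lift_ar_in:
  "\<lbrakk>x \<in> Ob E; u \<in> Ar B; src B u = fob P x\<rbrakk>
    \<Longrightarrow> carr (upair x (ide B (fob P x))) (ide E x) u (upair x u) \<in> comma_ar P"
  by (simp add: comma_ar_iff)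

lemma lift_props:
  assumes "x \<in> Ob E" "u \<in> Ar B" "src B u = fob P x"
  shows "lift x u = far L (carr (upair x (ide B (fob P x))) (ide E x) u (upair x u))"
    "lift x u \<in> Ar E" "src E (lift x u) = x" "tgt E (lift x u) = fob L (upair x u)" "far P (lift x u) = u"
  using assms lift_ar_in[OF assms] by (simp_all add: lift_def unit_ob over_ar)

text \<open>The key to uniqueness of factorizations: by the multiplication law the action sends
  \<open>(lift x u, 1) : (x, u) \<rightarrow> (u\<^sub>!x, 1)\<close> to an identity, since it is the image under \<open>C L\<close> of an
  arrow that \<open>M\<close> sends to an identity.\<close>

lemma far_action_lift:
  assumes xu: "x \<in> Ob E" "u \<in> Ar B" "src B u = fob P x"
  shows "far L (carr (upair x u) (lift x u) (ide B (tgt B u)) (upair (fob L (upair x u)) (ide B (tgt B u))))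
    = ide E (fob L (upair x u))"
proof -
  let ?z = "upair x (ide B (fob P x))" and ?w = "upair x u" and ?i = "ide B (tgt B u)"
  let ?a = "carr ?z (ide E x) u ?w"
  \<comment> \<open>This is ((1, u), 1) : ((x, 1), u) -> ((x, u), 1). M sends both of its endpoints
    to (x, u), while the bar of L turns its top component (1, u) into the lift.\<close>
  have "carr (upair ?z u) ?a ?i (upair ?w ?i) \<in> comma_ar (CodF P)"
    using xu lift_ar_in[OF xu] by (simp add: comma_ar_iff[of _ _ _ _ "CodF P"])
  from mult_ar[OF this] show ?thesis
    using xu L.functor_simps(5)[of ?w] by (simp add: lift_props(1)[OF xu] unit_ob)
qed

text \<open>The arrow inside L is (h, P h) after (lift, 1). The action sends the second factor to an
  identity and, by the unit law, the first to h. Hence h is determined by its composite with the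
  lift and by P h.\<close>

lemma lift_factor:
  assumes xu: "x \<in> Ob E" "u \<in> Ar B" "src B u = fob P x"
    and h: "h \<in> Ar E" "src E h = fob L (upair x u)"
  shows "far L (carr (upair x u) (cmp E h (lift x u)) (far P h)
      (upair (tgt E h) (ide B (fob P (tgt E h))))) = h"
proof -
  let ?w = "upair x u" and ?i = "ide B (tgt B u)"
  have w: "?w \<in> comma_ob P" using xu by simp
  have x': "fob P (fob L ?w) = tgt B u" using over_ob[OF w] by simp
  note l = lift_props[OF xu]
  let ?a = "carr ?w (lift x u) ?i (upair (fob L ?w) ?i)"
  let ?b = "carr (upair (fob L ?w) ?i) h (far P h) (upair (tgt E h) (ide B (fob P (tgt E h))))"
  have a: "?a \<in> comma_ar P" using xu l w by (simp add: comma_ar_iff x')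
  have b: "?b \<in> comma_ar P" using unit_ar_in[OF h refl] by (simp add: x')
  have "cmp E (far L ?b) (far L ?a) = far L (cmp (comma P) ?b ?a)"
    using a b by (subst L.functor_simps(6)) simp_all
  also have "cmp (comma P) ?b ?a
      = carr ?w (cmp E h (lift x u)) (far P h) (upair (tgt E h) (ide B (fob P (tgt E h))))"
    using a b h by (simp add: x')
  finally show ?thesis
    using far_action_lift[OF xu] unit_ar[OF h refl] h by (simp add: x')
qed

lemma cloven_lift: "cloven E B P lift"
proof (rule clovenI[OF functor_on_axioms], unfold_locales, goal_cases)
  case (1 x u)
  then show ?case by (auto simp: lift_def)
next
  case (2 x u)
  then show ?case by (simp add: lift_props(3))
next
  case (3 x u)
  then have xu: "x \<in> Ob E" "u \<in> Ar B" "src B u = fob P x" by simp_all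
  note l = lift_props[OF xu]
  have w: "upair x u \<in> comma_ob P" using xu by simp
  show ?case
    unfolding cocartesian_iff
  proof (intro conjI allI impI)
    fix g v
    assume "g \<in> Ar E \<and> src E g = src E (lift x u) \<and> v \<in> Ar B \<and> src B v = fob P (tgt E (lift x u))
      \<and> far P g = cmp B v (far P (lift x u))"
    then have g: "g \<in> Ar E" "src E g = x" and v: "v \<in> Ar B" "src B v = tgt B u" "far P g = cmp B v u"
      using l over_ob[OF w] by auto
    define y where "y = tgt E g"
    let ?y = "upair y (ide B (fob P y))"
    have y: "y \<in> Ob E" "fob P y = tgt B v"
      using g(1) functor_simps(4)[OF g(1)] v xu by (simp_all add: y_def)
    let ?a = "carr (upair x (ide B (fob P x))) (ide E x) u (upair x u)"
    \<comment> \<open>The required factorization is L (g, v). Precomposed with the lift L (1, u) it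
      becomes L (g, P g) : (x, 1) -> (y, 1) under L, which is g by the unit law.\<close>
    let ?b = "carr (upair x u) g v ?y"
    have a: "?a \<in> comma_ar P" using lift_ar_in[OF xu] .
    have b: "?b \<in> comma_ar P" using xu g v y by (simp add: comma_ar_iff flip: y_def)
    have "cmp E (far L ?b) (lift x u) = far L (cmp (comma P) ?b ?a)"
      unfolding l(1) using a b by (subst L.functor_simps(6)) simp_all
    also have "cmp (comma P) ?b ?a = carr (upair x (ide B (fob P x))) g (far P g) ?y"
      using a b g v by simp
    also have "far L \<dots> = g"
      using unit_ar[OF g y_def[symmetric]] .
    finally have bg: "cmp E (far L ?b) (lift x u) = g" .
    show "\<exists>!h. h \<in> Ar E \<and> src E h = tgt E (lift x u) \<and> tgt E h = tgt E g \<and> cmp E h (lift x u) = g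
        \<and> far P h = v"
    proof (rule ex1I[of _ "far L ?b"], goal_cases)
      case 1
      show ?case using b bg y unit_ob[OF y(1)] by (simp add: l(2-) over_ar flip: y_def)
    next
      case (2 h)
      then show ?case using lift_factor[OF xu, of h] by (auto simp: l(2-) y_def)
    qed
  qed (simp add: l(2))
next
  case (4 x u)
  then show ?case by (simp add: lift_props(5))
qed

text \<open>Normality is the unit law at an identity. For splitness, (1, vu) decomposes as (1, v)(1,
  u) in the comma category, and the multiplication law identifies L of the first factor with the
  lift of v at u_!x.\<close>

lemma split_cleavage_lift: "split_cleavage P lift"
proof -
  interpret C: cloven E B P lift by (rule cloven_lift)
  show ?thesis
  proof (rule C.split_cleavageI, goal_cases)
    case (1 x)
    then show ?case using unit_ar[of "ide E x" x x] by (simp add: lift_props)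
  next
    case (2 x u v)
    then have xu: "x \<in> Ob E" "u \<in> Ar B" "src B u = fob P x" and v: "v \<in> Ar B" "src B v = tgt B u"
        by simp_all
    let ?w = "upair x u"
    have w: "?w \<in> comma_ob P" using xu by simp
    have y: "fob L ?w \<in> Ob E" "fob P (fob L ?w) = tgt B u" using w over_ob[OF w] by simp_all
    let ?a = "carr (upair x (ide B (fob P x))) (ide E x) u ?w" and ?b
        = "carr ?w (ide E x) v (upair x (cmp B v u))"
    have a: "?a \<in> comma_ar P" using lift_ar_in[OF xu] .
    have b: "?b \<in> comma_ar P" using free_lifts_in[OF w v(1)] v by simp
    \<comment> \<open>This arrow is (1, v) : ((x, u), 1) -> ((x, u), v). M sends it to
      \<open>?b\<close>, and the bar of L sends it to (1, v) : (u_!x, 1) -> (u_!x, v).\<close>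
    have "carr (upair ?w (ide B (tgt B u))) (ide (comma P) ?w) v (upair ?w v) \<in> comma_ar (CodF P)"
      using comma_ide_in[OF w] w v xu by (simp add: comma_ar_iff[of _ _ _ _ "CodF P"])
    from mult_ar[OF this]
    have "far L ?b = far L (carr (upair (fob L ?w) (ide B (tgt B u))) (far L (ide (comma P) ?w)) v
        (upair (fob L ?w) v))"
      using xu by simp
    also have "far L (ide (comma P) ?w) = ide E (fob L ?w)" using w L.functor_simps(5)[of ?w] by simp
    finally have lb: "far L ?b = lift (fob L ?w) v"
      using y v by (simp add: lift_props)
    have "lift x (cmp B v u) = far L (cmp (comma P) ?b ?a)"
      using xu v a b by (simp add: lift_props)
    also have "\<dots> = cmp E (far L ?b) (far L ?a)" using a b by (subst L.functor_simps(6)) simp_all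
    finally show ?case by (simp add: lb lift_props(4)[OF xu] flip: lift_props(1)[OF xu])
  qed
qed

text \<open>The defining equation of the functor attached to \<open>lift\<close> is L applied to an
  identity in the comma category, so L itself is that functor. This gives surjectivity of the
  comparison on objects.\<close>

lemma LF_lift: "LF P lift = L"
proof -
  interpret C: cloven E B P lift by (rule cloven_lift)
  have "lift_action P lift L"
    unfolding lift_action_def
  proof (intro conjI ballI)
    show "functor_on (comma P) (fdom P) L" using L.functor_on_axioms by simp
  next
    fix z assume "z \<in> comma_ob P"
    then show "fob L z = tgt (fdom P) (lift (ufst z) (usnd z))" by (simp add: lift_props(4))
  next
    fix a assume a [simp]: "a \<in> comma_ar P"
    show "far P (far L a) = cbot a" by (simp add: over_ar)
    let ?x = "ufst (csrc a)" and ?y = "ufst (ctgt a)"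
    let ?b = "carr (upair ?x (ide B (fob P ?x))) (ide E ?x) (usnd (csrc a)) (csrc a)"
    let ?c = "carr (upair ?y (ide B (fob P ?y))) (ide E ?y) (usnd (ctgt a)) (ctgt a)"
    let ?d = "carr (upair ?x (ide B (fob P ?x))) (ctop a) (far P (ctop a)) (upair ?y (ide B (fob P ?y)))"
    have b: "?b \<in> comma_ar P" using lift_ar_in[of ?x "usnd (csrc a)"] by simp
    have c: "?c \<in> comma_ar P" using lift_ar_in[of ?y "usnd (ctgt a)"] by simp
    have d: "?d \<in> comma_ar P" using unit_ar_in[of "ctop a"] by simp
    have "cmp E (far L a) (far L ?b) = far L (cmp (comma P) a ?b)" using b
        by (subst L.functor_simps(6)) simp_all
    \<comment> \<open>For \<open>a\<close> = (f, v) : (x, u) -> (y, w) this is (f, v)(1, u) = (1,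
      w)(f, P f), valid because v u = w P f.\<close>
    also have "cmp (comma P) a ?b = cmp (comma P) ?c ?d" using b c d comma_square[OF a] by simp
    also have "far L \<dots> = cmp E (far L ?c) (far L ?d)" using c d by (subst L.functor_simps(6)) simp_all
    finally show "cmp (fdom P) (far L a) (lift ?x (usnd (csrc a)))
        = cmp (fdom P) (lift ?y (usnd (ctgt a))) (ctop a)"
      using unit_ar[of "ctop a"] by (simp add: lift_props)
  qed
  then show ?thesis by (rule C.LF_eqI)
qed

end

section \<open>Strict actions versus split cleavages, and the comparison isomorphism\<close>

lemma comma_monad_simps [simp]:
  "mfun comma_monad = comma_twofun" "munit comma_monad = comma_unit" "mmult comma_monad = comma_mult"
  "F0 comma_twofun P = CodF P"
  "F1 comma_twofun (P, T, S, Q) = (CodF P, bar (P, T, S, Q), S, CodF Q)"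
  "F2 comma_twofun (P, \<beta>, \<alpha>, Q) = (CodF P, bar2 (P, \<beta>, \<alpha>, Q), \<alpha>, CodF Q)"
  by (simp_all add: comma_monad_def comma_twofun_def)

lemma comma_algebraE:
  assumes "(P, a) \<in> algebras CAT2 comma_monad"
  obtains E B L where "a = (CodF P, L, idf (fcod P), P)" "P \<in> C0 CAT2" "strict_algebra E B P L"
proof -
  have P: "P \<in> C0 CAT2" and a: "a \<in> C1 CAT2" "s1 CAT2 a = CodF P" "t1 CAT2 a = P"
    and unit: "comp1 CAT2 a (comma_unit P) = id1 CAT2 P"
    and mult: "comp1 CAT2 a (comma_mult P) = comp1 CAT2 a (F1 comma_twofun a)"
    using assms by (simp_all add: algebras_def)
  obtain E B where "functor_on E B P" using P by (auto simp: CAT2_C0)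
  then interpret comma_functor E B P by (simp add: comma_functor_def)
  obtain L S where aL: "a = (CodF P, L, S, P)" using a by (cases a) simp
  obtain C D E' B' where sq: "square C D (CodF P) E' B' P L S" using a(1) unfolding aL CAT2_C1 by blast
  have [simp]: "C = comma P" "D = B" "E' = E" "B' = B"
    using sq by (auto simp: square_def comma_functor_def functor_on_iff)
  interpret sq: square "comma P" B "CodF P" E B P L S using sq by simp
  \<comment> \<open>The base component of the unit law reads S 1 = 1.\<close>
  have S: "S = idf B"
    using unit by (simp add: aL comma_unit_def fcomp_idf[OF sq.S.functor_on_axioms])
  have "fcomp P L = CodF P"
    using sq.commutes by (simp add: S fcomp_idf[OF functor_on_CodF])
  moreover have "fcomp L (HF P) = idf E" using unit by (simp add: aL comma_unit_def)
  moreover have "fcomp L (MF P) = fcomp L (bar (CodF P, L, idf B, P))"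
    using mult by (simp add: aL comma_mult_def S)
  ultimately have "strict_algebra E B P L"
    using comma_functor_axioms sq.T.functor_on_axioms
    by (simp add: strict_algebra_def strict_algebra_axioms_def)
  then show ?thesis using that P aL S by simp
qed

text \<open>In the defining equation of L at (1, u) : (x, 1) -> (x, u) the first lift is an identity
  by normality. Hence the lifts can be recovered from L.\<close>

lemma (in split_cloven) lift_eq_LF:
  assumes "x \<in> Ob E" "u \<in> Ar B" "src B u = fob P x"
  shows "\<delta> x u = far (LF P \<delta>) (carr (upair x (ide B (fob P x))) (ide E x) u (upair x u))"
proof -
  have a: "carr (upair x (ide B (fob P x))) (ide E x) u (upair x u) \<in> comma_ar P"
    using assms by (simp add: comma_ar_iff)
  show ?thesis using LF_simps(3-)[OF a] assms by simp
qed

text \<open>On legitimate arguments \<open>lift_eq_LF\<close> recovers the lift; elsewhere both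
  cleavages are \<open>undefined\<close>.\<close>

lemma LF_inj:
  assumes "split_cloven E B P \<delta>" "split_cloven E B P \<delta>'" "LF P \<delta> = LF P \<delta>'"
  shows "\<delta> = \<delta>'"
proof -
  interpret d: split_cloven E B P \<delta> by fact
  interpret d': split_cloven E B P \<delta>' by fact
  have "\<delta> x u = \<delta>' x u" for x u
  proof (cases "x \<in> Ob E \<and> u \<in> Ar B \<and> src B u = fob P x")
    case True
    then show ?thesis by (simp add: d.lift_eq_LF d'.lift_eq_LF assms(3))
  next
    case False
    then show ?thesis using d.lift_ext[of x u] d'.lift_ext[of x u] by auto
  qed
  then show ?thesis by blast
qed

text \<open>For the converse, the equation of functors is evaluated at (1, u) : (x, 1) -> (x, u),
  where both actions yield chosen lifts.\<close>

lemma preserves_lifts_iff_LF: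
  assumes "split_cloven E B P \<delta>" "split_cloven E' B' Q \<delta>'" "square E B P E' B' Q T S"
  shows "preserves_lifts (P, \<delta>) (P, T, S, Q) (Q, \<delta>')
    \<longleftrightarrow> fcomp T (LF P \<delta>) = fcomp (LF Q \<delta>') (bar (P, T, S, Q))"
proof
  interpret P: split_cloven E B P \<delta> by fact
  interpret Q: split_cloven E' B' Q \<delta>' by fact
  interpret square E B P E' B' Q T S by fact
  show "fcomp T (LF P \<delta>) = fcomp (LF Q \<delta>') (bar (P, T, S, Q))"
    if "preserves_lifts (P, \<delta>) (P, T, S, Q) (Q, \<delta>')"
    using that lift_square_iff[OF assms(3) P.split_cleavage_axioms Q.split_cleavage_axioms]
    by (simp add: lift_square.LF_natural)
  assume eq: "fcomp T (LF P \<delta>) = fcomp (LF Q \<delta>') (bar (P, T, S, Q))"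
  have "far T (\<delta> x u) = \<delta>' (fob T x) (far S u)" if xu: "x \<in> Ob E" "u \<in> Ar B" "src B u = fob P x" for x u
  proof -
    let ?a = "carr (upair x (ide B (fob P x))) (ide E x) u (upair x u)"
    have a: "?a \<in> comma_ar P" using xu by (simp add: comma_ar_iff)
    have "fdom (LF P \<delta>) = comma P" using P.LF_simps(1) by (simp add: functor_on_iff)
    then have "far T (far (LF P \<delta>) ?a) = far (LF Q \<delta>') (far (bar (P, T, S, Q)) ?a)"
      using arg_cong[OF eq, of "\<lambda>F. far F ?a"] a by (simp add: fcomp_simps)
    then show ?thesis
      using xu a by (simp add: P.lift_eq_LF Q.lift_eq_LF)
  qed
  then show "preserves_lifts (P, \<delta>) (P, T, S, Q) (Q, \<delta>')" by (simp add: preserves_lifts_def)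
qed

text \<open>A literal equality of records, so the results on the adjunction apply to the comma
  2-monad by rewriting.\<close>

lemma comma_twofun_eq: "comma_twofun = tf_comp (forget fst) Free"
  unfolding comma_twofun_def tf_comp_def forget_def Free_def by (auto simp: fun_eq_iff comma_twofun_def)

lemma comma_mult_eq:
  assumes "P \<in> C0 CAT2"
  shows "comma_mult P = (CodF (CodF P), LF (CodF P) (free_lifts P), idf (fcod P), CodF P)"
proof -
  obtain E B where "functor_on E B P" using assms by (auto simp: CAT2_C0)
  then interpret comma_functor E B P by (simp add: comma_functor_def)
  show ?thesis by (simp add: comma_mult_def LF_free)
qed

lemma two_monad_comma: "two_monad (CAT2 :: ('u::infinite func, 'u sq, 'u sq2) twocat) comma_monad"
  by (rule two_adjunction.two_monad_induced[OF two_adjunction_Free])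
    (simp_all add: comma_twofun_eq comma_mult_eq)

lemma L_action_simp [simp]: "L_action (P, \<delta>) = (CodF P, LF P \<delta>, idf (fcod P), P)"
  by (simp add: L_action_def)

lemma \<Gamma>_in_algebras:
  assumes "Z \<in> C0 SCoFib"
  shows "(fst Z, L_action Z) \<in> algebras CAT2 comma_monad"
  using two_adjunction.induced_algebra[OF two_adjunction_Free _ _ _ assms, where T = comma_monad]
  by (simp add: comma_twofun_eq comma_mult_eq free_counit_def)

text \<open>Injectivity is recovery of the lifts from L. Surjectivity uses the cleavage
  \<open>lift\<close> extracted from an action, whose functor is the action itself.\<close>

lemma bij_betw_\<Gamma>:
  "bij_betw (\<lambda>Z. (fst Z, L_action Z)) (C0 (SCoFib :: 'u::infinite scofib_twocat))
      (algebras CAT2 comma_monad)"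
proof (rule bij_betwI', goal_cases)
  case (1 Z Z')
  obtain E B P \<delta> where Z: "Z = (P, \<delta>)" "split_cloven E B P \<delta>" using 1(1) by (rule SCoFib_C0E)
  obtain E' B' P' \<delta>' where Z': "Z' = (P', \<delta>')" "split_cloven E' B' P' \<delta>'" using 1(2) by (rule SCoFib_C0E)
  have "E' = E \<and> B' = B" if "P' = P"
    using Z(2) Z'(2) that by (auto simp: split_cloven_def cloven_def comma_functor_def functor_on_iff)
  then show ?case using Z Z' LF_inj[of E B P \<delta> \<delta>'] by auto
next
  case (2 Z)
  then show ?case by (rule \<Gamma>_in_algebras)
next
  case (3 Y)
  obtain P a where Y: "Y = (P, a)" by (cases Y)
  obtain E B L where a: "a = (CodF P, L, idf (fcod P), P)" "P \<in> C0 CAT2" "strict_algebra E B P L"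
    using 3 Y by (auto elim: comma_algebraE)
  interpret strict_algebra E B P L by fact
  have "(P, lift) \<in> C0 SCoFib" using a(2) split_cleavage_lift by (simp add: SCoFib_eq)
  moreover have "Y = (fst (P, lift), L_action (P, lift))" using Y a(1) by (simp add: LF_lift)
  ultimately show ?case by blast
qed

lemma two_iso_over_\<Gamma>:
  "two_iso_over (CAT2 :: ('u::infinite func, 'u sq, 'u sq2) twocat)
    SCoFib (forget fst) (Alg_s CAT2 comma_monad) (forget fst) \<Gamma>"
  unfolding SCoFib_eq Alg_s_def
proof (rule two_iso_over_structured[OF structured_cells_SCoFib structured_cells_algebras, where g
    = "\<lambda>Z. (fst Z, L_action Z)"], goal_cases)
  case 1
  show ?case by (rule two_monad.axioms(1)[OF two_monad_comma])
next
  case 2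
  show ?case using bij_betw_\<Gamma> by (simp add: SCoFib_eq)
next
  case (3 Z)
  show ?case by simp
next
  case (4 Z f Z')
  obtain P \<delta> where Z: "Z = (P, \<delta>)" "split_cleavage P \<delta>" using 4(1) by (cases Z) auto
  obtain Q \<delta>' where Z': "Z' = (Q, \<delta>')" "split_cleavage Q \<delta>'" using 4(2) by (cases Z') auto
  obtain T S where f: "f = (P, T, S, Q)" using 4(4,5) Z Z' by (cases f) simp
  obtain E B E' B' where sq: "square E B P E' B' Q T S" using 4(3) unfolding f CAT2_C1 by blast
  then interpret square E B P E' B' Q T S .
  show ?case
    using preserves_lifts_iff_LF[OF split_clovenI split_clovenI sq] Z Z'
    by (simp add: f P.functor_on_axioms Q.functor_on_axioms fcomp_idf[OF S.functor_on_axioms])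
next
  case (5 Z a Z')
  \<comment> \<open>The boundary conditions supplied by \<open>two_iso_over_structured\<close> make
    both squares preserve lifts, as \<open>LF_natural2\<close> requires.\<close>
  have "(Z, a, Z') \<in> C2 SCoFib" using 5 by (simp add: SCoFib_eq)
  then obtain E B P \<delta> E' B' Q \<delta>' T S T' S' \<beta> \<alpha> where a: "(Z, a, Z') = ((P, \<delta>), (P, \<beta>, \<alpha>, Q), (Q, \<delta>'))"
      and sq: "square2 E B P E' B' Q T S T' S' \<beta> \<alpha>"
        "lift_square E B P \<delta> E' B' Q \<delta>' T S" "lift_square E B P \<delta> E' B' Q \<delta>' T' S'" by (rule SCoFib_C2E)
  interpret square2 E B P E' B' Q T S T' S' \<beta> \<alpha> by fact
  show ?case
    using a by (simp add: LF_natural2[OF sq(2,3,1)] hcomp_id2_idf[OF \<alpha>.ntrans_on_axioms])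
qed (simp_all add: \<Gamma>_def)

text \<open>U of the counit at Z is \<open>L_action Z\<close>, so the canonical comparison has the
  same tags as \<open>\<Gamma>\<close> and the same underlying cells.\<close>

lemma comparison_eq_\<Gamma>: "comparison SCoFib (forget fst) free_counit = \<Gamma>"
  unfolding comparison_def \<Gamma>_def Let_def free_counit_def SCoFib_eq by (simp add: fun_eq_iff)

theorem theorem4p8:
  shows "two_monad (CAT2 :: ('u::infinite func, 'u sq, 'u sq2) twocat) comma_monad
    \<and> two_iso_over (CAT2 :: ('u func, 'u sq, 'u sq2) twocat)
        SCoFib (forget fst) (Alg_s CAT2 comma_monad) (forget fst) \<Gamma>
    \<and> strictly_two_monadic SCoFib (CAT2 :: ('u func, 'u sq, 'u sq2) twocat)
        (forget fst) Free comma_unit free_counit comma_monad"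
proof -
  have "tm_eq CAT2 (induced_monad Free (forget fst) comma_unit free_counit) comma_monad"
    by (simp add: tm_eq_def tf_eq_def induced_monad_def comma_twofun_eq comma_mult_eq)
  then show ?thesis
    unfolding strictly_two_monadic_def comparison_eq_\<Gamma>
    using two_monad_comma two_iso_over_\<Gamma> two_adjunction_Free by blast
qed

end
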